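(* Let $n\ge 4$ and let $l$ be a real number with $1\le l\le \frac n2-1$. If $(u_0,u_1)\in (L^{1,1}(\mathbf{R}^n)\cap Y^{l+1})\times (L^{1,1}(\mathbf{R}^n)\cap Y^{l})$, then the solution $u$ of $u_{tt}+Lu+(I+L)^{-1}u_t=0$, $u(0,\cdot)=u_0$, $u_t(0,\cdot)=u_1$, satisfies $$\|u(t,\cdot)\|_{L^2(\mathbf{R}^n)}\le C\, I_{0,l}\, t^{-\frac{l+1}{2}}$$ for all sufficiently large $t$, where $C>0$ is a constant which depends only on $n$.
   Context: The Fourier transform is $\hat f(\xi)=\int_{\mathbf{R}^n}e^{-ix\cdot\xi}f(x)\,dx$ (extended to $L^2(\mathbf{R}^n)$). The operator $L$ on $L^2(\mathbf{R}^n)$ is the Fourier multiplier $\widehat{Lf}(\xi)=\log(1+|\xi|^2)\hat f(\xi)$ with its maximal domain. For $\delta\ge 0$, $Y^\delta=\{f\in L^2(\mathbf{R}^n):\int_{\mathbf{R}^n}(1+\log(1+|\xi|^2))^\delta|\hat f(\xi)|^2d\xi<\infty\}$, with norm $\|f\|_{Y^\delta}=\big(\int_{\mathbf{R}^n}(1+\log(1+|\xi|^2))^\delta|\hat f(\xi)|^2d\xi\big)^{1/2}$. $L^{1,1}(\mathbf{R}^n)=\{f\in L^1(\mathbf{R}^n):\|f\|_{1,1}:=\int_{\mathbf{R}^n}(1+|x|)|f(x)|dx<\infty\}$. Cauchy problem: $u_{tt}+Lu+(I+L)^{-1}u_t=0$ on $(0,\infty)\times\mathbf{R}^n$, $u(0,\cdot)=u_0$,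 $u_t(0,\cdot)=u_1$. For $(u_0,u_1)\in Y^2\times Y^1$ the solution is the unique weak solution $u\in C([0,\infty),Y^2)\cap C^1([0,\infty),Y^1)\cap C^2([0,\infty),L^2(\mathbf{R}^n))$; for a.e. $\xi$, $\hat u(t,\xi)$ solves $\hat u_{tt}+\log(1+|\xi|^2)\hat u+(1+\log(1+|\xi|^2))^{-1}\hat u_t=0$ with $\hat u(0,\xi)=\hat u_0(\xi)$, $\hat u_t(0,\xi)=\hat u_1(\xi)$. Notation: $I_{0,l}:=\sqrt{\|u_0\|_{1,1}^2+\|u_1\|_{1,1}^2+\|u_0\|_{Y^{l+1}}^2+\|u_1\|_{Y^l}^2}$. *)

theory Defs
  imports "HOL-Analysis.Analysis"
begin

text \<open>
  Elements of \<open>L\<^sup>2\<close> are represented by Borel functions, so all equations between them hold only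
  almost everywhere.
\<close>

type_synonym 'n cfun = "real^'n \<Rightarrow> complex"

definition L2 :: "('n::finite) cfun set" where
  "L2 = {f. f \<in> borel_measurable lborel \<and> integrable lborel (\<lambda>x. (norm (f x))\<^sup>2)}"

definition L2_norm :: "('n::finite) cfun \<Rightarrow> real" where
  "L2_norm f = sqrt (LINT x|lborel. (norm (f x))\<^sup>2)"

definition L11 :: "('n::finite) cfun set" where
  "L11 = {f. integrable lborel f \<and> integrable lborel (\<lambda>x. (1 + norm x) * norm (f x))}"

definition L11_norm :: "('n::finite) cfun \<Rightarrow> real" where
  "L11_norm f = (LINT x|lborel. (1 + norm x) * norm (f x))"

definition fourier_L1 :: "('n::finite) cfun \<Rightarrow> 'n cfun" where
  "fourier_L1 f \<xi> = (LINT x|lborel. exp (- \<i> * complex_of_real (x \<bullet> \<xi>)) * f x)"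

text \<open>
  The extension to \<open>L\<^sup>2\<close>: the limit in \<open>L\<^sup>2\<close> of the transforms of the truncations of \<open>f\<close> to balls,
  which are in \<open>L\<^sup>1 \<inter> L\<^sup>2\<close>.  The limit exists by Plancherel and is unique up to null sets; \<open>SOME\<close>
  picks a representative.  The convergence is stated with the nonnegative integral, which is
  infinite rather than \<open>0\<close> on functions that are not square integrable.
\<close>

definition fourier :: "('n::finite) cfun \<Rightarrow> 'n cfun" where
  "fourier f = (SOME g. g \<in> L2 \<and>
     ((\<lambda>R::real. \<integral>\<^sup>+\<xi>. ennreal ((norm (fourier_L1 (\<lambda>x. indicator (cball 0 R) x * f x) \<xi> - g \<xi>))\<^sup>2) \<partial>lborel)
        \<longlongrightarrow> 0) at_top)"

definition Y :: "real \<Rightarrow> ('n::finite) cfun set" where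
  "Y \<delta> = {f \<in> L2. integrable lborel
     (\<lambda>\<xi>. (1 + ln (1 + (norm \<xi>)\<^sup>2)) powr \<delta> * (norm (fourier f \<xi>))\<^sup>2)}"

definition Y_norm :: "real \<Rightarrow> ('n::finite) cfun \<Rightarrow> real" where
  "Y_norm \<delta> f = sqrt (LINT \<xi>|lborel. (1 + ln (1 + (norm \<xi>)\<^sup>2)) powr \<delta> * (norm (fourier f \<xi>))\<^sup>2)"

text \<open>
  The unbounded operator \<open>L\<close> and its resolvent \<open>(I + L)\<^sup>-\<^sup>1\<close> are given by their graphs:
  \<open>L_graph f g\<close> means that \<open>f\<close> is in the (maximal) domain of \<open>L\<close> and \<open>L f = g\<close>.
\<close>

definition L_graph :: "('n::finite) cfun \<Rightarrow> 'n cfun \<Rightarrow> bool" where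
  "L_graph f g \<longleftrightarrow> f \<in> L2 \<and> g \<in> L2 \<and>
     (AE \<xi> in lborel. fourier g \<xi> = complex_of_real (ln (1 + (norm \<xi>)\<^sup>2)) * fourier f \<xi>)"

definition IL_inv_graph :: "('n::finite) cfun \<Rightarrow> 'n cfun \<Rightarrow> bool" where
  "IL_inv_graph f h \<longleftrightarrow> (\<exists>g. L_graph h g \<and> f \<in> L2 \<and> (AE x in lborel. h x + g x = f x))"

text \<open>
  Continuity and differentiability on \<open>[0,\<infinity>)\<close> (one-sided at \<open>0\<close>) of curves with values in a
  function space \<open>X\<close> with norm \<open>N\<close>.
\<close>

definition curve_continuous ::
    "('n::finite) cfun set \<Rightarrow> ('n cfun \<Rightarrow> real) \<Rightarrow> (real \<Rightarrow> 'n cfun) \<Rightarrow> bool" where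
  "curve_continuous X N u \<longleftrightarrow> (\<forall>t\<ge>0. u t \<in> X) \<and>
     (\<forall>t\<ge>0. ((\<lambda>s. N (\<lambda>x. u s x - u t x)) \<longlongrightarrow> 0) (at t within {0..}))"

definition curve_derivative ::
    "('n::finite) cfun set \<Rightarrow> ('n cfun \<Rightarrow> real) \<Rightarrow> (real \<Rightarrow> 'n cfun) \<Rightarrow> (real \<Rightarrow> 'n cfun) \<Rightarrow> bool" where
  "curve_derivative X N u u' \<longleftrightarrow> (\<forall>t\<ge>0. u t \<in> X \<and> u' t \<in> X) \<and>
     (\<forall>t\<ge>0. ((\<lambda>s. N (\<lambda>x. (u s x - u t x) / complex_of_real (s - t) - u' t x)) \<longlongrightarrow> 0)
        (at t within {0..}))"

text \<open>
  Solutions \<open>u \<in> C([0,\<infinity>), Y\<^sup>2) \<inter> C\<^sup>1([0,\<infinity>), Y\<^sup>1) \<inter> C\<^sup>2([0,\<infinity>), L\<^sup>2)\<close> of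
  \<open>u\<^sub>t\<^sub>t + L u + (I + L)\<^sup>-\<^sup>1 u\<^sub>t = 0\<close>.  In this class every term of the equation is in \<open>L\<^sup>2\<close>, so
  the equation is required to hold in \<open>L\<^sup>2\<close> at every time.  The derivative of \<open>u\<close> in \<open>Y\<^sup>1\<close> is also
  its derivative in \<open>L\<^sup>2\<close>.
\<close>

definition is_solution ::
    "('n::finite) cfun \<Rightarrow> 'n cfun \<Rightarrow> (real \<Rightarrow> 'n cfun) \<Rightarrow> bool" where
  "is_solution u0 u1 u \<longleftrightarrow> (\<exists>ut utt.
     curve_continuous (Y 2) (Y_norm 2) u \<and>
     curve_derivative (Y 1) (Y_norm 1) u ut \<and> curve_continuous (Y 1) (Y_norm 1) ut \<and>
     curve_derivative L2 L2_norm ut utt \<and> curve_continuous L2 L2_norm utt \<and>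
     (\<forall>t>0. \<exists>Lu h. L_graph (u t) Lu \<and> IL_inv_graph (ut t) h \<and>
        (AE x in lborel. utt t x + Lu x + h x = 0)) \<and>
     (AE x in lborel. u 0 x = u0 x) \<and> (AE x in lborel. ut 0 x = u1 x))"

definition I0 :: "real \<Rightarrow> ('n::finite) cfun \<Rightarrow> 'n cfun \<Rightarrow> real" where
  "I0 l u0 u1 = sqrt ((L11_norm u0)\<^sup>2 + (L11_norm u1)\<^sup>2 + (Y_norm (l + 1) u0)\<^sup>2 + (Y_norm l u1)\<^sup>2)"

end

(*
  On the Fourier side the equation is, for each frequency, a damped oscillator
  w'' + m w + w' / (1 + m) = 0 with m = log(1 + |xi|^2).  With a = 1 / (1 + m), the quantity
  |w'|^2 + (m + a^2/2) |w|^2 + a <w', w> decays at least like exp(-c t), where c = a m / (2 (m + a^2))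
  is comparable to m at low and to a at high frequencies.  Suitably normalised, its coefficients are
  bounded in xi, so its integral over xi, weighted by exp(-c (T - t)), can be differentiated along
  differentiable curves in L^2; this needs neither uniqueness nor an explicit formula for the
  solution.  At low frequencies the transforms of the data are bounded by their L^1 norms and
  exp(-c t) is dominated by a Gaussian of integral const t^(-n/2); at high frequencies
  exp(-c t) <= const t^(-l-1) (1 + m)^(l+1) costs exactly the regularity of the data.
*)
theory Submission
  imports Defs "HOL-Probability.Characteristic_Functions"
begin

section \<open>Square integrable functions\<close>

text \<open>The energy comes from two multipliers. Testing w'' + m w + a w' = 0 with w' yields the
  derivative -2a |w'|^2 of |w'|^2 + m |w|^2, in which |w| is not dissipated. Adding a <w',w> with
  its correction a^2 |w|^2 / 2 turns the dissipation into a (|w'|^2 + m |w|^2). The whole energy is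
  at most 2 |w'|^2 + (m + a^2) |w|^2, so it decays at rate c as soon as 2c <= a and c (m + a^2) <= a
  m; this is what fixes c. The normaliser is m + a^2 as well. It is comparable to 1 + m = 1/a, so
  after division |w'|^2 carries a factor of order a, and this is why u_1 is measured with one order
  less than u_0. The other obstacle is \<open>fourier\<close> itself: it is a choice of an L^2
  limit, of which nothing is known until the limit is shown to exist. Plancherel's identity on the
  intersection of L^1 and L^2 therefore has to precede every use of it. The transform is
  unnormalised and multiplies L^2 norms by (2 pi)^(n/2). The condition l + 1 <= n/2 enters where the
  Gaussian's t^(-n/2) is compared with t^(-l-1).\<close>

lemma L2_measurable: "f \<in> L2 \<Longrightarrow> f \<in> borel_measurable borel"
  by (simp add: L2_def)

lemma L2_integrable: "f \<in> L2 \<Longrightarrow> integrable lborel (\<lambda>x. (norm (f x))\<^sup>2)"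
  by (simp add: L2_def)

lemma L2_norm_nonneg [simp]: "0 \<le> L2_norm f"
  by (simp add: L2_norm_def)

lemma L2_norm_power2: "(L2_norm f)\<^sup>2 = (LINT x|lborel. (norm (f x))\<^sup>2)"
  by (simp add: L2_norm_def)

lemma nn_integral_L2:
  assumes "f \<in> L2"
  shows "(\<integral>\<^sup>+x. ennreal ((norm (f x))\<^sup>2) \<partial>lborel) = ennreal ((L2_norm f)\<^sup>2)"
  using L2_integrable[OF assms] unfolding L2_norm_power2
  by (intro nn_integral_eq_integral) auto

text \<open>The hypothesis concerns the nonnegative integral because the Bochner integral of a
  non-integrable function is \<open>0\<close>, so that a bound on the latter would say nothing about
  membership in \<open>L2\<close>.\<close>

lemma L2I:
  fixes f :: "('n::finite) cfun"
  assumes "f \<in> borel_measurable borel" "(\<integral>\<^sup>+x. ennreal ((norm (f x))\<^sup>2) \<partial>lborel) \<le> ennreal K"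
  shows "f \<in> L2"
proof -
  have "(\<integral>\<^sup>+x. ennreal (norm ((norm (f x))\<^sup>2)) \<partial>lborel) < \<infinity>"
    using assms(2) by (simp add: order_le_less_trans)
  then show ?thesis
    using assms(1) unfolding L2_def by (auto simp: integrable_iff_bounded)
qed

lemma L2_norm_leI:
  fixes f :: "('n::finite) cfun"
  assumes "f \<in> borel_measurable borel" "(\<integral>\<^sup>+x. ennreal ((norm (f x))\<^sup>2) \<partial>lborel) \<le> ennreal (K\<^sup>2)" "0 \<le> K"
  shows "L2_norm f \<le> K"
proof -
  have "ennreal ((L2_norm f)\<^sup>2) \<le> ennreal (K\<^sup>2)"
    using nn_integral_L2[OF L2I[OF assms(1,2)]] assms(2) by simp
  then have "(L2_norm f)\<^sup>2 \<le> K\<^sup>2" by (simp add: ennreal_le_iff)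
  then show ?thesis using assms(3) by (rule power2_le_imp_le)
qed

lemma L2_norm_cong_AE:
  fixes f g :: "('n::finite) cfun"
  assumes "f \<in> borel_measurable borel" "g \<in> borel_measurable borel" "AE x in lborel. f x = g x"
  shows "L2_norm f = L2_norm g"
  unfolding L2_norm_def using assms by (auto intro!: arg_cong[where f=sqrt] integral_cong_AE)

lemma L2_bounded_mult:
  fixes f :: "('n::finite) cfun" and \<phi> :: "'n cfun"
  assumes f: "f \<in> L2" and m: "\<phi> \<in> borel_measurable borel" and b: "\<And>x. norm (\<phi> x) \<le> K"
  shows "(\<lambda>x. \<phi> x * f x) \<in> L2" "L2_norm (\<lambda>x. \<phi> x * f x) \<le> K * L2_norm f"
proof -
  have K: "0 \<le> K" using b[of undefined] by (meson norm_ge_zero order_trans)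
  have meas: "(\<lambda>x. \<phi> x * f x) \<in> borel_measurable borel"
    using L2_measurable[OF f] m by measurable
  have "(\<integral>\<^sup>+x. ennreal ((norm (\<phi> x * f x))\<^sup>2) \<partial>lborel) \<le> (\<integral>\<^sup>+x. ennreal (K\<^sup>2) * ennreal ((norm (f x))\<^sup>2) \<partial>lborel)"
    by (intro nn_integral_mono) (auto simp: norm_mult power_mult_distrib ennreal_mult[symmetric]
      intro!: ennreal_leI mult_right_mono power_mono b)
  also have "\<dots> = ennreal (K\<^sup>2) * ennreal ((L2_norm f)\<^sup>2)"
    using L2_measurable[OF f] by (subst nn_integral_cmult) (auto simp: nn_integral_L2[OF f])
  also have "\<dots> = ennreal ((K * L2_norm f)\<^sup>2)"
    by (simp add: ennreal_mult[symmetric] power_mult_distrib)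
  finally have le: "(\<integral>\<^sup>+x. ennreal ((norm (\<phi> x * f x))\<^sup>2) \<partial>lborel) \<le> ennreal ((K * L2_norm f)\<^sup>2)" .
  show "(\<lambda>x. \<phi> x * f x) \<in> L2" by (rule L2I[OF meas le])
  show "L2_norm (\<lambda>x. \<phi> x * f x) \<le> K * L2_norm f"
    by (rule L2_norm_leI[OF meas le]) (simp add: K)
qed

lemma L2_cmult: "f \<in> L2 \<Longrightarrow> (\<lambda>x. c * f x) \<in> L2"
  by (rule L2_bounded_mult(1)[where K="norm c"]) auto

lemma L2_norm_cmult: "L2_norm (\<lambda>x. c * f x) = norm c * L2_norm f"
  by (simp add: L2_norm_def norm_mult power_mult_distrib real_sqrt_mult)

lemma L2_norm_minus: "L2_norm (\<lambda>x. - f x) = L2_norm f"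
  by (simp add: L2_norm_def)

lemma norm_add_power2_le:
  fixes a b :: "'a::real_normed_vector"
  shows "(norm (a + b))\<^sup>2 \<le> 2 * (norm a)\<^sup>2 + 2 * (norm b)\<^sup>2"
proof -
  have "(norm (a + b))\<^sup>2 \<le> (norm a + norm b)\<^sup>2"
    by (intro power_mono norm_triangle_ineq) auto
  also have "\<dots> \<le> 2 * (norm a)\<^sup>2 + 2 * (norm b)\<^sup>2"
    using sum_squares_bound[of "norm a" "norm b"] by (simp add: power2_sum)
  finally show ?thesis .
qed

lemma L2_add:
  assumes "f \<in> L2" "g \<in> L2"
  shows "(\<lambda>x. f x + g x) \<in> L2"
proof -
  have meas [measurable]: "f \<in> borel_measurable borel" "g \<in> borel_measurable borel"
    using assms by (auto dest: L2_measurable)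
  have "integrable lborel (\<lambda>x. 2 * (norm (f x))\<^sup>2 + 2 * (norm (g x))\<^sup>2)"
    using L2_integrable[OF assms(1)] L2_integrable[OF assms(2)] by auto
  then have "integrable lborel (\<lambda>x. (norm (f x + g x))\<^sup>2)"
    by (rule Bochner_Integration.integrable_bound) (auto simp: norm_add_power2_le)
  then show ?thesis by (simp add: L2_def)
qed

lemma L2_minus: "f \<in> L2 \<Longrightarrow> (\<lambda>x. - f x) \<in> L2"
  using L2_cmult[of f "-1"] by simp

lemma L2_diff: "f \<in> L2 \<Longrightarrow> g \<in> L2 \<Longrightarrow> (\<lambda>x. f x - g x) \<in> L2"
  using L2_add[OF _ L2_minus] by fastforce

lemma L2_integrable_norm_mult:
  assumes "f \<in> L2" "g \<in> L2"
  shows "integrable lborel (\<lambda>x. norm (f x) * norm (g x))"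
proof -
  have meas [measurable]: "f \<in> borel_measurable borel" "g \<in> borel_measurable borel"
    using assms by (auto dest: L2_measurable)
  have "integrable lborel (\<lambda>x. (norm (f x))\<^sup>2 + (norm (g x))\<^sup>2)"
    using assms by (auto dest: L2_integrable)
  then show ?thesis
  proof (rule Bochner_Integration.integrable_bound)
    have "a * b \<le> a\<^sup>2 + b\<^sup>2" for a b :: real
      using zero_le_power2[of "a - b"] zero_le_power2[of "a + b"] by (simp add: power2_eq_square algebra_simps)
    then show "AE x in lborel. norm (norm (f x) * norm (g x)) \<le> norm ((norm (f x))\<^sup>2 + (norm (g x))\<^sup>2)"
      by simp
  qed measurable
qed

lemma L2_Cauchy_Schwarz_norm:
  assumes "f \<in> L2" "g \<in> L2"
  shows "(LINT x|lborel. norm (f x) * norm (g x)) \<le> L2_norm f * L2_norm g"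
proof -
  have meas [measurable]: "f \<in> borel_measurable borel" "g \<in> borel_measurable borel"
    using assms by (auto dest: L2_measurable)
  let ?I = "LINT x|lborel. norm (f x) * norm (g x)"
  have I0: "0 \<le> ?I" by simp
  have "ennreal (?I\<^sup>2) = (\<integral>\<^sup>+x. ennreal (norm (f x)) * ennreal (norm (g x)) \<partial>lborel)\<^sup>2"
    using nn_integral_eq_integral[OF L2_integrable_norm_mult[OF assms]] I0
    by (simp add: ennreal_mult ennreal_power)
  also have "\<dots> \<le> (\<integral>\<^sup>+x. (ennreal (norm (f x)))\<^sup>2 \<partial>lborel) * (\<integral>\<^sup>+x. (ennreal (norm (g x)))\<^sup>2 \<partial>lborel)"
    by (rule Cauchy_Schwarz_nn_integral) auto
  also have "\<dots> = ennreal ((L2_norm f)\<^sup>2) * ennreal ((L2_norm g)\<^sup>2)"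
    using nn_integral_L2[OF assms(1)] nn_integral_L2[OF assms(2)] by (simp add: ennreal_power)
  also have "\<dots> = ennreal ((L2_norm f * L2_norm g)\<^sup>2)"
    by (simp add: ennreal_mult power_mult_distrib)
  finally have "?I\<^sup>2 \<le> (L2_norm f * L2_norm g)\<^sup>2" by (simp add: ennreal_le_iff)
  then show ?thesis by (rule power2_le_imp_le) simp
qed

text \<open>\<open>complex\<close> carries the inner product of the real plane, so
  \<open>f x \<bullet> g x\<close> is the real part of \<open>f x * cnj (g x)\<close>. This is the
  form in which squared norms expand and in which the energy is written.\<close>

lemma L2_integrable_inner:
  assumes "f \<in> L2" "g \<in> L2"
  shows "integrable lborel (\<lambda>x. f x \<bullet> g x)"
proof -
  have meas [measurable]: "f \<in> borel_measurable borel" "g \<in> borel_measurable borel"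
    using assms by (auto dest: L2_measurable)
  show ?thesis
    by (rule Bochner_Integration.integrable_bound[OF L2_integrable_norm_mult[OF assms]])
      (auto simp: Cauchy_Schwarz_ineq2)
qed

lemma L2_Cauchy_Schwarz:
  assumes "f \<in> L2" "g \<in> L2"
  shows "\<bar>LINT x|lborel. f x \<bullet> g x\<bar> \<le> L2_norm f * L2_norm g"
proof -
  have "\<bar>LINT x|lborel. f x \<bullet> g x\<bar> \<le> (LINT x|lborel. \<bar>f x \<bullet> g x\<bar>)"
    by (rule integral_abs_bound)
  also have "\<dots> \<le> (LINT x|lborel. norm (f x) * norm (g x))"
    by (intro integral_mono L2_integrable_norm_mult assms integrable_abs L2_integrable_inner)
      (auto simp: Cauchy_Schwarz_ineq2)
  also have "\<dots> \<le> L2_norm f * L2_norm g" by (rule L2_Cauchy_Schwarz_norm[OF assms])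
  finally show ?thesis .
qed

lemma L2_norm_triangle:
  assumes "f \<in> L2" "g \<in> L2"
  shows "L2_norm (\<lambda>x. f x + g x) \<le> L2_norm f + L2_norm g"
proof -
  have "(L2_norm (\<lambda>x. f x + g x))\<^sup>2
      = (LINT x|lborel. (norm (f x))\<^sup>2 + 2 * (f x \<bullet> g x) + (norm (g x))\<^sup>2)"
    unfolding L2_norm_power2
    by (intro Bochner_Integration.integral_cong) (auto simp: power2_norm_eq_inner inner_add inner_commute algebra_simps)
  also have "\<dots> = (L2_norm f)\<^sup>2 + 2 * (LINT x|lborel. f x \<bullet> g x) + (L2_norm g)\<^sup>2"
    using assms by (simp add: L2_norm_power2 L2_integrable L2_integrable_inner)
  also have "\<dots> \<le> (L2_norm f)\<^sup>2 + 2 * (L2_norm f * L2_norm g) + (L2_norm g)\<^sup>2"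
    using L2_Cauchy_Schwarz[OF assms] by simp
  also have "\<dots> = (L2_norm f + L2_norm g)\<^sup>2" by (simp add: power2_sum)
  finally show ?thesis by (rule power2_le_imp_le) simp
qed

lemma L2_norm_triangle_via:
  assumes "f \<in> L2" "g \<in> L2" "h \<in> L2"
  shows "L2_norm (\<lambda>x. f x - h x) \<le> L2_norm (\<lambda>x. f x - g x) + L2_norm (\<lambda>x. g x - h x)"
  using L2_norm_triangle[OF L2_diff[OF assms(1,2)] L2_diff[OF assms(2,3)]] by simp

lemma L2_norm_zero_AE:
  assumes "f \<in> L2" "L2_norm f = 0"
  shows "AE x in lborel. f x = 0"
proof -
  have "(\<integral>\<^sup>+x. ennreal ((norm (f x))\<^sup>2) \<partial>lborel) = 0"
    using nn_integral_L2[OF assms(1)] assms(2) by simp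
  then have "AE x in lborel. ennreal ((norm (f x))\<^sup>2) = 0"
    using L2_measurable[OF assms(1)] by (subst (asm) nn_integral_0_iff_AE) auto
  then show ?thesis by eventually_elim (simp add: ennreal_eq_0_iff)
qed

lemma L2_norm_tendsto:
  assumes "\<And>s. f s \<in> L2" "g \<in> L2" "((\<lambda>s. L2_norm (\<lambda>x. f s x - g x)) \<longlongrightarrow> 0) F"
  shows "((\<lambda>s. L2_norm (f s)) \<longlongrightarrow> L2_norm g) F"
proof (rule Lim_transform)
  show "((\<lambda>s. L2_norm g) \<longlongrightarrow> L2_norm g) F" by simp
  show "((\<lambda>s. L2_norm (f s) - L2_norm g) \<longlongrightarrow> 0) F"
  proof (rule Lim_null_comparison[OF _ assms(3)])
    have "norm (L2_norm (f s) - L2_norm g) \<le> L2_norm (\<lambda>x. f s x - g x)" for s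
    proof -
      have "L2_norm (\<lambda>x. g x - f s x) = L2_norm (\<lambda>x. f s x - g x)"
        using L2_norm_minus[of "\<lambda>x. f s x - g x"] by simp
      then show ?thesis
        using L2_norm_triangle[OF L2_diff[OF assms(1)[of s] assms(2)] assms(2)]
          L2_norm_triangle[OF L2_diff[OF assms(2) assms(1)[of s]] assms(1)[of s]] by simp
    qed
    then show "\<forall>\<^sub>F s in F. norm (L2_norm (f s) - L2_norm g) \<le> L2_norm (\<lambda>x. f s x - g x)" by simp
  qed
qed

section \<open>Gaussian integrals\<close>

text \<open>Lebesgue measure is the image of the product of the one-dimensional Lebesgue measures
  under the coordinate map \<open>?T\<close>, and integrals of products of one-variable functions
  factor there. Gaussians and characters both have this product form.\<close>

lemma
  fixes f :: "'a::euclidean_space \<Rightarrow> real \<Rightarrow> complex"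
  assumes int: "\<And>b. b \<in> Basis \<Longrightarrow> integrable lborel (f b)"
  shows integrable_lborel_prod_Basis: "integrable (lborel :: 'a measure) (\<lambda>x. \<Prod>b\<in>Basis. f b (x \<bullet> b))" (is ?A)
    and integral_lborel_prod_Basis: "(LINT x|(lborel :: 'a measure). (\<Prod>b\<in>Basis. f b (x \<bullet> b))) = (\<Prod>b\<in>Basis. (LINT x|lborel. f b x))" (is ?B)
proof -
  interpret product_sigma_finite "\<lambda>_::'a. lborel :: real measure" by standard
  let ?T = "\<lambda>g::'a \<Rightarrow> real. \<Sum>b\<in>Basis. g b *\<^sub>R b"
  have fm: "f b \<in> borel_measurable borel" if "b \<in> Basis" for b
    using borel_measurable_integrable[OF int[OF that]] by simp
  have meas: "(\<lambda>x::'a. \<Prod>b\<in>Basis. f b (x \<bullet> b)) \<in> borel_measurable borel"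
    by (intro borel_measurable_prod measurable_compose[OF _ fm]) auto
  have T: "?T \<in> measurable (\<Pi>\<^sub>M b\<in>Basis. lborel) borel" by measurable
  have eq: "(\<Prod>b\<in>Basis. f b (?T g \<bullet> b)) = (\<Prod>b\<in>Basis. f b (g b))" for g
    by (intro prod.cong) auto
  show ?A
    by (subst lborel_eq, subst integrable_distr_eq[OF T meas]) (simp only: eq product_integrable_prod finite_Basis int)
  show ?B
    by (subst lborel_eq, subst integral_distr[OF T meas]) (simp only: eq product_integral_prod finite_Basis int)
qed

text \<open>The value is the characteristic function of the standard normal distribution, rescaled
  by the density's factor \<open>1 / sqrt (2 * pi)\<close>. It is taken at \<open>- t\<close>
  because \<open>char\<close> has the opposite sign in the exponent.\<close>

lemma
  fixes t :: real
  shows integrable_fourier_gauss_std: "integrable lborel (\<lambda>x. exp (- \<i> * complex_of_real (x * t)) * complex_of_real (exp (- x\<^sup>2 / 2)))" (is ?A)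
    and integral_fourier_gauss_std: "(LINT x|lborel. exp (- \<i> * complex_of_real (x * t)) * complex_of_real (exp (- x\<^sup>2 / 2))) = complex_of_real (sqrt (2 * pi) * exp (- t\<^sup>2 / 2))" (is ?B)
proof -
  have "integrable lborel (\<lambda>x. sqrt (2 * pi) * std_normal_density x)"
    by (intro integrable_mult_right) (simp add: integrable_normal_density)
  then have i: "integrable lborel (\<lambda>x::real. exp (- x\<^sup>2 / 2))"
    by (simp add: std_normal_density_def)
  show ?A
    by (rule Bochner_Integration.integrable_bound[OF i]) (auto simp: norm_mult norm_exp_eq_Re)
  have "complex_of_real (exp (- t\<^sup>2 / 2)) = (CLINT x|density lborel std_normal_density. iexp (- t * x))"
    using char_std_normal_distribution by (auto simp: char_def fun_eq_iff dest: spec[of _ "-t"])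
  also have "\<dots> = (LINT x|lborel. std_normal_density x *\<^sub>R iexp (- t * x))"
    by (rule integral_density) (auto simp: normal_density_nonneg)
  also have "\<dots> = (LINT x|lborel. complex_of_real (1 / sqrt (2 * pi)) * (exp (- \<i> * complex_of_real (x * t)) * complex_of_real (exp (- x\<^sup>2 / 2))))"
    by (intro Bochner_Integration.integral_cong) (auto simp: std_normal_density_def scaleR_conv_of_real mult_ac)
  also have "\<dots> = complex_of_real (1 / sqrt (2 * pi)) * (LINT x|lborel. exp (- \<i> * complex_of_real (x * t)) * complex_of_real (exp (- x\<^sup>2 / 2)))"
    by (rule integral_mult_right_zero)
  finally show ?B by (simp add: field_simps)
qed

lemma
  fixes t e :: real
  assumes e: "e > 0"
  shows integrable_fourier_gauss_1: "integrable lborel (\<lambda>x. exp (- \<i> * complex_of_real (x * t)) * complex_of_real (exp (- (e * x)\<^sup>2 / 2)))" (is ?A)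
    and integral_fourier_gauss_1: "(LINT x|lborel. exp (- \<i> * complex_of_real (x * t)) * complex_of_real (exp (- (e * x)\<^sup>2 / 2))) = complex_of_real (sqrt (2 * pi) / e * exp (- (t / e)\<^sup>2 / 2))" (is ?B)
proof -
  let ?g = "\<lambda>x::real. exp (- \<i> * complex_of_real (x * (t / e))) * complex_of_real (exp (- x\<^sup>2 / 2))"
  have eq: "(\<lambda>x. exp (- \<i> * complex_of_real (x * t)) * complex_of_real (exp (- (e * x)\<^sup>2 / 2))) = (\<lambda>x. ?g (0 + e * x))"
    using e by (auto simp: fun_eq_iff)
  show ?A unfolding eq
    by (rule lborel_integrable_real_affine) (use e integrable_fourier_gauss_std[of "t / e"] in auto)
  have "(LINT x|lborel. ?g x) = e *\<^sub>R (LINT x|lborel. ?g (0 + e * x))"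
    using lborel_integral_real_affine[of e ?g 0] e by simp
  then show ?B unfolding eq integral_fourier_gauss_std using e
    by (simp add: scaleR_conv_of_real field_simps)
qed

text \<open>Normalised to the value \<open>1\<close> at the origin rather than to integral
  \<open>1\<close>: it serves as a cutoff that increases to \<open>1\<close>, as an averaging kernel
  of mass (2 pi)^(n/2), and later as a majorant of the low frequency decay factor.\<close>

definition gauss :: "'a::euclidean_space \<Rightarrow> real" where
  "gauss x = exp (- (norm x)\<^sup>2 / 2)"

lemma gauss_pos [simp]: "0 < gauss x" and gauss_nonneg [simp]: "0 \<le> gauss x" and gauss_le_1: "gauss x \<le> 1"
  by (simp_all add: gauss_def)

lemma gauss_measurable [measurable]: "gauss \<in> borel_measurable borel"
  unfolding gauss_def[abs_def] by measurable

lemma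
  fixes \<xi> :: "'a::euclidean_space"
  assumes e: "e > 0"
  shows integrable_fourier_gauss: "integrable lborel (\<lambda>x. exp (- \<i> * complex_of_real (x \<bullet> \<xi>)) * complex_of_real (gauss (e *\<^sub>R x)))" (is ?A)
    and integral_fourier_gauss: "(LINT x|lborel. exp (- \<i> * complex_of_real (x \<bullet> \<xi>)) * complex_of_real (gauss (e *\<^sub>R x)))
      = complex_of_real ((sqrt (2 * pi) / e) ^ DIM('a) * gauss (\<xi> /\<^sub>R e))" (is ?B)
proof -
  let ?f = "\<lambda>b x. exp (- \<i> * complex_of_real (x * (\<xi> \<bullet> b))) * complex_of_real (exp (- (e * x)\<^sup>2 / 2))"
  have gp: "gauss x = (\<Prod>b\<in>Basis. exp (- (x \<bullet> b)\<^sup>2 / 2))" for x :: 'a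
    unfolding gauss_def power2_norm_eq_inner euclidean_inner[of x x]
    by (simp add: exp_sum[symmetric] sum_negf sum_divide_distrib power2_eq_square)
  have eq: "exp (- \<i> * complex_of_real (x \<bullet> \<xi>)) * complex_of_real (gauss (e *\<^sub>R x)) = (\<Prod>b\<in>Basis. ?f b (x \<bullet> b))" for x
  proof -
    have "exp (- \<i> * complex_of_real (x \<bullet> \<xi>)) = (\<Prod>b\<in>Basis. exp (- \<i> * complex_of_real ((x \<bullet> b) * (\<xi> \<bullet> b))))"
      unfolding euclidean_inner[of x \<xi>] by (simp add: exp_sum[symmetric] sum_distrib_left sum_negf)
    moreover have "complex_of_real (gauss (e *\<^sub>R x)) = (\<Prod>b\<in>Basis. complex_of_real (exp (- (e * (x \<bullet> b))\<^sup>2 / 2)))"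
      by (simp only: gp of_real_prod inner_scaleR_left)
    ultimately show ?thesis by (simp only: prod.distrib)
  qed
  show ?A unfolding eq
    by (intro integrable_lborel_prod_Basis integrable_fourier_gauss_1 e)
  have "(LINT x|lborel. exp (- \<i> * complex_of_real (x \<bullet> \<xi>)) * complex_of_real (gauss (e *\<^sub>R x))) =
    (\<Prod>b\<in>(Basis::'a set). complex_of_real (sqrt (2 * pi) / e * exp (- (\<xi> \<bullet> b / e)\<^sup>2 / 2)))"
    unfolding eq using integral_lborel_prod_Basis[of ?f, OF integrable_fourier_gauss_1[OF e]] by (simp only: integral_fourier_gauss_1[OF e])
  also have "\<dots> = complex_of_real ((\<Prod>b\<in>(Basis::'a set). sqrt (2 * pi) / e) * (\<Prod>b\<in>(Basis::'a set). exp (- (\<xi> \<bullet> b / e)\<^sup>2 / 2)))"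
    by (simp only: of_real_prod prod.distrib of_real_mult)
  also have "(\<Prod>b\<in>(Basis::'a set). exp (- (\<xi> \<bullet> b / e)\<^sup>2 / 2)) = gauss (\<xi> /\<^sub>R e)"
    unfolding gp by (intro prod.cong) (simp_all add: field_simps)
  also have "(\<Prod>b\<in>(Basis::'a set). sqrt (2 * pi) / e) = (sqrt (2 * pi) / e) ^ DIM('a)"
    by (rule prod_constant)
  finally show ?B .
qed

lemma integrable_gauss:
  assumes "e > 0"
  shows "integrable lborel (\<lambda>x::'a::euclidean_space. gauss (e *\<^sub>R x))"
  using integrable_norm[OF integrable_fourier_gauss[OF assms, of "0::'a"]] by (simp add: abs_of_nonneg)

lemma integral_gauss:
  assumes "e > 0"
  shows "(LINT x|(lborel :: 'a::euclidean_space measure). gauss (e *\<^sub>R x)) = (sqrt (2 * pi) / e) ^ DIM('a)"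
proof -
  have "complex_of_real (LINT x|(lborel :: 'a measure). gauss (e *\<^sub>R x)) = complex_of_real ((sqrt (2 * pi) / e) ^ DIM('a))"
    using integral_fourier_gauss[OF assms, of "0::'a"] by (simp add: gauss_def)
  then show ?thesis by (simp only: of_real_eq_iff)
qed

lemma nn_integral_lborel_affine:
  fixes g :: "'a::euclidean_space \<Rightarrow> ennreal"
  assumes [measurable]: "g \<in> borel_measurable borel" and e: "e > 0"
  shows "(\<integral>\<^sup>+x. g x \<partial>lborel) = ennreal (e ^ DIM('a)) * (\<integral>\<^sup>+x. g (t + e *\<^sub>R x) \<partial>lborel)"
  using e by (subst lborel_affine[of e t]) (simp_all add: nn_integral_density nn_integral_distr nn_integral_cmult)

lemma integral_lborel_affine:
  fixes f :: "'a::euclidean_space \<Rightarrow> 'b::{banach, second_countable_topology}"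
  assumes [measurable]: "f \<in> borel_measurable borel" and e: "e > 0"
  shows "(LINT x|lborel. f x) = e ^ DIM('a) *\<^sub>R (LINT x|lborel. f (t + e *\<^sub>R x))"
  using e by (subst lborel_affine[of e t]) (simp_all add: integral_density integral_distr)

section \<open>Density of continuous functions\<close>

lemma L2_dominated_convergence:
  fixes f :: "('n::finite) cfun" and s :: "nat \<Rightarrow> 'n cfun" and D :: "real^'n \<Rightarrow> real"
  assumes f: "f \<in> borel_measurable borel" and s: "\<And>k. s k \<in> borel_measurable borel"
    and D: "integrable lborel (\<lambda>x. (D x)\<^sup>2)"
    and lim: "AE x in lborel. (\<lambda>k. s k x) \<longlonglongrightarrow> f x"
    and bound: "\<And>k x. norm (s k x) \<le> D x" "\<And>x. norm (f x) \<le> D x"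
  shows "(\<lambda>k. L2_norm (\<lambda>x. s k x - f x)) \<longlonglongrightarrow> 0"
proof -
  have [measurable]: "f \<in> borel_measurable borel" "\<And>k. s k \<in> borel_measurable borel" by fact+
  have "(\<lambda>k. LINT x|lborel. (norm (s k x - f x))\<^sup>2) \<longlonglongrightarrow> (LINT x|(lborel :: (real^'n) measure). 0)"
  proof (rule integral_dominated_convergence[where w="\<lambda>x. 4 * (D x)\<^sup>2"])
    show "AE x in lborel. (\<lambda>k. (norm (s k x - f x))\<^sup>2) \<longlonglongrightarrow> 0"
      using lim by eventually_elim (auto intro!: tendsto_eq_intros)
    show "AE x in lborel. norm ((norm (s k x - f x))\<^sup>2) \<le> 4 * (D x)\<^sup>2" for k
    proof (rule AE_I2)
      fix x
      have "norm (s k x - f x) \<le> 2 * D x"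
        using norm_triangle_ineq4[of "s k x" "f x"] bound(1)[of k x] bound(2)[of x] by simp
      then have "(norm (s k x - f x))\<^sup>2 \<le> (2 * D x)\<^sup>2" by (intro power_mono) auto
      then show "norm ((norm (s k x - f x))\<^sup>2) \<le> 4 * (D x)\<^sup>2" by (simp add: power_mult_distrib)
    qed
  qed (use D in auto)
  then have "(\<lambda>k. sqrt (LINT x|lborel. (norm (s k x - f x))\<^sup>2)) \<longlonglongrightarrow> sqrt 0"
    by (intro tendsto_real_sqrt) simp
  then show ?thesis by (simp add: L2_norm_def)
qed

lemma L2_of_bounded_support:
  fixes f :: "('n::finite) cfun"
  assumes f: "f \<in> borel_measurable borel" and b: "\<And>x. norm (f x) \<le> B * indicator (cball 0 r) x"
  shows "integrable lborel f" "f \<in> L2"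
proof -
  have i: "integrable lborel (\<lambda>x::real^'n. B * indicator (cball 0 r) x)"
    by (intro integrable_mult_right integrable_real_indicator) (use emeasure_lborel_cball_finite[of "0::real^'n" r] in auto)
  show "integrable lborel f"
    by (rule Bochner_Integration.integrable_bound[OF i]) (use f b in \<open>auto intro: order_trans[OF _ abs_ge_self]\<close>)
  have i2: "integrable lborel (\<lambda>x::real^'n. B\<^sup>2 * indicator (cball 0 r) x)"
    by (intro integrable_mult_right integrable_real_indicator) (use emeasure_lborel_cball_finite[of "0::real^'n" r] in auto)
  have "integrable lborel (\<lambda>x. (norm (f x))\<^sup>2)"
  proof (rule Bochner_Integration.integrable_bound[OF i2])
    show "(\<lambda>x. (norm (f x))\<^sup>2) \<in> borel_measurable lborel" using f by measurable
    have "(norm (f x))\<^sup>2 \<le> B\<^sup>2 * indicator (cball 0 r) x" for x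
      using power_mono[OF b[of x] norm_ge_zero, of 2] by (auto simp: indicator_def split: if_splits)
    then show "AE x in lborel. norm ((norm (f x))\<^sup>2) \<le> norm (B\<^sup>2 * indicator (cball 0 r) x)"
      by (auto simp: indicator_def)
  qed
  then show "f \<in> L2" using f by (simp add: L2_def)
qed

text \<open>Measurability provides continuous functions converging to \<open>f\<close> off a
  negligible set, but without control of size or support. Composing with a projection onto a ball of
  values and multiplying by a spatial cutoff repairs both. Neither changes the limit, because
  \<open>f\<close> already has values in that ball and is supported where the cutoff is
  \<open>1\<close>; dominated convergence then applies.\<close>

lemma L2_dense_continuous_bounded:
  fixes f :: "('n::finite) cfun"
  assumes f: "f \<in> borel_measurable borel" and b: "\<And>x. norm (f x) \<le> B * indicator (cball 0 r) x" and e: "e > 0"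
  shows "\<exists>g K. continuous_on UNIV g \<and> (\<forall>x. norm (g x) \<le> K) \<and> integrable lborel g \<and> g \<in> L2 \<and> L2_norm (\<lambda>x. g x - f x) < e"
proof -
  have [measurable]: "f \<in> borel_measurable borel" by fact
  \<comment> \<open>Strictly positive, since \<open>B'\<close> is a divisor in the projection that
    follows.\<close>
  define B' where "B' = max B 1"
  have B': "B' > 0" "B \<le> B'" by (auto simp: B'_def)
  have fb: "norm (f x) \<le> B' * indicator (cball 0 r) x" for x
    using b[of x] B' by (auto simp: indicator_def split: if_splits)
  have "f \<in> borel_measurable lebesgue" by (simp add: f measurable_completion)
  then have "f measurable_on UNIV" by (rule lebesgue_measurable_imp_measurable_on) simp
  then obtain N g where N: "negligible N" and g: "\<And>n. continuous_on UNIV (g n)" and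
    lim: "\<And>x. x \<notin> N \<Longrightarrow> (\<lambda>n::nat. g n x) \<longlonglongrightarrow> f x"
    unfolding measurable_on_def by auto
  \<comment> \<open>The radial projection of the complex plane onto the closed disc of radius
    \<open>B'\<close>: continuous, and the identity on that disc.\<close>
  define cl where "cl z = z / complex_of_real (max 1 (norm z / B'))" for z
  have cl_le: "norm (cl z) \<le> B'" for z
    using B' by (auto simp: cl_def norm_divide field_simps max_def abs_if)
  have cl_id: "norm z \<le> B' \<Longrightarrow> cl z = z" for z
    using B' by (auto simp: cl_def max_absorb1)
  have cl_cont: "continuous_on UNIV cl"
    unfolding cl_def[abs_def] by (intro continuous_intros) (use B' in auto)
  define ch where "ch x = max 0 (min 1 (r + 1 - norm x))" for x :: "real^'n"
  have ch: "0 \<le> ch x" "ch x \<le> 1" "norm x \<le> r \<Longrightarrow> ch x = 1" "norm x \<ge> r + 1 \<Longrightarrow> ch x = 0" for x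
    by (auto simp: ch_def)
  define s where "s n x = complex_of_real (ch x) * cl (g n x)" for n x
  have s_cont: "continuous_on UNIV (s n)" for n
    unfolding s_def ch_def[abs_def]
    by (intro continuous_intros continuous_on_compose2[OF cl_cont g]) auto
  have sm: "s n \<in> borel_measurable borel" for n by (rule borel_measurable_continuous_onI[OF s_cont])
  have s_le: "norm (s n x) \<le> B' * indicator (cball 0 (r + 1)) x" for n x
  proof (cases "norm x \<le> r + 1")
    case True
    have "norm (s n x) \<le> 1 * B'"
      unfolding s_def norm_mult using ch[of x] cl_le[of "g n x"] B' by (intro mult_mono) auto
    with True show ?thesis by simp
  next
    case False with ch(4)[of x] show ?thesis by (simp add: s_def)
  qed
  have "(\<lambda>k. L2_norm (\<lambda>x. s k x - f x)) \<longlonglongrightarrow> 0"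
  proof (rule L2_dominated_convergence[OF f sm _ _ s_le])
    have "(\<lambda>x. (B' * indicator (cball 0 (r + 1)) x)\<^sup>2) = (\<lambda>x::real^'n. B'\<^sup>2 * indicator (cball 0 (r + 1)) x)"
      by (auto simp: indicator_def)
    then show "integrable lborel (\<lambda>x::real^'n. (B' * indicator (cball 0 (r + 1)) x)\<^sup>2)"
      using emeasure_lborel_cball_finite[of "0::real^'n" "r + 1"] by auto
    show "norm (f x) \<le> B' * indicator (cball 0 (r + 1)) x" for x
      by (rule order_trans[OF fb[of x]]) (use B' in \<open>auto simp: indicator_def\<close>)
    have "AE x in lebesgue. x \<notin> N"
      using N by (simp add: negligible_iff_null_sets AE_not_in)
    then have "AE x in lebesgue. (\<lambda>k. s k x) \<longlonglongrightarrow> f x"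
    proof eventually_elim
      case (elim x)
      have "(\<lambda>k. s k x) \<longlonglongrightarrow> complex_of_real (ch x) * cl (f x)"
        unfolding s_def using cl_cont
        by (intro tendsto_mult tendsto_const isCont_tendsto_compose[OF _ lim[OF elim]])
          (simp add: continuous_on_eq_continuous_at)
      also have "cl (f x) = f x"
        by (rule cl_id, rule order_trans[OF fb[of x]]) (use B' in \<open>auto simp: indicator_def\<close>)
      also have "complex_of_real (ch x) * f x = f x"
        using fb[of x] ch(3)[of x] by (cases "norm x \<le> r") auto
      finally show ?case .
    qed
    then show "AE x in lborel. (\<lambda>k. s k x) \<longlonglongrightarrow> f x"
      by (simp add: AE_completion_iff)
  qed
  then have "\<forall>\<^sub>F k in sequentially. L2_norm (\<lambda>x. s k x - f x) < e"
    using e by (rule order_tendstoD)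
  then obtain k where "L2_norm (\<lambda>x. s k x - f x) < e" by (auto simp: eventually_sequentially)
  moreover have "norm (s k x) \<le> B'" for x
    by (rule order_trans[OF s_le[of k x]]) (use B' in \<open>auto simp: indicator_def\<close>)
  ultimately show ?thesis
    using s_cont L2_of_bounded_support[OF sm s_le] by blast
qed

text \<open>Cutting off arguments and values at the same level \<open>k\<close> reduces to bounded
  functions of bounded support; half of \<open>e\<close> is spent on the cutoff and half on the
  continuous approximation.\<close>

lemma L2_dense_continuous:
  fixes f :: "('n::finite) cfun"
  assumes f: "f \<in> L2" and e: "e > 0"
  shows "\<exists>g K. continuous_on UNIV g \<and> (\<forall>x. norm (g x) \<le> K) \<and> integrable lborel g \<and> g \<in> L2 \<and> L2_norm (\<lambda>x. g x - f x) < e"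
proof -
  have [measurable]: "f \<in> borel_measurable borel" using L2_measurable[OF f] .
  define s where "s k x = (if norm x \<le> real k \<and> norm (f x) \<le> real k then f x else 0)" for k x
  have sm [measurable]: "s k \<in> borel_measurable borel" for k
    unfolding s_def[abs_def] by measurable
  have sb: "norm (s k x) \<le> real k * indicator (cball 0 (real k)) x" for k x
    by (simp add: s_def)
  have "(\<lambda>k. L2_norm (\<lambda>x. s k x - f x)) \<longlonglongrightarrow> 0"
  proof (rule L2_dominated_convergence[where D="\<lambda>x. norm (f x)"])
    have "(\<lambda>k. s k x) \<longlonglongrightarrow> f x" for x
    proof (rule tendsto_eventually)
      obtain m :: nat where "norm x + norm (f x) \<le> real m" using real_arch_simple by blast
      then show "\<forall>\<^sub>F k in sequentially. s k x = f x"
        unfolding eventually_sequentially s_def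
      proof (intro exI[of _ m] allI impI)
        fix k assume "m \<le> k"
        then have "real m \<le> real k" by simp
        with \<open>norm x + norm (f x) \<le> real m\<close> norm_ge_zero[of x] norm_ge_zero[of "f x"]
        have "norm x \<le> real k" "norm (f x) \<le> real k" by linarith+
        then show "(if norm x \<le> real k \<and> norm (f x) \<le> real k then f x else 0) = f x" by simp
      qed
    qed
    then show "AE x in lborel. (\<lambda>k. s k x) \<longlonglongrightarrow> f x" by simp
  qed (use L2_integrable[OF f] in \<open>auto simp: s_def\<close>)
  then have "\<forall>\<^sub>F k in sequentially. L2_norm (\<lambda>x. s k x - f x) < e / 2"
    using e by (intro order_tendstoD) auto
  then obtain k where k: "L2_norm (\<lambda>x. s k x - f x) < e / 2" by (auto simp: eventually_sequentially)
  obtain g K where g: "continuous_on UNIV g" "\<forall>x. norm (g x) \<le> K" "integrable lborel g" "g \<in> L2" "L2_norm (\<lambda>x. g x - s k x) < e / 2"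
    using L2_dense_continuous_bounded[OF sm[of k] sb[of k], of "e / 2"] e by fastforce
  have "L2_norm (\<lambda>x. g x - f x) \<le> L2_norm (\<lambda>x. g x - s k x) + L2_norm (\<lambda>x. s k x - f x)"
    by (intro L2_norm_triangle_via g L2_of_bounded_support(2)[OF sm sb] f)
  with k g(5) have "L2_norm (\<lambda>x. g x - f x) < e" by simp
  with g show ?thesis by blast
qed

section \<open>Plancherel's theorem for integrable functions\<close>

lemma fourier_L1_measurable [measurable]:
  fixes f :: "('n::finite) cfun"
  assumes [measurable]: "f \<in> borel_measurable borel"
  shows "fourier_L1 f \<in> borel_measurable borel"
proof -
  have "(\<lambda>\<xi>. LINT x|lborel. exp (- \<i> * complex_of_real (x \<bullet> \<xi>)) * f x) \<in> borel_measurable (lborel :: (real^'n) measure)"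
    by (intro lborel.borel_measurable_lebesgue_integral) measurable
  then show ?thesis by (simp add: fourier_L1_def[abs_def])
qed

lemma integrable_exp_mult:
  fixes f :: "'a::euclidean_space \<Rightarrow> complex" and h :: "'a \<Rightarrow> real"
  assumes f: "integrable lborel f" and h [measurable]: "h \<in> borel_measurable borel" and c: "Re c = 0"
  shows "integrable lborel (\<lambda>x. exp (c * complex_of_real (h x)) * f x)"
  by (rule Bochner_Integration.integrable_bound[OF f])
    (use borel_measurable_integrable[OF f] in \<open>auto simp: norm_mult norm_exp_eq_Re c\<close>)

lemma fourier_L1_integrable:
  "integrable lborel f \<Longrightarrow> integrable lborel (\<lambda>x. exp (- \<i> * complex_of_real (x \<bullet> \<xi>)) * f x)"
  by (rule integrable_exp_mult) auto

lemma norm_fourier_L1_le: "norm (fourier_L1 f \<xi>) \<le> (LINT x|lborel. norm (f x))"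
proof -
  have "norm (fourier_L1 f \<xi>) \<le> (LINT x|lborel. norm (exp (- \<i> * complex_of_real (x \<bullet> \<xi>)) * f x))"
    unfolding fourier_L1_def by (rule integral_norm_bound)
  also have "\<dots> = (LINT x|lborel. norm (f x))" by (simp add: norm_mult norm_exp_eq_Re)
  finally show ?thesis .
qed

lemma fourier_L1_add:
  "integrable lborel f \<Longrightarrow> integrable lborel g \<Longrightarrow> fourier_L1 (\<lambda>x. f x + g x) \<xi> = fourier_L1 f \<xi> + fourier_L1 g \<xi>"
  unfolding fourier_L1_def distrib_left by (intro Bochner_Integration.integral_add fourier_L1_integrable)

lemma fourier_L1_diff:
  "integrable lborel f \<Longrightarrow> integrable lborel g \<Longrightarrow> fourier_L1 (\<lambda>x. f x - g x) \<xi> = fourier_L1 f \<xi> - fourier_L1 g \<xi>"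
  unfolding fourier_L1_def right_diff_distrib by (intro Bochner_Integration.integral_diff fourier_L1_integrable)

lemma fourier_L1_cmult: "fourier_L1 (\<lambda>x. c * f x) \<xi> = c * fourier_L1 f \<xi>"
  unfolding fourier_L1_def by (subst integral_mult_right_zero[symmetric]) (simp add: mult_ac)

text \<open>The multiplication formula of Fourier analysis, by Fubini, as the kernel has modulus
  \<open>1\<close>. The factor \<open>c\<close> is any purely imaginary number because both signs
  occur: one for the transform and the other for its complex conjugate.\<close>

lemma integral_exp_swap:
  fixes f h :: "'a::euclidean_space \<Rightarrow> complex"
  assumes f: "integrable lborel f" and h: "integrable lborel h" and c: "Re c = 0"
  shows "(LINT \<xi>|lborel. (LINT x|lborel. exp (c * complex_of_real (x \<bullet> \<xi>)) * f x) * h \<xi>)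
       = (LINT x|lborel. f x * (LINT \<xi>|lborel. exp (c * complex_of_real (x \<bullet> \<xi>)) * h \<xi>))"
proof -
  have [measurable]: "f \<in> borel_measurable borel" "h \<in> borel_measurable borel"
    using f h by (auto dest: borel_measurable_integrable)
  let ?F = "\<lambda>(x, \<xi>). exp (c * complex_of_real (x \<bullet> \<xi>)) * f x * h \<xi>"
  have nF: "norm (?F (x, \<xi>)) = norm (f x) * norm (h \<xi>)" for x \<xi>
    by (simp add: norm_mult norm_exp_eq_Re c)
  have F: "integrable (lborel \<Otimes>\<^sub>M lborel) ?F"
  proof (rule lborel_pair.Fubini_integrable)
    show "?F \<in> borel_measurable (lborel \<Otimes>\<^sub>M lborel)" by measurable
    show "integrable lborel (\<lambda>x. LINT y|lborel. norm (?F (x, y)))"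
      unfolding nF using integrable_norm[OF f] by simp
    have "integrable lborel (\<lambda>\<xi>. f x * (exp (c * complex_of_real (x \<bullet> \<xi>)) * h \<xi>))" for x
      by (intro integrable_mult_right integrable_exp_mult h c) measurable
    then show "AE x in lborel. integrable lborel (\<lambda>y. ?F (x, y))"
      by (simp add: mult_ac)
  qed
  have "(LINT \<xi>|lborel. (LINT x|lborel. exp (c * complex_of_real (x \<bullet> \<xi>)) * f x) * h \<xi>)
     = (LINT \<xi>|lborel. LINT x|lborel. exp (c * complex_of_real (x \<bullet> \<xi>)) * f x * h \<xi>)"
    by simp
  also have "\<dots> = (LINT x|lborel. LINT \<xi>|lborel. exp (c * complex_of_real (x \<bullet> \<xi>)) * f x * h \<xi>)"
    by (rule lborel_pair.Fubini_integral[OF F])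
  also have "\<dots> = (LINT x|lborel. f x * (LINT \<xi>|lborel. exp (c * complex_of_real (x \<bullet> \<xi>)) * h \<xi>))"
    by (subst integral_mult_right_zero[symmetric]) (simp add: mult_ac)
  finally show ?thesis .
qed

lemma gauss_minus: "gauss (- x) = gauss x"
  by (simp add: gauss_def)

lemma cnj_fourier_L1: "cnj (fourier_L1 f \<xi>) = (LINT x|lborel. exp (\<i> * complex_of_real (x \<bullet> \<xi>)) * cnj (f x))"
  unfolding fourier_L1_def by (simp add: exp_cnj flip: Bochner_Integration.integral_cnj)

text \<open>
  Both transforms are moved onto the Gaussian, whose transform concentrates at the origin as
  \<open>e\<close> tends to \<open>0\<close>.
\<close>

lemma integral_norm_fourier_L1_gauss:
  fixes f :: "('n::finite) cfun"
  assumes f: "integrable lborel f" and e: "e > 0"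
  shows "complex_of_real (LINT \<xi>|lborel. (norm (fourier_L1 f \<xi>))\<^sup>2 * gauss (e *\<^sub>R \<xi>))
     = complex_of_real (sqrt (2 * pi) ^ CARD('n)) * (LINT x|lborel. f x * (LINT w|lborel. cnj (f (x + e *\<^sub>R w)) * complex_of_real (gauss w)))"
proof -
  have fm [measurable]: "f \<in> borel_measurable borel"
    using f by (auto dest: borel_measurable_integrable)
  have f': "integrable lborel (\<lambda>x. cnj (f x))" using f by simp
  have [measurable]: "cnj \<in> borel_measurable borel"
    by (intro borel_measurable_continuous_onI continuous_intros)
  let ?G = "\<lambda>\<xi>::real^'n. complex_of_real (gauss (e *\<^sub>R \<xi>))"
  let ?h = "\<lambda>\<xi>. cnj (fourier_L1 f \<xi>) * ?G \<xi>"
  have G: "integrable lborel ?G" by (intro integrable_of_real integrable_gauss e)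
  have [measurable]: "?G \<in> borel_measurable borel" using borel_measurable_integrable[OF G] by simp
  have h: "integrable lborel ?h"
  proof (rule Bochner_Integration.integrable_bound)
    show "integrable lborel (\<lambda>\<xi>. complex_of_real (LINT x|lborel. norm (f x)) * ?G \<xi>)"
      by (intro integrable_mult_right G)
    show "AE \<xi> in lborel. norm (?h \<xi>) \<le> norm (complex_of_real (LINT x|lborel. norm (f x)) * ?G \<xi>)"
      by (auto simp: norm_mult intro!: mult_right_mono norm_fourier_L1_le)
  qed measurable
  have inner: "(LINT \<xi>|lborel. exp (- \<i> * complex_of_real (x \<bullet> \<xi>)) * ?h \<xi>)
    = complex_of_real (sqrt (2 * pi) ^ CARD('n)) * (LINT w|lborel. cnj (f (x + e *\<^sub>R w)) * complex_of_real (gauss w))" for x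
  proof -
    let ?k = "\<lambda>\<xi>. exp (- \<i> * complex_of_real (x \<bullet> \<xi>)) * ?G \<xi>"
    have k: "integrable lborel ?k" by (intro integrable_exp_mult G) auto
    have "(LINT \<xi>|lborel. exp (- \<i> * complex_of_real (x \<bullet> \<xi>)) * ?h \<xi>)
       = (LINT \<xi>|lborel. (LINT y|lborel. exp (\<i> * complex_of_real (y \<bullet> \<xi>)) * cnj (f y)) * ?k \<xi>)"
      by (simp only: cnj_fourier_L1 mult_ac)
    also have "\<dots> = (LINT y|lborel. cnj (f y) * (LINT \<xi>|lborel. exp (\<i> * complex_of_real (y \<bullet> \<xi>)) * ?k \<xi>))"
      by (rule integral_exp_swap[OF f' k]) simp
    also have "\<dots> = (LINT y|lborel. cnj (f y) * (LINT \<xi>|lborel. exp (- \<i> * complex_of_real (\<xi> \<bullet> (x - y))) * ?G \<xi>))"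
    proof -
      have "exp (\<i> * complex_of_real (y \<bullet> \<xi>)) * ?k \<xi> = exp (- \<i> * complex_of_real (\<xi> \<bullet> (x - y))) * ?G \<xi>" for y \<xi>
        by (simp add: exp_add[symmetric] inner_diff_right inner_commute algebra_simps flip: mult.assoc)
      then show ?thesis by presburger
    qed
    also have "\<dots> = (LINT y|lborel. cnj (f y) * complex_of_real ((sqrt (2 * pi) / e) ^ CARD('n) * gauss ((x - y) /\<^sub>R e)))"
      by (simp only: integral_fourier_gauss[OF e] DIM_cart DIM_real mult_1_right)
    \<comment> \<open>Substitution \<open>y = x + e *\<^sub>R w\<close>: the Jacobian
      \<open>e ^ CARD('n)\<close> is going to cancel the negative power of \<open>e\<close> in the
      transform of the dilated Gaussian.\<close>
    also have "\<dots> = e ^ CARD('n) *\<^sub>R (LINT w|lborel. cnj (f (x + e *\<^sub>R w)) * complex_of_real ((sqrt (2 * pi) / e) ^ CARD('n) * gauss ((x - (x + e *\<^sub>R w)) /\<^sub>R e)))"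
      using e by (subst integral_lborel_affine[of _ e x]) auto
    also have "\<dots> = e ^ CARD('n) *\<^sub>R (LINT w|lborel. complex_of_real ((sqrt (2 * pi) / e) ^ CARD('n)) * (cnj (f (x + e *\<^sub>R w)) * complex_of_real (gauss w)))"
    proof -
      have "(x - (x + e *\<^sub>R w)) /\<^sub>R e = - w" for w using e by simp
      then show ?thesis by (simp only: gauss_minus of_real_mult mult_ac)
    qed
    also have "\<dots> = complex_of_real (sqrt (2 * pi) ^ CARD('n)) * (LINT w|lborel. cnj (f (x + e *\<^sub>R w)) * complex_of_real (gauss w))"
      unfolding integral_mult_right_zero using e
      by (simp add: scaleR_conv_of_real power_divide)
    finally show ?thesis .
  qed
  have "complex_of_real (LINT \<xi>|lborel. (norm (fourier_L1 f \<xi>))\<^sup>2 * gauss (e *\<^sub>R \<xi>))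
     = (LINT \<xi>|lborel. fourier_L1 f \<xi> * ?h \<xi>)"
    by (subst integral_complex_of_real[symmetric])
      (simp add: complex_norm_square[symmetric] mult.assoc[symmetric])
  also have "\<dots> = (LINT x|lborel. f x * (LINT \<xi>|lborel. exp (- \<i> * complex_of_real (x \<bullet> \<xi>)) * ?h \<xi>))"
    unfolding fourier_L1_def[of f] using integral_exp_swap[OF f h, of "-\<i>"] by (simp add: fourier_L1_def)
  also have "\<dots> = (LINT x|lborel. complex_of_real (sqrt (2 * pi) ^ CARD('n)) * (f x * (LINT w|lborel. cnj (f (x + e *\<^sub>R w)) * complex_of_real (gauss w))))"
    unfolding inner by (simp only: mult_ac)
  finally show ?thesis unfolding integral_mult_right_zero .
qed

text \<open>Fatou's lemma in the form used to carry a uniform bound to a pointwise limit whose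
  integrability is still unknown.\<close>

lemma nn_integral_Fatou_le:
  fixes u :: "nat \<Rightarrow> 'a \<Rightarrow> ennreal"
  assumes u: "\<And>n. u n \<in> borel_measurable M" and lim: "AE x in M. (\<lambda>n. u n x) \<longlonglongrightarrow> v x"
    and le: "\<And>n. (\<integral>\<^sup>+x. u n x \<partial>M) \<le> C"
  shows "(\<integral>\<^sup>+x. v x \<partial>M) \<le> C"
proof -
  have "(\<integral>\<^sup>+x. v x \<partial>M) = (\<integral>\<^sup>+x. liminf (\<lambda>n. u n x) \<partial>M)"
    using lim by (intro nn_integral_cong_AE) (auto elim!: eventually_mono dest!: lim_imp_Liminf[rotated])
  also have "\<dots> \<le> liminf (\<lambda>n. \<integral>\<^sup>+x. u n x \<partial>M)"
    by (rule nn_integral_liminf[OF u])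
  also have "\<dots> \<le> limsup (\<lambda>n. \<integral>\<^sup>+x. u n x \<partial>M)"
    by (rule Liminf_le_Limsup) simp
  also have "\<dots> \<le> C"
    by (rule Limsup_bounded) (simp add: le)
  finally show ?thesis .
qed

text \<open>True for every function: without integrability the left side is \<open>0\<close>. Hence
  iterated integrals can be estimated with no integrability checks.\<close>

lemma norm_integral_le_nn_integral:
  fixes f :: "'a \<Rightarrow> 'b::{banach, second_countable_topology}"
  shows "ennreal (norm (integral\<^sup>L M f)) \<le> (\<integral>\<^sup>+x. ennreal (norm (f x)) \<partial>M)"
proof (cases "integrable M f")
  case True
  have "ennreal (norm (integral\<^sup>L M f)) \<le> ennreal (LINT x|M. norm (f x))"
    by (intro ennreal_leI integral_norm_bound)
  also have "\<dots> = (\<integral>\<^sup>+x. ennreal (norm (f x)) \<partial>M)"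
    by (rule nn_integral_eq_integral[symmetric]) (use True in auto)
  finally show ?thesis .
qed (simp add: not_integrable_integral_eq)

text \<open>The factor by which the unnormalised transform stretches L^2 norms, and also the total
  mass of \<open>gauss\<close>. The type argument carries the dimension.\<close>

definition fourier_const :: "'n itself \<Rightarrow> real" where
  "fourier_const _ = sqrt (2 * pi) ^ CARD('n)"

lemma fourier_const_pos [simp]: "0 < fourier_const TYPE('n::finite)"
  by (simp add: fourier_const_def)

lemma fourier_const_nonneg [simp]: "0 \<le> fourier_const TYPE('n::finite)"
  by (simp add: fourier_const_def)

lemma nn_integral_gauss: "(\<integral>\<^sup>+w. ennreal (gauss w) \<partial>(lborel :: (real^'n::finite) measure)) = ennreal (fourier_const TYPE('n))"
  using integrable_gauss[of 1, where ?'a="real^'n"] integral_gauss[of 1, where ?'a="real^'n"]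
  by (subst nn_integral_eq_integral) (auto simp: fourier_const_def)

lemma nn_integral_translate:
  fixes g :: "'a::euclidean_space \<Rightarrow> ennreal"
  assumes "g \<in> borel_measurable borel"
  shows "(\<integral>\<^sup>+x. g (x + t) \<partial>lborel) = (\<integral>\<^sup>+x. g x \<partial>lborel)"
  using nn_integral_lborel_affine[OF assms, of 1 t] by (simp add: add.commute)

text \<open>The Gaussian identity contains the product of \<open>f x\<close> and
  \<open>f (x + e *\<^sub>R w)\<close>. The product of their norms is at most half the sum of the
  squares, and by translation invariance each half contributes the same amount, whatever
  \<open>w\<close> and \<open>e\<close> are. The bound is therefore uniform in \<open>e\<close> and
  asks for no continuity of \<open>f\<close>.\<close>

lemma fourier_L1_gauss_le:
  fixes f :: "('n::finite) cfun"
  assumes f: "integrable lborel f" and f2: "f \<in> L2" and e: "e > 0"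
  shows "(\<integral>\<^sup>+\<xi>. ennreal ((norm (fourier_L1 f \<xi>))\<^sup>2 * gauss (e *\<^sub>R \<xi>)) \<partial>lborel)
      \<le> ennreal ((fourier_const TYPE('n) * L2_norm f)\<^sup>2)"
proof -
  let ?c = "fourier_const TYPE('n)"
  have fm [measurable]: "f \<in> borel_measurable borel" by (rule L2_measurable[OF f2])
  let ?J = "\<lambda>x. LINT w|lborel. cnj (f (x + e *\<^sub>R w)) * complex_of_real (gauss w)"
  have i: "integrable lborel (\<lambda>\<xi>. (norm (fourier_L1 f \<xi>))\<^sup>2 * gauss (e *\<^sub>R \<xi>))"
  proof (rule Bochner_Integration.integrable_bound)
    show "integrable lborel (\<lambda>\<xi>::real^'n. (LINT x|lborel. norm (f x))\<^sup>2 * gauss (e *\<^sub>R \<xi>))"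
      by (intro integrable_mult_right integrable_gauss e)
    show "AE \<xi> in lborel. norm ((norm (fourier_L1 f \<xi>))\<^sup>2 * gauss (e *\<^sub>R \<xi>)) \<le> norm ((LINT x|lborel. norm (f x))\<^sup>2 * gauss (e *\<^sub>R \<xi>))"
      by (auto simp: abs_mult intro!: mult_right_mono power_mono norm_fourier_L1_le)
  qed measurable
  have "(\<integral>\<^sup>+\<xi>. ennreal ((norm (fourier_L1 f \<xi>))\<^sup>2 * gauss (e *\<^sub>R \<xi>)) \<partial>lborel)
      = ennreal (LINT \<xi>|lborel. (norm (fourier_L1 f \<xi>))\<^sup>2 * gauss (e *\<^sub>R \<xi>))"
    by (rule nn_integral_eq_integral[OF i]) simp
  also have "\<dots> = ennreal (norm (complex_of_real (LINT \<xi>|lborel. (norm (fourier_L1 f \<xi>))\<^sup>2 * gauss (e *\<^sub>R \<xi>))))"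
    by simp
  also have "\<dots> = ennreal ?c * ennreal (norm (LINT x|lborel. f x * ?J x))"
    unfolding integral_norm_fourier_L1_gauss[OF f e] by (simp add: norm_mult ennreal_mult fourier_const_def norm_power)
  also have "\<dots> \<le> ennreal ?c * ennreal (?c * (L2_norm f)\<^sup>2)"
  proof (rule mult_left_mono)
    have "ennreal (norm (LINT x|lborel. f x * ?J x)) \<le> (\<integral>\<^sup>+x. ennreal (norm (f x * ?J x)) \<partial>lborel)"
      by (rule norm_integral_le_nn_integral)
    also have "\<dots> = (\<integral>\<^sup>+x. ennreal (norm (f x)) * ennreal (norm (?J x)) \<partial>lborel)"
      by (simp add: norm_mult ennreal_mult)
    also have "\<dots> \<le> (\<integral>\<^sup>+x. ennreal (norm (f x)) * (\<integral>\<^sup>+w. ennreal (norm (f (x + e *\<^sub>R w)) * gauss w) \<partial>lborel) \<partial>lborel)"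
    proof (intro nn_integral_mono mult_left_mono)
      fix x
      show "ennreal (norm (?J x)) \<le> (\<integral>\<^sup>+w. ennreal (norm (f (x + e *\<^sub>R w)) * gauss w) \<partial>lborel)"
        by (rule order_trans[OF norm_integral_le_nn_integral]) (simp add: norm_mult)
    qed simp
    also have "\<dots> = (\<integral>\<^sup>+x. \<integral>\<^sup>+w. ennreal (norm (f x) * (norm (f (x + e *\<^sub>R w)) * gauss w)) \<partial>lborel \<partial>lborel)"
      by (subst nn_integral_cmult[symmetric]) (auto simp: ennreal_mult)
    also have "\<dots> \<le> (\<integral>\<^sup>+x. \<integral>\<^sup>+w. ennreal ((norm (f x))\<^sup>2 / 2 * gauss w) + ennreal ((norm (f (x + e *\<^sub>R w)))\<^sup>2 / 2 * gauss w) \<partial>lborel \<partial>lborel)"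
    proof (intro nn_integral_mono)
      fix x w
      have "norm (f x) * norm (f (x + e *\<^sub>R w)) \<le> (norm (f x))\<^sup>2 / 2 + (norm (f (x + e *\<^sub>R w)))\<^sup>2 / 2"
        using sum_squares_bound[of "norm (f x)" "norm (f (x + e *\<^sub>R w))"] by simp
      from mult_right_mono[OF this, of "gauss w"]
      have "norm (f x) * (norm (f (x + e *\<^sub>R w)) * gauss w) \<le> (norm (f x))\<^sup>2 / 2 * gauss w + (norm (f (x + e *\<^sub>R w)))\<^sup>2 / 2 * gauss w"
        by (simp only: gauss_nonneg distrib_right mult.assoc)
      from ennreal_leI[OF this]
      show "ennreal (norm (f x) * (norm (f (x + e *\<^sub>R w)) * gauss w)) \<le> ennreal ((norm (f x))\<^sup>2 / 2 * gauss w) + ennreal ((norm (f (x + e *\<^sub>R w)))\<^sup>2 / 2 * gauss w)"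
        by (subst (asm) ennreal_plus) simp_all
    qed
    also have "\<dots> = (\<integral>\<^sup>+x. \<integral>\<^sup>+w. ennreal ((norm (f x))\<^sup>2 / 2 * gauss w) \<partial>(lborel :: (real^'n) measure) \<partial>lborel)
      + (\<integral>\<^sup>+x. \<integral>\<^sup>+w. ennreal ((norm (f (x + e *\<^sub>R w)))\<^sup>2 / 2 * gauss w) \<partial>lborel \<partial>lborel)"
    proof -
      have "(\<integral>\<^sup>+w. ennreal ((norm (f x))\<^sup>2 / 2 * gauss w) + ennreal ((norm (f (x + e *\<^sub>R w)))\<^sup>2 / 2 * gauss w) \<partial>lborel)
        = (\<integral>\<^sup>+w. ennreal ((norm (f x))\<^sup>2 / 2 * gauss w) \<partial>(lborel :: (real^'n) measure)) + (\<integral>\<^sup>+w. ennreal ((norm (f (x + e *\<^sub>R w)))\<^sup>2 / 2 * gauss w) \<partial>lborel)" for x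
        by (rule nn_integral_add) measurable
      then show ?thesis
        by (simp only:) (rule nn_integral_add; intro lborel.borel_measurable_nn_integral; measurable)
    qed
    \<comment> \<open>Tonelli puts the integral over \<open>x\<close> inside, where the shift by
      \<open>e *\<^sub>R w\<close> is constant and disappears.\<close>
    also have "(\<integral>\<^sup>+x. \<integral>\<^sup>+w. ennreal ((norm (f (x + e *\<^sub>R w)))\<^sup>2 / 2 * gauss w) \<partial>lborel \<partial>lborel)
      = (\<integral>\<^sup>+w. \<integral>\<^sup>+x. ennreal ((norm (f (x + e *\<^sub>R w)))\<^sup>2 / 2 * gauss w) \<partial>lborel \<partial>lborel)"
      by (rule lborel_pair.Fubini'[symmetric]) measurable
    also have "\<dots> = (\<integral>\<^sup>+w. ennreal ((L2_norm f)\<^sup>2 / 2) * ennreal (gauss w) \<partial>(lborel :: (real^'n) measure))"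
    proof (rule nn_integral_cong)
      fix w
      have "(\<integral>\<^sup>+x. ennreal ((norm (f (x + e *\<^sub>R w)))\<^sup>2 / 2 * gauss w) \<partial>lborel)
        = (\<integral>\<^sup>+x. ennreal ((norm (f x))\<^sup>2 / 2 * gauss w) \<partial>(lborel :: (real^'n) measure))"
        by (rule nn_integral_translate) measurable
      also have "\<dots> = (\<integral>\<^sup>+x. ennreal (gauss w / 2) * ennreal ((norm (f x))\<^sup>2) \<partial>lborel)"
        by (intro nn_integral_cong) (simp add: ennreal_mult[symmetric] mult.commute)
      also have "\<dots> = ennreal (gauss w / 2) * ennreal ((L2_norm f)\<^sup>2)"
        by (subst nn_integral_cmult) (auto simp: nn_integral_L2[OF f2])
      also have "\<dots> = ennreal ((L2_norm f)\<^sup>2 / 2) * ennreal (gauss w)"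
        by (simp add: ennreal_mult[symmetric] mult.commute)
      finally show "(\<integral>\<^sup>+x. ennreal ((norm (f (x + e *\<^sub>R w)))\<^sup>2 / 2 * gauss w) \<partial>lborel) = ennreal ((L2_norm f)\<^sup>2 / 2) * ennreal (gauss w)" .
    qed
    also have "\<dots> = ennreal (?c * (L2_norm f)\<^sup>2 / 2)"
      by (subst nn_integral_cmult) (auto simp: nn_integral_gauss ennreal_mult[symmetric] mult.commute)
    also have "(\<integral>\<^sup>+x. \<integral>\<^sup>+w. ennreal ((norm (f x))\<^sup>2 / 2 * gauss w) \<partial>(lborel :: (real^'n) measure) \<partial>lborel)
       = (\<integral>\<^sup>+x. ennreal (?c / 2) * ennreal ((norm (f x))\<^sup>2) \<partial>lborel)"
    proof (rule nn_integral_cong)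
      fix x
      have "(\<integral>\<^sup>+w. ennreal ((norm (f x))\<^sup>2 / 2 * gauss w) \<partial>(lborel :: (real^'n) measure)) = (\<integral>\<^sup>+w. ennreal ((norm (f x))\<^sup>2 / 2) * ennreal (gauss w) \<partial>(lborel :: (real^'n) measure))"
        by (simp only: ennreal_mult gauss_nonneg zero_le_power2 divide_nonneg_pos zero_less_numeral)
      also have "\<dots> = ennreal ((norm (f x))\<^sup>2 / 2) * ennreal ?c"
        by (subst nn_integral_cmult) (auto simp: nn_integral_gauss)
      finally show "(\<integral>\<^sup>+w. ennreal ((norm (f x))\<^sup>2 / 2 * gauss w) \<partial>(lborel :: (real^'n) measure)) = ennreal (?c / 2) * ennreal ((norm (f x))\<^sup>2)"
        by (simp add: ennreal_mult[symmetric] mult.commute)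
    qed
    also have "\<dots> = ennreal (?c * (L2_norm f)\<^sup>2 / 2)"
      by (subst nn_integral_cmult) (auto simp: nn_integral_L2[OF f2] ennreal_mult[symmetric])
    also have "ennreal (?c * (L2_norm f)\<^sup>2 / 2) + ennreal (?c * (L2_norm f)\<^sup>2 / 2) = ennreal (?c * (L2_norm f)\<^sup>2)"
      by (subst ennreal_plus[symmetric]) auto
    finally show "ennreal (norm (LINT x|lborel. f x * ?J x)) \<le> ennreal (?c * (L2_norm f)\<^sup>2)" .
  qed simp
  also have "\<dots> = ennreal ((?c * L2_norm f)\<^sup>2)"
    by (simp add: ennreal_mult[symmetric] power2_eq_square mult_ac)
  finally show ?thesis .
qed

lemma tendsto_gauss_0:
  fixes x :: "'a::euclidean_space"
  shows "(\<lambda>k. gauss (inverse (real (Suc k)) *\<^sub>R x)) \<longlonglongrightarrow> 1"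
proof -
  have "(\<lambda>k. inverse (real (Suc k)) *\<^sub>R x) \<longlonglongrightarrow> 0 *\<^sub>R x"
    by (intro tendsto_scaleR LIMSEQ_inverse_real_of_nat tendsto_const)
  moreover have "isCont gauss (0 *\<^sub>R x)"
    unfolding gauss_def[abs_def] by (intro continuous_intros) auto
  ultimately have "(\<lambda>k. gauss (inverse (real (Suc k)) *\<^sub>R x)) \<longlonglongrightarrow> gauss (0 *\<^sub>R x)"
    by (rule isCont_tendsto_compose[rotated])
  then show ?thesis by (simp add: gauss_def)
qed

text \<open>The cutoff is removed along \<open>e = 1 / (k + 1)\<close>. Fatou suffices because the
  bound does not depend on \<open>e\<close>, and it yields square integrability of the transform at
  the same time.\<close>

lemma fourier_L1_L2_bound:
  fixes f :: "('n::finite) cfun"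
  assumes f: "integrable lborel f" and f2: "f \<in> L2"
  shows "(\<integral>\<^sup>+\<xi>. ennreal ((norm (fourier_L1 f \<xi>))\<^sup>2) \<partial>lborel) \<le> ennreal ((fourier_const TYPE('n) * L2_norm f)\<^sup>2)"
proof (rule nn_integral_Fatou_le[where u="\<lambda>k \<xi>. ennreal ((norm (fourier_L1 f \<xi>))\<^sup>2 * gauss (inverse (real (Suc k)) *\<^sub>R \<xi>))"])
  have [measurable]: "f \<in> borel_measurable borel" by (rule L2_measurable[OF f2])
  show "(\<lambda>\<xi>. ennreal ((norm (fourier_L1 f \<xi>))\<^sup>2 * gauss (inverse (real (Suc k)) *\<^sub>R \<xi>))) \<in> borel_measurable lborel" for k
    by measurable
  show "(\<integral>\<^sup>+\<xi>. ennreal ((norm (fourier_L1 f \<xi>))\<^sup>2 * gauss (inverse (real (Suc k)) *\<^sub>R \<xi>)) \<partial>lborel) \<le> ennreal ((fourier_const TYPE('n) * L2_norm f)\<^sup>2)" for k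
    by (rule fourier_L1_gauss_le[OF f f2]) simp
  have "(\<lambda>k. ennreal ((norm (fourier_L1 f \<xi>))\<^sup>2 * gauss (inverse (real (Suc k)) *\<^sub>R \<xi>))) \<longlonglongrightarrow> ennreal ((norm (fourier_L1 f \<xi>))\<^sup>2 * 1)" for \<xi>
    by (intro tendsto_ennrealI tendsto_mult tendsto_const tendsto_gauss_0)
  then show "AE \<xi> in lborel. (\<lambda>k. ennreal ((norm (fourier_L1 f \<xi>))\<^sup>2 * gauss (inverse (real (Suc k)) *\<^sub>R \<xi>))) \<longlonglongrightarrow> ennreal ((norm (fourier_L1 f \<xi>))\<^sup>2)"
    by simp
qed

lemma
  fixes f :: "('n::finite) cfun"
  assumes f: "integrable lborel f" and f2: "f \<in> L2"
  shows fourier_L1_L2: "fourier_L1 f \<in> L2"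
    and L2_norm_fourier_L1_le: "L2_norm (fourier_L1 f) \<le> fourier_const TYPE('n) * L2_norm f"
proof -
  have m: "fourier_L1 f \<in> borel_measurable borel"
    using L2_measurable[OF f2] by measurable
  show "fourier_L1 f \<in> L2" by (rule L2I[OF m fourier_L1_L2_bound[OF f f2]])
  show "L2_norm (fourier_L1 f) \<le> fourier_const TYPE('n) * L2_norm f"
    by (rule L2_norm_leI[OF m fourier_L1_L2_bound[OF f f2]]) simp
qed

text \<open>For the reverse inequality the average of \<open>f\<close> over a shrinking Gaussian has
  to converge to \<open>f x\<close> at each point. Continuity gives the convergence of the integrand
  and boundedness the majorant \<open>K * gauss w\<close>. The cutoff integrals on the frequency
  side stay below the full norm because \<open>gauss\<close> is at most \<open>1\<close>.\<close>

lemma L2_norm_fourier_L1_continuous: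
  fixes f :: "('n::finite) cfun"
  assumes f: "integrable lborel f" and f2: "f \<in> L2" and cont: "continuous_on UNIV f" and bd: "\<And>x. norm (f x) \<le> K"
  shows "fourier_const TYPE('n) * L2_norm f \<le> L2_norm (fourier_L1 f)"
proof -
  let ?c = "fourier_const TYPE('n)"
  let ?e = "\<lambda>k. inverse (real (Suc k))"
  have fm [measurable]: "f \<in> borel_measurable borel" by (rule L2_measurable[OF f2])
  have [measurable]: "cnj \<in> borel_measurable borel"
    by (intro borel_measurable_continuous_onI continuous_intros)
  have [measurable]: "(\<lambda>w::real^'n. complex_of_real (gauss w)) \<in> borel_measurable borel" by measurable
  let ?J = "\<lambda>k x. LINT w|lborel. cnj (f (x + ?e k *\<^sub>R w)) * complex_of_real (gauss w)"
  have ig: "integrable lborel (\<lambda>w::real^'n. gauss w)" using integrable_gauss[of 1, where ?'a="real^'n"] by simp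
  have igc: "(LINT w|(lborel::(real^'n) measure). complex_of_real (gauss w)) = complex_of_real ?c"
    using integral_gauss[of 1, where ?'a="real^'n"] by (simp add: fourier_const_def)
  have J_lim: "(\<lambda>k. ?J k x) \<longlonglongrightarrow> cnj (f x) * complex_of_real ?c" for x
  proof -
    have "(\<lambda>k. ?J k x) \<longlonglongrightarrow> (LINT w|(lborel::(real^'n) measure). cnj (f x) * complex_of_real (gauss w))"
    proof (rule integral_dominated_convergence[where w="\<lambda>w. K * gauss w"])
      show "integrable lborel (\<lambda>w::real^'n. K * gauss w)" using ig by simp
      have "(\<lambda>k. cnj (f (x + ?e k *\<^sub>R w)) * complex_of_real (gauss w)) \<longlonglongrightarrow> cnj (f x) * complex_of_real (gauss w)" for w
      proof -
        have "(\<lambda>k. x + ?e k *\<^sub>R w) \<longlonglongrightarrow> x + 0 *\<^sub>R w"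
          by (intro tendsto_intros LIMSEQ_inverse_real_of_nat)
        then have "(\<lambda>k. f (x + ?e k *\<^sub>R w)) \<longlonglongrightarrow> f x"
          using cont by (intro isCont_tendsto_compose[where g=f]) (auto simp: continuous_on_eq_continuous_at)
        then show ?thesis by (intro tendsto_intros)
      qed
      then show "AE w in lborel. (\<lambda>k. cnj (f (x + ?e k *\<^sub>R w)) * complex_of_real (gauss w)) \<longlonglongrightarrow> cnj (f x) * complex_of_real (gauss w)"
        by simp
      show "AE w in lborel. norm (cnj (f (x + ?e k *\<^sub>R w)) * complex_of_real (gauss w)) \<le> K * gauss w" for k
        by (auto simp: norm_mult intro!: mult_right_mono bd)
    qed measurable
    then show ?thesis by (simp only: integral_mult_right_zero igc)
  qed
  have J_le: "norm (?J k x) \<le> K * ?c" for k x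
  proof -
    have "norm (?J k x) \<le> (LINT w|(lborel::(real^'n) measure). K * gauss w)"
    proof (rule Bochner_Integration.integral_norm_bound_integral)
      show i: "integrable lborel (\<lambda>w::real^'n. K * gauss w)" using ig by simp
      show le: "norm (cnj (f (x + ?e k *\<^sub>R w)) * complex_of_real (gauss w)) \<le> K * gauss w" for w
        by (auto simp: norm_mult intro!: mult_right_mono bd)
      show "integrable lborel (\<lambda>w. cnj (f (x + ?e k *\<^sub>R w)) * complex_of_real (gauss w))"
      proof (rule Bochner_Integration.integrable_bound[OF i])
        show "AE w in lborel. norm (cnj (f (x + ?e k *\<^sub>R w)) * complex_of_real (gauss w)) \<le> norm (K * gauss w)"
          by (intro AE_I2 order_trans[OF le]) simp
      qed measurable
    qed
    also have "\<dots> = K * ?c"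
      using integral_gauss[of 1, where ?'a="real^'n"] by (simp add: fourier_const_def)
    finally show ?thesis .
  qed
  have Jm: "(\<lambda>x. ?J k x) \<in> borel_measurable lborel" for k
    by (intro lborel.borel_measurable_lebesgue_integral) measurable
  have "(\<lambda>k. LINT x|lborel. f x * ?J k x) \<longlonglongrightarrow> (LINT x|lborel. f x * (cnj (f x) * complex_of_real ?c))"
  proof (rule integral_dominated_convergence[where w="\<lambda>x. norm (f x) * (K * ?c)"])
    show "integrable lborel (\<lambda>x. norm (f x) * (K * ?c))" using f by simp
    show "AE x in lborel. (\<lambda>k. f x * ?J k x) \<longlonglongrightarrow> f x * (cnj (f x) * complex_of_real ?c)"
      by (intro AE_I2 tendsto_mult tendsto_const J_lim)
    show "AE x in lborel. norm (f x * ?J k x) \<le> norm (f x) * (K * ?c)" for k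
      unfolding norm_mult by (intro AE_I2 mult_left_mono J_le) auto
    show "(\<lambda>x. f x * ?J k x) \<in> borel_measurable lborel" for k
      using Jm[of k] by measurable
  qed measurable
  also have "(LINT x|lborel. f x * (cnj (f x) * complex_of_real ?c)) = complex_of_real ((L2_norm f)\<^sup>2 * ?c)"
    unfolding L2_norm_power2 of_real_mult integral_complex_of_real[symmetric]
    by (subst integral_mult_left_zero[symmetric]) (simp only: complex_norm_square mult.assoc)
  finally have lim: "(\<lambda>k. complex_of_real ?c * (LINT x|lborel. f x * ?J k x)) \<longlonglongrightarrow> complex_of_real ?c * complex_of_real ((L2_norm f)\<^sup>2 * ?c)"
    by (intro tendsto_mult tendsto_const)
  have "complex_of_real ?c * (LINT x|lborel. f x * ?J k x) = complex_of_real (LINT \<xi>|lborel. (norm (fourier_L1 f \<xi>))\<^sup>2 * gauss (?e k *\<^sub>R \<xi>))" for k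
    using integral_norm_fourier_L1_gauss[OF f, of "?e k"] by (simp add: fourier_const_def)
  with lim have "(\<lambda>k. complex_of_real (LINT \<xi>|lborel. (norm (fourier_L1 f \<xi>))\<^sup>2 * gauss (?e k *\<^sub>R \<xi>))) \<longlonglongrightarrow> complex_of_real (?c * ((L2_norm f)\<^sup>2 * ?c))"
    by simp
  then have "(\<lambda>k. LINT \<xi>|lborel. (norm (fourier_L1 f \<xi>))\<^sup>2 * gauss (?e k *\<^sub>R \<xi>)) \<longlonglongrightarrow> ?c * ((L2_norm f)\<^sup>2 * ?c)"
    by (simp only: tendsto_of_real_iff)
  moreover have "(LINT \<xi>|lborel. (norm (fourier_L1 f \<xi>))\<^sup>2 * gauss (?e k *\<^sub>R \<xi>)) \<le> (L2_norm (fourier_L1 f))\<^sup>2" for k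
    unfolding L2_norm_power2
  proof (rule integral_mono')
    show "integrable lborel (\<lambda>\<xi>. (norm (fourier_L1 f \<xi>))\<^sup>2)" by (intro L2_integrable fourier_L1_L2 f f2)
    show "(norm (fourier_L1 f \<xi>))\<^sup>2 * gauss (?e k *\<^sub>R \<xi>) \<le> (norm (fourier_L1 f \<xi>))\<^sup>2" for \<xi>
      by (intro mult_left_le gauss_le_1) auto
  qed simp
  ultimately have "?c * ((L2_norm f)\<^sup>2 * ?c) \<le> (L2_norm (fourier_L1 f))\<^sup>2"
    by (intro LIMSEQ_le_const2) auto
  then have "(?c * L2_norm f)\<^sup>2 \<le> (L2_norm (fourier_L1 f))\<^sup>2" by (simp add: power2_eq_square mult_ac)
  then show ?thesis by (rule power2_le_imp_le) simp
qed

text \<open>The lower bound passes from continuous functions to \<open>f\<close> by density, since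
  the upper bound makes the transform Lipschitz for the L^2 norm. The approximation error is paid
  twice, once for \<open>f\<close> and once for its transform, and each time multiplied by the
  constant; hence the tolerance \<open>d / (2 * ?c)\<close>.\<close>

theorem Plancherel_L1:
  fixes f :: "('n::finite) cfun"
  assumes f: "integrable lborel f" and f2: "f \<in> L2"
  shows "L2_norm (fourier_L1 f) = fourier_const TYPE('n) * L2_norm f"
proof (rule antisym[OF L2_norm_fourier_L1_le[OF f f2]], rule field_le_epsilon)
  fix d :: real assume d: "d > 0"
  let ?c = "fourier_const TYPE('n)"
  obtain g K where g: "continuous_on UNIV g" "\<And>x. norm (g x) \<le> K" "integrable lborel g" "g \<in> L2" "L2_norm (\<lambda>x. g x - f x) < d / (2 * ?c)"
    using L2_dense_continuous[OF f2, of "d / (2 * ?c)"] d fourier_const_pos by (metis divide_pos_pos mult_pos_pos zero_less_numeral)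
  have "L2_norm (\<lambda>x. f x - g x) < d / (2 * ?c)"
    using g(5) L2_norm_minus[of "\<lambda>x. g x - f x"] by simp
  then have fg: "?c * L2_norm (\<lambda>x. f x - g x) < d / 2" by (simp add: field_simps)
  have "L2_norm f \<le> L2_norm (\<lambda>x. f x - g x) + L2_norm g"
    using L2_norm_triangle[OF L2_diff[OF f2 g(4)] g(4)] by simp
  then have 1: "?c * L2_norm f \<le> ?c * L2_norm (\<lambda>x. f x - g x) + ?c * L2_norm g"
    unfolding distrib_left[symmetric] by (rule mult_left_mono) simp
  have 2: "?c * L2_norm g \<le> L2_norm (fourier_L1 g)"
    by (rule L2_norm_fourier_L1_continuous[OF g(3,4,1,2)])
  have "L2_norm (\<lambda>\<xi>. fourier_L1 g \<xi> - fourier_L1 f \<xi>) = L2_norm (fourier_L1 (\<lambda>x. g x - f x))"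
    by (rule arg_cong[where f=L2_norm], rule ext, rule fourier_L1_diff[symmetric, OF g(3) f])
  also have "\<dots> \<le> ?c * L2_norm (\<lambda>x. g x - f x)"
    by (intro L2_norm_fourier_L1_le Bochner_Integration.integrable_diff L2_diff f f2 g)
  finally have 3: "L2_norm (\<lambda>\<xi>. fourier_L1 g \<xi> - fourier_L1 f \<xi>) \<le> ?c * L2_norm (\<lambda>x. f x - g x)"
    using L2_norm_minus[of "\<lambda>x. g x - f x"] by simp
  have "L2_norm (fourier_L1 g) \<le> L2_norm (\<lambda>\<xi>. fourier_L1 g \<xi> - fourier_L1 f \<xi>) + L2_norm (fourier_L1 f)"
    using L2_norm_triangle[OF L2_diff[OF fourier_L1_L2[OF g(3,4)] fourier_L1_L2[OF f f2]] fourier_L1_L2[OF f f2]] by simp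
  with 1 2 3 fg show "?c * L2_norm f \<le> L2_norm (fourier_L1 f) + d" by linarith
qed

section \<open>The Fourier transform of square integrable functions\<close>

text \<open>Riesz-Fischer for sequences with geometric increments. Instead of Minkowski's inequality
  for series, the squares of the increments are summed with weight \<open>4^k\<close>: as their
  integrals are of order \<open>16^(-k)\<close>, the sum has a finite integral. At almost every
  point the increments are then of order \<open>2^(-k)\<close>, and the sequence converges
  absolutely.\<close>

lemma L2_complete:
  fixes s :: "nat \<Rightarrow> ('n::finite) cfun"
  assumes s: "\<And>k. s k \<in> L2" and K: "0 \<le> K" and le: "\<And>k. L2_norm (\<lambda>x. s (Suc k) x - s k x) \<le> K * (1/4)^k"
  shows "\<exists>g\<in>L2. (\<lambda>k. L2_norm (\<lambda>x. s k x - g x)) \<longlonglongrightarrow> 0"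
proof -
  have sm [measurable]: "s k \<in> borel_measurable borel" for k by (rule L2_measurable[OF s])
  define d where "d k x = s (Suc k) x - s k x" for k x
  have d: "d k \<in> L2" for k unfolding d_def by (intro L2_diff s)
  have dm [measurable]: "d k \<in> borel_measurable borel" for k by (rule L2_measurable[OF d])
  have "(\<integral>\<^sup>+x. (\<Sum>k. ennreal (4^k * (norm (d k x))\<^sup>2)) \<partial>lborel) = (\<Sum>k. \<integral>\<^sup>+x. ennreal (4^k * (norm (d k x))\<^sup>2) \<partial>lborel)"
    by (rule nn_integral_suminf) measurable
  also have "\<dots> = (\<Sum>k. ennreal (4^k * (L2_norm (d k))\<^sup>2))"
    by (intro suminf_cong) (simp add: ennreal_mult nn_integral_cmult nn_integral_L2[OF d])
  also have "\<dots> \<le> (\<Sum>k. ennreal (K\<^sup>2 * (1/4)^k))"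
  proof (intro suminf_le allI ennreal_leI)
    fix k
    have "(L2_norm (d k))\<^sup>2 \<le> (K * (1/4)^k)\<^sup>2"
      using le[of k] by (intro power_mono) (simp_all add: d_def[abs_def])
    then have "4^k * (L2_norm (d k))\<^sup>2 \<le> 4^k * (K * (1/4)^k)\<^sup>2" by simp
    also have "\<dots> = K\<^sup>2 * (4 * (1/4) * (1/4))^k" by (simp only: power_mult_distrib power2_eq_square mult_ac)
    finally show "4^k * (L2_norm (d k))\<^sup>2 \<le> K\<^sup>2 * (1/4)^k" by simp
  qed auto
  also have "\<dots> < \<infinity>"
    by (subst suminf_ennreal2) (auto intro!: summable_mult summable_geometric)
  finally have fin: "(\<integral>\<^sup>+x. (\<Sum>k. ennreal (4^k * (norm (d k x))\<^sup>2)) \<partial>lborel) < \<infinity>" .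
  have "AE x in lborel. (\<Sum>k. ennreal (4^k * (norm (d k x))\<^sup>2)) \<noteq> \<infinity>"
    by (rule nn_integral_noteq_infinite[OF _ less_imp_neq[OF fin]]) measurable
  then have conv: "AE x in lborel. convergent (\<lambda>k. s k x)"
  proof eventually_elim
    case (elim x)
    have "\<exists>B. S = ennreal B \<and> 0 \<le> B" if "S \<noteq> \<infinity>" for S :: ennreal
      using that by (cases S) auto
    from this[OF elim] obtain B where B: "(\<Sum>k. ennreal (4^k * (norm (d k x))\<^sup>2)) = ennreal B" "0 \<le> B"
      by blast
    have dB: "norm (d k x) \<le> sqrt B * (1/2)^k" for k
    proof -
      have "a k \<le> suminf a" for a :: "nat \<Rightarrow> ennreal"
        using sum_le_suminf[of a "{k}"] by simp
      from this[of "\<lambda>k. ennreal (4^k * (norm (d k x))\<^sup>2)"]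
      have "ennreal (4^k * (norm (d k x))\<^sup>2) \<le> ennreal B" by (simp only: B(1))
      then have "4^k * (norm (d k x))\<^sup>2 \<le> B" by (simp only: ennreal_le_iff[OF B(2)])
      moreover have "(2^k * norm (d k x))\<^sup>2 = (2 * 2)^k * (norm (d k x))\<^sup>2"
        by (simp only: power_mult_distrib power2_eq_square mult_ac)
      ultimately have "(2^k * norm (d k x))\<^sup>2 \<le> (sqrt B)\<^sup>2"
        using B(2) by simp
      then have "2^k * norm (d k x) \<le> sqrt B" by (rule power2_le_imp_le) (simp add: B)
      then show ?thesis by (simp add: field_simps power_divide)
    qed
    have "summable (\<lambda>k. d k x)"
      by (rule summable_comparison_test'[OF summable_mult[OF summable_geometric], of "1/2" 0 _ "sqrt B"]) (auto intro: dB)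
    then have "convergent (\<lambda>n. \<Sum>k<n. d k x)" by (simp add: summable_iff_convergent)
    moreover have "(\<Sum>k<n. d k x) = s n x - s 0 x" for n
      unfolding d_def by (rule sum_lessThan_telescope)
    ultimately have "convergent (\<lambda>n. (s n x - s 0 x) + s 0 x)"
      by (intro convergent_add convergent_const) simp
    then show ?case by simp
  qed
  \<comment> \<open>\<open>lim\<close> is unspecified where the sequence diverges, but that set is
    null.\<close>
  define g where "g x = lim (\<lambda>k. s k x)" for x
  have gm [measurable]: "g \<in> borel_measurable borel"
    unfolding g_def[abs_def] by (rule borel_measurable_lim_metric) measurable
  have lim: "AE x in lborel. (\<lambda>k. s k x) \<longlonglongrightarrow> g x"
    using conv by eventually_elim (simp add: g_def convergent_LIMSEQ_iff)
  \<comment> \<open>A telescoped geometric sum; the subtracted term makes the induction close,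
    because \<open>2 - 2/4\<close> is at least \<open>1\<close>.\<close>
  have skm: "L2_norm (\<lambda>x. s k x - s (k + m) x) \<le> 2 * K * (1/4)^k - 2 * K * (1/4)^(k+m)" for k m
  proof (induction m)
    case 0
    then show ?case using K by (simp add: L2_norm_def)
  next
    case (Suc m)
    have "L2_norm (\<lambda>x. s k x - s (k + Suc m) x) \<le> L2_norm (\<lambda>x. s k x - s (k + m) x) + L2_norm (\<lambda>x. s (k + m) x - s (k + Suc m) x)"
      by (intro L2_norm_triangle_via s)
    also have "L2_norm (\<lambda>x. s (k + m) x - s (k + Suc m) x) = L2_norm (\<lambda>x. s (Suc (k + m)) x - s (k + m) x)"
      using L2_norm_minus[of "\<lambda>x. s (Suc (k + m)) x - s (k + m) x"] by simp
    also have "L2_norm (\<lambda>x. s k x - s (k + m) x) + \<dots> \<le> (2 * K * (1/4)^k - 2 * K * (1/4)^(k+m)) + K * (1/4)^(k + m)"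
      by (intro add_mono Suc.IH le)
    finally show ?case using mult_nonneg_nonneg[OF K, of "(1/4)^(k+m)"] by simp
  qed
  have le_g: "(\<integral>\<^sup>+x. ennreal ((norm (s k x - g x))\<^sup>2) \<partial>lborel) \<le> ennreal ((2 * K * (1/4)^k)\<^sup>2)" for k
  proof (rule nn_integral_Fatou_le[where u="\<lambda>m x. ennreal ((norm (s k x - s (k + m) x))\<^sup>2)"])
    show "AE x in lborel. (\<lambda>m. ennreal ((norm (s k x - s (k + m) x))\<^sup>2)) \<longlonglongrightarrow> ennreal ((norm (s k x - g x))\<^sup>2)"
      using lim
    proof eventually_elim
      case (elim x)
      then have "(\<lambda>m. s (k + m) x) \<longlonglongrightarrow> g x"
        using LIMSEQ_ignore_initial_segment[of "\<lambda>m. s m x" "g x" k] by (simp add: add.commute)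
      then show ?case by (intro tendsto_ennrealI tendsto_intros)
    qed
    show "(\<integral>\<^sup>+x. ennreal ((norm (s k x - s (k + m) x))\<^sup>2) \<partial>lborel) \<le> ennreal ((2 * K * (1/4)^k)\<^sup>2)" for m
      unfolding nn_integral_L2[OF L2_diff[OF s s]]
      by (intro ennreal_leI power_mono order_trans[OF skm]) (use K in auto)
  qed measurable
  have sg: "(\<lambda>x. s k x - g x) \<in> L2" for k
    by (rule L2I[OF _ le_g]) measurable
  have "g \<in> L2" using L2_diff[OF s sg, of 0 0] by simp
  moreover have "(\<lambda>k. L2_norm (\<lambda>x. s k x - g x)) \<longlonglongrightarrow> 0"
  proof (rule Lim_null_comparison)
    have "L2_norm (\<lambda>x. s k x - g x) \<le> 2 * K * (1/4)^k" for k
      by (rule L2_norm_leI[OF _ le_g]) (use K in auto)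
    then show "\<forall>\<^sub>F k in sequentially. norm (L2_norm (\<lambda>x. s k x - g x)) \<le> 2 * K * (1/4)^k" by simp
    show "(\<lambda>k. 2 * K * (1/4)^k) \<longlonglongrightarrow> 0"
      by (intro tendsto_mult_right_zero LIMSEQ_power_zero) simp
  qed
  ultimately show ?thesis by blast
qed

section \<open>Truncated transforms: existence and uniqueness of their L^2 limit\<close>

definition trunc :: "real \<Rightarrow> ('n::finite) cfun \<Rightarrow> 'n cfun" where
  "trunc R f = (\<lambda>x. indicator (cball 0 R) x * f x)"

lemma trunc_L2: "f \<in> L2 \<Longrightarrow> trunc R f \<in> L2"
  unfolding trunc_def by (rule L2_bounded_mult(1)[where K=1]) (auto simp: indicator_def borel_measurable_indicator)

lemma trunc_integrable:
  assumes "f \<in> L2"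
  shows "integrable lborel (trunc R f)"
proof -
  let ?i = "indicator (cball 0 R) :: real^'n \<Rightarrow> complex"
  have i: "?i \<in> L2"
  proof (rule L2_of_bounded_support(2)[where B=1 and r=R])
    show "?i \<in> borel_measurable borel" by (rule borel_measurable_indicator) simp
  qed (simp add: indicator_def)
  show ?thesis
    by (rule Bochner_Integration.integrable_bound[OF L2_integrable_norm_mult[OF i assms]])
      (use L2_measurable[OF trunc_L2[OF assms]] in \<open>auto simp: trunc_def norm_mult\<close>)
qed

lemma trunc_tendsto:
  assumes f: "f \<in> L2"
  shows "((\<lambda>R. L2_norm (\<lambda>x. trunc R f x - f x)) \<longlongrightarrow> 0) at_top"
proof (rule tendsto_at_topI_sequentially)
  fix X :: "nat \<Rightarrow> real" assume X: "filterlim X at_top sequentially"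
  have [measurable]: "f \<in> borel_measurable borel" by (rule L2_measurable[OF f])
  show "(\<lambda>k. L2_norm (\<lambda>x. trunc (X k) f x - f x)) \<longlonglongrightarrow> 0"
  proof (rule L2_dominated_convergence[where D="\<lambda>x. norm (f x)"])
    show "trunc (X k) f \<in> borel_measurable borel" for k by (rule L2_measurable[OF trunc_L2[OF f]])
    have "(\<lambda>k. trunc (X k) f x) \<longlonglongrightarrow> f x" for x
    proof (rule tendsto_eventually)
      have "\<forall>\<^sub>F k in sequentially. norm x \<le> X k" using X by (simp add: filterlim_at_top)
      then show "\<forall>\<^sub>F k in sequentially. trunc (X k) f x = f x"
        by eventually_elim (simp add: trunc_def)
    qed
    then show "AE x in lborel. (\<lambda>k. trunc (X k) f x) \<longlonglongrightarrow> f x" by simp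
  qed (use L2_integrable[OF f] in \<open>auto simp: trunc_def norm_mult indicator_def\<close>)
qed

definition is_fourier :: "('n::finite) cfun \<Rightarrow> 'n cfun \<Rightarrow> bool" where
  "is_fourier f g \<longleftrightarrow> g \<in> L2 \<and> ((\<lambda>R. L2_norm (\<lambda>\<xi>. fourier_L1 (trunc R f) \<xi> - g \<xi>)) \<longlongrightarrow> 0) at_top"

lemma fourier_trunc_L2: "f \<in> L2 \<Longrightarrow> fourier_L1 (trunc R f) \<in> L2"
  by (intro fourier_L1_L2 trunc_integrable trunc_L2)

text \<open>For \<open>f\<close> in \<open>L2\<close> the difference of the truncated transform and
  a candidate in \<open>L2\<close> is square integrable, so the nonnegative integral is the square
  of \<open>L2_norm\<close>. From here on convergence can be handled with real norms and the
  triangle inequality.\<close>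

lemma fourier_eq_SOME:
  assumes f: "f \<in> L2"
  shows "fourier f = (SOME g. is_fourier f g)"
proof -
  have "(g \<in> L2 \<and> ((\<lambda>R::real. \<integral>\<^sup>+\<xi>. ennreal ((norm (fourier_L1 (\<lambda>x. indicator (cball 0 R) x * f x) \<xi> - g \<xi>))\<^sup>2) \<partial>lborel) \<longlongrightarrow> 0) at_top)
      \<longleftrightarrow> is_fourier f g" for g
  proof (cases "g \<in> L2")
    case True
    let ?N = "\<lambda>R. L2_norm (\<lambda>\<xi>. fourier_L1 (trunc R f) \<xi> - g \<xi>)"
    have "((\<lambda>R. ennreal ((?N R)\<^sup>2)) \<longlongrightarrow> ennreal 0) at_top \<longleftrightarrow> ((\<lambda>R. (?N R)\<^sup>2) \<longlongrightarrow> 0) at_top"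
      by (rule tendsto_ennreal_iff) auto
    also have "\<dots> \<longleftrightarrow> (?N \<longlongrightarrow> 0) at_top"
      using tendsto_power[of ?N 0 at_top 2] tendsto_real_sqrt[of "\<lambda>R. (?N R)\<^sup>2" 0 at_top] by auto
    finally show ?thesis
      using True by (simp add: is_fourier_def nn_integral_L2[OF L2_diff[OF fourier_trunc_L2[OF f] True]] flip: trunc_def)
  qed (simp add: is_fourier_def)
  then show ?thesis unfolding fourier_def by simp
qed

text \<open>The radii \<open>r k\<close> make the truncation error at most \<open>(1/4)^k\<close>,
  which is the rate that \<open>L2_complete\<close> asks for; comparing two truncations costs two
  such errors, hence the factor \<open>2\<close>. The same comparison then extends convergence from
  the radii \<open>r k\<close> to all \<open>R\<close>.\<close>

lemma is_fourier_exists: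
  fixes f :: "('n::finite) cfun"
  assumes f: "f \<in> L2"
  shows "\<exists>g. is_fourier f g"
proof -
  let ?c = "fourier_const TYPE('n)"
  have iso: "L2_norm (\<lambda>\<xi>. fourier_L1 (trunc R f) \<xi> - fourier_L1 (trunc S f) \<xi>) \<le> ?c * (L2_norm (\<lambda>x. trunc R f x - f x) + L2_norm (\<lambda>x. trunc S f x - f x))" for R S
  proof -
    have "L2_norm (\<lambda>\<xi>. fourier_L1 (trunc R f) \<xi> - fourier_L1 (trunc S f) \<xi>) = L2_norm (fourier_L1 (\<lambda>x. trunc R f x - trunc S f x))"
      by (rule arg_cong[where f=L2_norm], rule ext, rule fourier_L1_diff[symmetric, OF trunc_integrable[OF f] trunc_integrable[OF f]])
    also have "\<dots> \<le> ?c * L2_norm (\<lambda>x. trunc R f x - trunc S f x)"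
      by (intro L2_norm_fourier_L1_le Bochner_Integration.integrable_diff trunc_integrable L2_diff trunc_L2 f)
    also have "\<dots> \<le> ?c * (L2_norm (\<lambda>x. trunc R f x - f x) + L2_norm (\<lambda>x. f x - trunc S f x))"
      by (intro mult_left_mono L2_norm_triangle_via trunc_L2 f) simp
    also have "L2_norm (\<lambda>x. f x - trunc S f x) = L2_norm (\<lambda>x. trunc S f x - f x)"
      using L2_norm_minus[of "\<lambda>x. trunc S f x - f x"] by simp
    finally show ?thesis .
  qed
  have "\<exists>R0. \<forall>R\<ge>R0. L2_norm (\<lambda>x. trunc R f x - f x) < (1/4)^k" for k :: nat
    using order_tendstoD(2)[OF trunc_tendsto[OF f], of "(1/4)^k"] by (simp add: eventually_at_top_linorder)
  then obtain r where r: "\<And>k R. r k \<le> R \<Longrightarrow> L2_norm (\<lambda>x. trunc R f x - f x) < (1/4)^k" by metis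
  let ?s = "\<lambda>k. fourier_L1 (trunc (r k) f)"
  have "\<exists>g\<in>L2. (\<lambda>k. L2_norm (\<lambda>x. ?s k x - g x)) \<longlonglongrightarrow> 0"
  proof (rule L2_complete)
    show "?s k \<in> L2" for k by (rule fourier_trunc_L2[OF f])
    show "L2_norm (\<lambda>x. ?s (Suc k) x - ?s k x) \<le> (?c * 2) * (1/4)^k" for k
    proof -
      have "L2_norm (\<lambda>x. trunc (r (Suc k)) f x - f x) + L2_norm (\<lambda>x. trunc (r k) f x - f x) \<le> 2 * (1/4)^k"
        using r[of k "r k"] r[of "Suc k" "r (Suc k)"] L2_norm_nonneg[of "\<lambda>x. trunc (r (Suc k)) f x - f x"]
        unfolding power_Suc by linarith
      then have "?c * (L2_norm (\<lambda>x. trunc (r (Suc k)) f x - f x) + L2_norm (\<lambda>x. trunc (r k) f x - f x)) \<le> ?c * (2 * (1/4)^k)"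
        by (rule mult_left_mono) simp
      with iso[of "r (Suc k)" "r k"] show ?thesis by (simp only: mult.assoc)
    qed
  qed simp
  then obtain g where g: "g \<in> L2" "(\<lambda>k. L2_norm (\<lambda>x. ?s k x - g x)) \<longlonglongrightarrow> 0" by blast
  have "((\<lambda>R. L2_norm (\<lambda>\<xi>. fourier_L1 (trunc R f) \<xi> - g \<xi>)) \<longlongrightarrow> 0) at_top"
  proof (rule tendstoI)
    fix e :: real assume e: "e > 0"
    have "(\<lambda>k. ?c * (2 * (1/4)^k) + L2_norm (\<lambda>x. ?s k x - g x)) \<longlonglongrightarrow> ?c * (2 * 0) + 0"
      by (intro tendsto_intros g(2) LIMSEQ_power_zero) simp
    then have "\<forall>\<^sub>F k in sequentially. ?c * (2 * (1/4)^k) + L2_norm (\<lambda>x. ?s k x - g x) < e"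
      using e by (intro order_tendstoD(2)[where a=e]) auto
    then obtain k where k: "?c * (2 * (1/4)^k) + L2_norm (\<lambda>x. ?s k x - g x) < e"
      by (auto simp: eventually_sequentially)
    have "L2_norm (\<lambda>\<xi>. fourier_L1 (trunc R f) \<xi> - g \<xi>) < e" if "r k \<le> R" for R
    proof -
      have "L2_norm (\<lambda>\<xi>. fourier_L1 (trunc R f) \<xi> - g \<xi>) \<le> L2_norm (\<lambda>\<xi>. fourier_L1 (trunc R f) \<xi> - ?s k \<xi>) + L2_norm (\<lambda>\<xi>. ?s k \<xi> - g \<xi>)"
        by (intro L2_norm_triangle_via fourier_trunc_L2 f g)
      moreover have "L2_norm (\<lambda>x. trunc R f x - f x) + L2_norm (\<lambda>x. trunc (r k) f x - f x) \<le> 2 * (1/4)^k"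
        using r[of k R] r[of k "r k"] that by simp
      then have "?c * (L2_norm (\<lambda>x. trunc R f x - f x) + L2_norm (\<lambda>x. trunc (r k) f x - f x)) \<le> ?c * (2 * (1/4)^k)"
        by (rule mult_left_mono) simp
      with iso[of R "r k"] have "L2_norm (\<lambda>\<xi>. fourier_L1 (trunc R f) \<xi> - ?s k \<xi>) \<le> ?c * (2 * (1/4)^k)"
        by linarith
      ultimately show ?thesis using k by linarith
    qed
    then show "\<forall>\<^sub>F R in at_top. dist (L2_norm (\<lambda>\<xi>. fourier_L1 (trunc R f) \<xi> - g \<xi>)) 0 < e"
      by (auto simp: eventually_at_top_linorder)
  qed
  with g(1) show ?thesis unfolding is_fourier_def by blast
qed

lemma is_fourier_fourier: "f \<in> L2 \<Longrightarrow> is_fourier f (fourier f)"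
  by (simp add: fourier_eq_SOME) (rule someI_ex[OF is_fourier_exists])

lemma fourier_L2: "f \<in> L2 \<Longrightarrow> fourier f \<in> L2"
  using is_fourier_fourier[of f] by (simp add: is_fourier_def)

lemma fourier_tendsto: "f \<in> L2 \<Longrightarrow> ((\<lambda>R. L2_norm (\<lambda>\<xi>. fourier_L1 (trunc R f) \<xi> - fourier f \<xi>)) \<longlongrightarrow> 0) at_top"
  using is_fourier_fourier[of f] by (simp add: is_fourier_def)

text \<open>The only access to the value chosen by \<open>SOME\<close>: a formula for a transform is
  proved by showing that its right side is a limit of the truncated transforms.\<close>

lemma fourier_unique:
  fixes f g :: "('n::finite) cfun"
  assumes f: "f \<in> L2" and g: "is_fourier f g"
  shows "AE \<xi> in lborel. fourier f \<xi> = g \<xi>"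
proof -
  have gL: "g \<in> L2" and lim: "((\<lambda>R. L2_norm (\<lambda>\<xi>. fourier_L1 (trunc R f) \<xi> - g \<xi>)) \<longlongrightarrow> 0) at_top"
    using g by (auto simp: is_fourier_def)
  have "((\<lambda>R. L2_norm (\<lambda>\<xi>. fourier_L1 (trunc R f) \<xi> - fourier f \<xi>) + L2_norm (\<lambda>\<xi>. fourier_L1 (trunc R f) \<xi> - g \<xi>)) \<longlongrightarrow> 0 + 0) at_top"
    by (intro tendsto_add fourier_tendsto f lim)
  moreover have "L2_norm (\<lambda>\<xi>. fourier f \<xi> - g \<xi>) \<le> L2_norm (\<lambda>\<xi>. fourier_L1 (trunc R f) \<xi> - fourier f \<xi>) + L2_norm (\<lambda>\<xi>. fourier_L1 (trunc R f) \<xi> - g \<xi>)" for R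
    using L2_norm_triangle_via[OF fourier_L2[OF f] fourier_trunc_L2[OF f, of R] gL] L2_norm_minus[of "\<lambda>\<xi>. fourier_L1 (trunc R f) \<xi> - fourier f \<xi>"] by simp
  ultimately have "L2_norm (\<lambda>\<xi>. fourier f \<xi> - g \<xi>) \<le> 0 + 0"
    by (intro tendsto_lowerbound[where F="at_top::real filter"]) auto
  then have "L2_norm (\<lambda>\<xi>. fourier f \<xi> - g \<xi>) = 0" by (simp add: antisym)
  from L2_norm_zero_AE[OF L2_diff[OF fourier_L2[OF f] gL] this] show ?thesis by simp
qed

theorem Plancherel:
  fixes f :: "('n::finite) cfun"
  assumes f: "f \<in> L2"
  shows "L2_norm (fourier f) = fourier_const TYPE('n) * L2_norm f"
proof (rule tendsto_unique[of "at_top :: real filter"])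
  show "((\<lambda>R. L2_norm (fourier_L1 (trunc R f))) \<longlongrightarrow> L2_norm (fourier f)) at_top"
    by (rule L2_norm_tendsto[OF fourier_trunc_L2[OF f] fourier_L2[OF f] fourier_tendsto[OF f]])
  have "((\<lambda>R. L2_norm (trunc R f)) \<longlongrightarrow> L2_norm f) at_top"
    by (rule L2_norm_tendsto[OF trunc_L2[OF f] f trunc_tendsto[OF f]])
  then show "((\<lambda>R. L2_norm (fourier_L1 (trunc R f))) \<longlongrightarrow> fourier_const TYPE('n) * L2_norm f) at_top"
    unfolding Plancherel_L1[OF trunc_integrable[OF f] trunc_L2[OF f]] by (intro tendsto_intros)
qed simp

lemma fourier_lincomb:
  fixes f g :: "('n::finite) cfun"
  assumes f: "f \<in> L2" and g: "g \<in> L2"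
  shows "AE \<xi> in lborel. fourier (\<lambda>x. a * f x + b * g x) \<xi> = a * fourier f \<xi> + b * fourier g \<xi>"
proof (rule fourier_unique)
  show "(\<lambda>x. a * f x + b * g x) \<in> L2" by (intro L2_add L2_cmult f g)
  have F: "(\<lambda>\<xi>. a * fourier f \<xi> + b * fourier g \<xi>) \<in> L2"
    by (intro L2_add L2_cmult fourier_L2 f g)
  have eq: "fourier_L1 (trunc R (\<lambda>x. a * f x + b * g x)) \<xi> = a * fourier_L1 (trunc R f) \<xi> + b * fourier_L1 (trunc R g) \<xi>" for R \<xi>
  proof -
    have "trunc R (\<lambda>x. a * f x + b * g x) = (\<lambda>x. a * trunc R f x + b * trunc R g x)"
      by (auto simp: trunc_def algebra_simps)
    then show ?thesis
      using fourier_L1_add[of "\<lambda>x. a * trunc R f x" "\<lambda>x. b * trunc R g x" \<xi>] trunc_integrable[OF f, of R] trunc_integrable[OF g, of R]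
      by (simp add: fourier_L1_cmult)
  qed
  have "((\<lambda>R. L2_norm (\<lambda>\<xi>. fourier_L1 (trunc R (\<lambda>x. a * f x + b * g x)) \<xi> - (a * fourier f \<xi> + b * fourier g \<xi>))) \<longlongrightarrow> 0) at_top"
  proof (rule Lim_null_comparison)
    let ?d = "\<lambda>R f \<xi>. fourier_L1 (trunc R f) \<xi> - fourier f \<xi>"
    show "\<forall>\<^sub>F R in at_top. norm (L2_norm (\<lambda>\<xi>. fourier_L1 (trunc R (\<lambda>x. a * f x + b * g x)) \<xi> - (a * fourier f \<xi> + b * fourier g \<xi>)))
      \<le> norm a * L2_norm (?d R f) + norm b * L2_norm (?d R g)"
    proof (intro always_eventually allI)
      fix R
      have "L2_norm (\<lambda>\<xi>. a * ?d R f \<xi> + b * ?d R g \<xi>) \<le> norm a * L2_norm (?d R f) + norm b * L2_norm (?d R g)"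
        unfolding L2_norm_cmult[symmetric]
        by (intro L2_norm_triangle L2_cmult L2_diff fourier_trunc_L2 fourier_L2 f g)
      moreover have "(\<lambda>\<xi>. fourier_L1 (trunc R (\<lambda>x. a * f x + b * g x)) \<xi> - (a * fourier f \<xi> + b * fourier g \<xi>)) = (\<lambda>\<xi>. a * ?d R f \<xi> + b * ?d R g \<xi>)"
        unfolding eq by (auto simp: algebra_simps)
      ultimately show "norm (L2_norm (\<lambda>\<xi>. fourier_L1 (trunc R (\<lambda>x. a * f x + b * g x)) \<xi> - (a * fourier f \<xi> + b * fourier g \<xi>)))
        \<le> norm a * L2_norm (?d R f) + norm b * L2_norm (?d R g)" by simp
    qed
    show "((\<lambda>R. norm a * L2_norm (?d R f) + norm b * L2_norm (?d R g)) \<longlongrightarrow> 0) at_top"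
      by (intro tendsto_add_zero tendsto_mult_right_zero fourier_tendsto f g)
  qed
  with F show "is_fourier (\<lambda>x. a * f x + b * g x) (\<lambda>\<xi>. a * fourier f \<xi> + b * fourier g \<xi>)"
    by (simp add: is_fourier_def)
qed

text \<open>The difference of a truncation and \<open>f\<close> is again in both L^1 and L^2, so
  \<open>Plancherel_L1\<close> converts its convergence in L^2 into convergence of the transforms.
  This is what makes pointwise bounds by L^1 norms available for \<open>fourier\<close>.\<close>

lemma fourier_eq_fourier_L1:
  fixes f :: "('n::finite) cfun"
  assumes f: "integrable lborel f" and f2: "f \<in> L2"
  shows "AE \<xi> in lborel. fourier f \<xi> = fourier_L1 f \<xi>"
proof (rule fourier_unique[OF f2])
  have "L2_norm (\<lambda>\<xi>. fourier_L1 (trunc R f) \<xi> - fourier_L1 f \<xi>) = fourier_const TYPE('n) * L2_norm (\<lambda>x. trunc R f x - f x)" for R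
  proof -
    have "(\<lambda>\<xi>. fourier_L1 (trunc R f) \<xi> - fourier_L1 f \<xi>) = fourier_L1 (\<lambda>x. trunc R f x - f x)"
      by (rule ext) (rule fourier_L1_diff[symmetric, OF trunc_integrable[OF f2] f])
    then show ?thesis
      by (simp add: Plancherel_L1[OF Bochner_Integration.integrable_diff[OF trunc_integrable[OF f2] f] L2_diff[OF trunc_L2[OF f2] f2]])
  qed
  then show "is_fourier f (fourier_L1 f)"
    unfolding is_fourier_def using fourier_L1_L2[OF f f2]
    by (simp add: tendsto_mult_right_zero[OF trunc_tendsto[OF f2]])
qed

text \<open>Equality of functions and not only almost everywhere: the truncated transforms are
  integrals and coincide at every point, so the two predicates under \<open>SOME\<close> are the
  same and so is the choice.\<close>

lemma fourier_cong_AE: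
  assumes f: "f \<in> L2" and g: "g \<in> L2" and eq: "AE x in lborel. f x = g x"
  shows "fourier f = fourier g"
proof -
  have "fourier_L1 (trunc R f) = fourier_L1 (trunc R g)" for R
    unfolding fourier_L1_def
  proof (intro ext integral_cong_AE)
    have [measurable]: "trunc R f \<in> borel_measurable borel" "trunc R g \<in> borel_measurable borel"
      using f g by (auto intro: L2_measurable trunc_L2)
    show "(\<lambda>x. exp (- \<i> * complex_of_real (x \<bullet> \<xi>)) * trunc R f x) \<in> borel_measurable lborel"
      "(\<lambda>x. exp (- \<i> * complex_of_real (x \<bullet> \<xi>)) * trunc R g x) \<in> borel_measurable lborel" for \<xi>
      by measurable
    show "AE x in lborel. exp (- \<i> * complex_of_real (x \<bullet> \<xi>)) * trunc R f x = exp (- \<i> * complex_of_real (x \<bullet> \<xi>)) * trunc R g x" for \<xi>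
      using eq by eventually_elim (simp add: trunc_def)
  qed
  then have "is_fourier f = is_fourier g" by (auto simp: is_fourier_def fun_eq_iff)
  then show ?thesis using f g by (simp add: fourier_eq_SOME)
qed

section \<open>Differentiable curves of square integrable functions\<close>

lemma
  fixes f g :: "('n::finite) cfun" and \<psi> :: "real^'n \<Rightarrow> real"
  assumes \<psi>: "\<psi> \<in> borel_measurable borel" "\<And>x. \<bar>\<psi> x\<bar> \<le> K" and f: "f \<in> L2" and g: "g \<in> L2"
  shows integrable_weighted_inner: "integrable lborel (\<lambda>x. \<psi> x * (f x \<bullet> g x))" (is ?A)
    and weighted_inner_bound: "\<bar>LINT x|lborel. \<psi> x * (f x \<bullet> g x)\<bar> \<le> K * L2_norm f * L2_norm g" (is ?B)
proof -
  have eq: "\<psi> x * (f x \<bullet> g x) = (complex_of_real (\<psi> x) * f x) \<bullet> g x" for x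
    by (simp add: scaleR_conv_of_real[symmetric])
  have "(\<lambda>x. complex_of_real (\<psi> x)) \<in> borel_measurable borel" using \<psi>(1) by measurable
  note b = L2_bounded_mult[OF f this, of K]
  have m: "(\<lambda>x. complex_of_real (\<psi> x) * f x) \<in> L2" by (rule b(1)) (simp add: \<psi>(2))
  show ?A unfolding eq by (rule L2_integrable_inner[OF m g])
  have "\<bar>LINT x|lborel. (complex_of_real (\<psi> x) * f x) \<bullet> g x\<bar> \<le> L2_norm (\<lambda>x. complex_of_real (\<psi> x) * f x) * L2_norm g"
    by (rule L2_Cauchy_Schwarz[OF m g])
  also have "\<dots> \<le> (K * L2_norm f) * L2_norm g"
    by (intro mult_right_mono b(2)) (simp_all add: \<psi>(2))
  finally show ?B unfolding eq .
qed

text \<open>A second order Taylor estimate uniform in \<open>c\<close>. The frequency will enter the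
  weight only through \<open>c\<close>, so the difference quotient of the weight converges uniformly
  in frequency.\<close>

lemma exp_diff_quotient_bound:
  fixes c t s T :: real
  assumes c: "0 \<le> c" "c \<le> 1" and t: "t \<le> T" "s \<le> T" "s \<noteq> t"
  shows "\<bar>(exp (- c * (T - s)) - exp (- c * (T - t))) / (s - t) - c * exp (- c * (T - t))\<bar> \<le> \<bar>s - t\<bar>"
proof -
  let ?ms = "exp (- c * (T - s))" and ?mt = "exp (- c * (T - t))"
  define h where "h = c * (s - t)"
  have le1: "?ms \<le> 1" "?mt \<le> 1" using c t by (auto intro!: mult_nonneg_nonneg)
  have ms: "?ms = ?mt * exp h" by (simp add: h_def exp_add[symmetric] algebra_simps)
  \<comment> \<open>The sign of \<open>h\<close> tells which of the two exponentials is the larger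
    one. That one is at most \<open>1\<close> and is factored out; what remains is a function of
    \<open>h\<close> alone, controlled by \<open>1 - h \<le> exp (- h)\<close> and
    \<open>1 + h \<le> exp h\<close>.\<close>
  have "\<bar>?ms - ?mt - ?mt * h\<bar> \<le> h\<^sup>2"
  proof (cases "h \<le> 0")
    case True
    have "exp h * (1 - h) \<le> exp h * exp (- h)"
      using exp_ge_add_one_self[of "-h"] by (intro mult_left_mono) auto
    then have "exp h * (1 - h) \<le> 1" by (simp add: exp_add[symmetric])
    then have "(exp h - 1 - h) * (1 - h) \<le> h\<^sup>2" by (simp add: power2_eq_square algebra_simps)
    moreover have "0 \<le> exp h - 1 - h" using exp_ge_add_one_self[of h] by linarith
    moreover from this have "(exp h - 1 - h) * 1 \<le> (exp h - 1 - h) * (1 - h)"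
      using True by (intro mult_left_mono) auto
    ultimately have a: "\<bar>exp h - 1 - h\<bar> \<le> h\<^sup>2" by simp
    have eq: "\<bar>?ms - ?mt - ?mt * h\<bar> = ?mt * \<bar>exp h - 1 - h\<bar>"
    proof -
      have "?ms - ?mt - ?mt * h = ?mt * (exp h - 1 - h)" unfolding ms by (simp only: right_diff_distrib mult_1_right)
      then show ?thesis by (simp only: abs_mult abs_exp_cancel)
    qed
    have "?mt * \<bar>exp h - 1 - h\<bar> \<le> 1 * \<bar>exp h - 1 - h\<bar>" by (intro mult_right_mono le1) simp
    with a show ?thesis unfolding eq by simp
  next
    case False
    have mt: "?mt = ?ms * exp (- h)" unfolding ms by (simp add: exp_minus)
    have "(1 + h) * (1 - h) \<le> (1 + h) * exp (- h)"
      using exp_ge_add_one_self[of "-h"] False by (intro mult_left_mono) auto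
    then have "1 - (1 + h) * exp (- h) \<le> h\<^sup>2" by (simp add: power2_eq_square algebra_simps)
    moreover have "(1 + h) * exp (- h) \<le> exp h * exp (- h)"
      using exp_ge_add_one_self[of h] by (intro mult_right_mono) auto
    then have "0 \<le> 1 - (1 + h) * exp (- h)" by (simp add: exp_add[symmetric])
    ultimately have a: "\<bar>1 - (1 + h) * exp (- h)\<bar> \<le> h\<^sup>2" by simp
    have "?ms - ?mt - ?mt * h = ?ms * (1 - (1 + h) * exp (- h))"
      unfolding mt by (simp only: algebra_simps)
    then have eq: "\<bar>?ms - ?mt - ?mt * h\<bar> = ?ms * \<bar>1 - (1 + h) * exp (- h)\<bar>"
      by (simp only: abs_mult abs_exp_cancel)
    have "?ms * \<bar>1 - (1 + h) * exp (- h)\<bar> \<le> 1 * \<bar>1 - (1 + h) * exp (- h)\<bar>"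
      by (intro mult_right_mono le1) simp
    with a show ?thesis unfolding eq by simp
  qed
  also have "h\<^sup>2 = c\<^sup>2 * (s - t)\<^sup>2" by (simp add: h_def power_mult_distrib)
  also have "\<dots> \<le> 1 * (s - t)\<^sup>2" using c by (intro mult_right_mono) (auto simp: power_le_one)
  also have "1 * (s - t)\<^sup>2 = \<bar>s - t\<bar> * \<bar>s - t\<bar>" by (simp add: power2_eq_square)
  finally have *: "\<bar>?ms - ?mt - ?mt * h\<bar> \<le> \<bar>s - t\<bar> * \<bar>s - t\<bar>" .
  have "(?ms - ?mt) / (s - t) - c * ?mt = (?ms - ?mt - ?mt * h) / (s - t)"
    using t by (simp add: h_def field_simps)
  then have "\<bar>(?ms - ?mt) / (s - t) - c * ?mt\<bar> = \<bar>?ms - ?mt - ?mt * h\<bar> / \<bar>s - t\<bar>"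
    by (simp add: abs_divide)
  also have "\<dots> \<le> \<bar>s - t\<bar> * \<bar>s - t\<bar> / \<bar>s - t\<bar>" by (intro divide_right_mono *) simp
  also have "\<dots> = \<bar>s - t\<bar>" by (rule nonzero_mult_div_cancel_left) (use t in simp)
  finally show ?thesis .
qed

text \<open>A derivative at one time and relative to a set, because solutions are differentiable on
  the half line whereas the weighted energy is studied on \<open>{0..T}\<close>.\<close>

definition L2_deriv_at :: "(real \<Rightarrow> ('n::finite) cfun) \<Rightarrow> 'n cfun \<Rightarrow> real \<Rightarrow> real set \<Rightarrow> bool" where
  "L2_deriv_at X X' t S \<longleftrightarrow> X' \<in> L2 \<and>
     ((\<lambda>s. L2_norm (\<lambda>\<xi>. (X s \<xi> - X t \<xi>) / complex_of_real (s - t) - X' \<xi>)) \<longlongrightarrow> 0) (at t within S)"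

lemma L2_deriv_at_subset: "L2_deriv_at X X' t S \<Longrightarrow> R \<subseteq> S \<Longrightarrow> L2_deriv_at X X' t R"
  unfolding L2_deriv_at_def by (blast intro: tendsto_within_subset)

lemma L2_divide: "f \<in> L2 \<Longrightarrow> (\<lambda>x. f x / c) \<in> L2"
  using L2_cmult[of f "inverse c"] by (simp add: field_simps)

lemma L2_deriv_at_continuous:
  fixes X :: "real \<Rightarrow> ('n::finite) cfun"
  assumes d: "L2_deriv_at X X' t S" and X: "\<And>s. s \<in> S \<Longrightarrow> X s \<in> L2" and t: "t \<in> S"
  shows "((\<lambda>s. L2_norm (\<lambda>\<xi>. X s \<xi> - X t \<xi>)) \<longlongrightarrow> 0) (at t within S)"
proof (rule Lim_null_comparison)
  let ?q = "\<lambda>s \<xi>. (X s \<xi> - X t \<xi>) / complex_of_real (s - t)"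
  have X': "X' \<in> L2" and lim: "((\<lambda>s. L2_norm (\<lambda>\<xi>. ?q s \<xi> - X' \<xi>)) \<longlongrightarrow> 0) (at t within S)"
    using d by (auto simp: L2_deriv_at_def)
  show "\<forall>\<^sub>F s in at t within S. norm (L2_norm (\<lambda>\<xi>. X s \<xi> - X t \<xi>)) \<le> \<bar>s - t\<bar> * (L2_norm (\<lambda>\<xi>. ?q s \<xi> - X' \<xi>) + L2_norm X')"
    unfolding eventually_at_filter
  proof (intro always_eventually allI impI)
    fix s assume s: "s \<noteq> t" "s \<in> S"
    have q: "?q s \<in> L2" by (intro L2_divide L2_diff X s t)
    have "(\<lambda>\<xi>. X s \<xi> - X t \<xi>) = (\<lambda>\<xi>. complex_of_real (s - t) * ?q s \<xi>)" using s(1) by auto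
    then have "L2_norm (\<lambda>\<xi>. X s \<xi> - X t \<xi>) = \<bar>s - t\<bar> * L2_norm (?q s)"
      by (simp only: L2_norm_cmult norm_of_real)
    also have "L2_norm (?q s) \<le> L2_norm (\<lambda>\<xi>. ?q s \<xi> - X' \<xi>) + L2_norm X'"
      using L2_norm_triangle[OF L2_diff[OF q X'] X'] by simp
    then have "\<bar>s - t\<bar> * L2_norm (?q s) \<le> \<bar>s - t\<bar> * (L2_norm (\<lambda>\<xi>. ?q s \<xi> - X' \<xi>) + L2_norm X')"
      by (rule mult_left_mono) simp
    finally show "norm (L2_norm (\<lambda>\<xi>. X s \<xi> - X t \<xi>)) \<le> \<bar>s - t\<bar> * (L2_norm (\<lambda>\<xi>. ?q s \<xi> - X' \<xi>) + L2_norm X')"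
      by simp
  qed
  have "((\<lambda>s. \<bar>s - t\<bar> * (L2_norm (\<lambda>\<xi>. ?q s \<xi> - X' \<xi>) + L2_norm X')) \<longlongrightarrow> \<bar>t - t\<bar> * (0 + L2_norm X')) (at t within S)"
    by (intro tendsto_intros lim)
  then show "((\<lambda>s. \<bar>s - t\<bar> * (L2_norm (\<lambda>\<xi>. ?q s \<xi> - X' \<xi>) + L2_norm X')) \<longlongrightarrow> 0) (at t within S)" by simp
qed

lemma L2_norm_tendsto_within:
  fixes X :: "real \<Rightarrow> ('n::finite) cfun"
  assumes X: "\<And>s. s \<in> S \<Longrightarrow> X s \<in> L2" and t: "t \<in> S"
    and lim: "((\<lambda>s. L2_norm (\<lambda>\<xi>. X s \<xi> - X t \<xi>)) \<longlongrightarrow> 0) (at t within S)"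
  shows "((\<lambda>s. L2_norm (X s)) \<longlongrightarrow> L2_norm (X t)) (at t within S)"
proof -
  \<comment> \<open>The curve is in \<open>L2\<close> only for times in \<open>S\<close>; freezing
    it elsewhere gives a family lying entirely in \<open>L2\<close> without affecting the
    limit.\<close>
  define X2 where "X2 s = (if s \<in> S then X s else X t)" for s
  have ev: "\<forall>\<^sub>F s in at t within S. X2 s = X s"
    unfolding eventually_at_filter X2_def by (rule always_eventually) simp
  have "((\<lambda>s. L2_norm (X2 s)) \<longlongrightarrow> L2_norm (X t)) (at t within S)"
  proof (rule L2_norm_tendsto)
    show "X2 s \<in> L2" for s using X t by (simp add: X2_def)
    show "X t \<in> L2" using X t by simp
    show "((\<lambda>s. L2_norm (\<lambda>x. X2 s x - X t x)) \<longlongrightarrow> 0) (at t within S)"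
      by (rule Lim_transform_eventually[OF lim]) (use ev in eventually_elim, simp)
  qed
  then show ?thesis
    by (rule Lim_transform_eventually) (use ev in eventually_elim, simp)
qed

text \<open>The product rule for three factors with its remainder spelled out: each of the six terms
  on the right has one factor that vanishes in the limit, namely an increment or the error of a
  difference quotient.\<close>

lemma weighted_quotient_identity:
  fixes x y x0 y0 x' y' :: complex and r ms mt c :: real
  shows "(ms * (x \<bullet> y) - mt * (x0 \<bullet> y0)) / r - mt * (c * (x0 \<bullet> y0) + x' \<bullet> y0 + x0 \<bullet> y')
    = ((ms - mt) / r - c * mt) * (x \<bullet> y) + c * mt * ((x - x0) \<bullet> y) + c * mt * (x0 \<bullet> (y - y0))
      + mt * (((x - x0) / complex_of_real r - x') \<bullet> y) + mt * (x' \<bullet> (y - y0)) + mt * (x0 \<bullet> ((y - y0) / complex_of_real r - y'))"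
proof -
  have d: "z / complex_of_real r = z /\<^sub>R r" for z by (simp add: scaleR_conv_of_real divide_inverse mult.commute)
  show ?thesis unfolding d
    by (simp only: inner_diff_left inner_diff_right inner_scaleR_left inner_scaleR_right divide_inverse) algebra
qed

text \<open>Integrability and bound are kept together so that six terms can be added by composing
  the rule with itself.\<close>

lemma abs_integral_add_le:
  fixes f g :: "'a \<Rightarrow> real"
  assumes "integrable M f \<and> \<bar>integral\<^sup>L M f\<bar> \<le> a" "integrable M g \<and> \<bar>integral\<^sup>L M g\<bar> \<le> b"
  shows "integrable M (\<lambda>x. f x + g x) \<and> \<bar>LINT x|M. f x + g x\<bar> \<le> a + b"
  using assms by auto

text \<open>Differentiability is assumed only in L^2, not pointwise in \<xi>. Each remainder term of
  \<open>weighted_quotient_identity\<close> is estimated by Cauchy-Schwarz, with a coefficient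
  bounded uniformly in \<xi>: \<phi> and \<open>c\<close> by assumption, and the weight because
  times do not exceed \<open>T\<close>.\<close>

lemma has_derivative_weighted_inner:
  fixes X Y :: "real \<Rightarrow> ('n::finite) cfun" and \<phi> c :: "real^'n \<Rightarrow> real"
  assumes X: "\<And>s. s \<in> {0..T} \<Longrightarrow> X s \<in> L2" and Y: "\<And>s. s \<in> {0..T} \<Longrightarrow> Y s \<in> L2"
    and dX: "L2_deriv_at X X' t {0..T}" and dY: "L2_deriv_at Y Y' t {0..T}"
    and \<phi> [measurable]: "\<phi> \<in> borel_measurable borel" and \<phi>K: "\<And>\<xi>. \<bar>\<phi> \<xi>\<bar> \<le> K"
    and c [measurable]: "c \<in> borel_measurable borel" and c01: "\<And>\<xi>. 0 \<le> c \<xi>" "\<And>\<xi>. c \<xi> \<le> 1"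
    and t: "t \<in> {0..T}"
  shows "((\<lambda>s. LINT \<xi>|lborel. (\<phi> \<xi> * exp (- c \<xi> * (T - s))) * (X s \<xi> \<bullet> Y s \<xi>)) has_real_derivative
    (LINT \<xi>|lborel. (\<phi> \<xi> * exp (- c \<xi> * (T - t))) * (c \<xi> * (X t \<xi> \<bullet> Y t \<xi>) + X' \<xi> \<bullet> Y t \<xi> + X t \<xi> \<bullet> Y' \<xi>))) (at t within {0..T})"
proof -
  let ?S = "{0..T}"
  define m where "m s \<xi> = exp (- c \<xi> * (T - s))" for s \<xi>
  have mm [measurable]: "m s \<in> borel_measurable borel" for s unfolding m_def[abs_def] by measurable
  have m01: "0 \<le> m s \<xi>" "s \<in> ?S \<Longrightarrow> m s \<xi> \<le> 1" for s \<xi>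
    using c01 by (auto simp: m_def)
  have K: "0 \<le> K" using \<phi>K[of undefined] by linarith
  define F where "F s = (LINT \<xi>|lborel. (\<phi> \<xi> * m s \<xi>) * (X s \<xi> \<bullet> Y s \<xi>))" for s
  define D where "D = (LINT \<xi>|lborel. (\<phi> \<xi> * m t \<xi>) * (c \<xi> * (X t \<xi> \<bullet> Y t \<xi>) + X' \<xi> \<bullet> Y t \<xi> + X t \<xi> \<bullet> Y' \<xi>))"
  have X': "X' \<in> L2" and Y': "Y' \<in> L2" using dX dY by (auto simp: L2_deriv_at_def)
  note Xt = X[OF t] and Yt = Y[OF t]
  let ?dx = "\<lambda>s \<xi>. X s \<xi> - X t \<xi>" and ?dy = "\<lambda>s \<xi>. Y s \<xi> - Y t \<xi>"
  let ?qx = "\<lambda>s \<xi>. (X s \<xi> - X t \<xi>) / complex_of_real (s - t) - X' \<xi>" and ?qy = "\<lambda>s \<xi>. (Y s \<xi> - Y t \<xi>) / complex_of_real (s - t) - Y' \<xi>"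
  let ?B = "\<lambda>s. (K * \<bar>s - t\<bar>) * L2_norm (X s) * L2_norm (Y s) + K * L2_norm (?dx s) * L2_norm (Y s) + K * L2_norm (X t) * L2_norm (?dy s)
     + K * L2_norm (?qx s) * L2_norm (Y s) + K * L2_norm X' * L2_norm (?dy s) + K * L2_norm (X t) * L2_norm (?qy s)"
  have bd: "\<bar>\<phi> \<xi> * p\<bar> \<le> K * r" if "\<bar>p\<bar> \<le> r" for \<xi> p r
    unfolding abs_mult by (intro mult_mono \<phi>K that K) simp
  have main: "\<bar>(F s - F t) / (s - t) - D\<bar> \<le> ?B s" if s: "s \<noteq> t" "s \<in> ?S" for s
  proof -
    note Xs = X[OF s(2)] and Ys = Y[OF s(2)]
    have dx: "?dx s \<in> L2" and dy: "?dy s \<in> L2" by (intro L2_diff Xs Xt Ys Yt)+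
    have qx: "?qx s \<in> L2" and qy: "?qy s \<in> L2" by (intro L2_diff L2_divide Xs Xt Ys Yt X' Y')+
    have b0: "\<bar>\<phi> \<xi> * m s \<xi>\<bar> \<le> K" if "s \<in> ?S" for s \<xi> using bd[of "m s \<xi>" 1 \<xi>] m01[of s \<xi>] that by simp
    have bc: "\<bar>\<phi> \<xi> * (c \<xi> * m t \<xi>)\<bar> \<le> K" for \<xi>
      using bd[of "c \<xi> * m t \<xi>" 1 \<xi>] mult_mono[OF c01(2)[of \<xi>] m01(2)[OF t, of \<xi>]] m01[of t \<xi>] c01[of \<xi>] by (simp add: abs_mult)
    have bq: "\<bar>\<phi> \<xi> * ((m s \<xi> - m t \<xi>) / (s - t) - c \<xi> * m t \<xi>)\<bar> \<le> K * \<bar>s - t\<bar>" for \<xi>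
      unfolding m_def using t s by (intro bd exp_diff_quotient_bound c01) auto
    have m1: "(\<lambda>\<xi>. \<phi> \<xi> * m s \<xi>) \<in> borel_measurable borel" for s by measurable
    have m2: "(\<lambda>\<xi>. \<phi> \<xi> * (c \<xi> * m t \<xi>)) \<in> borel_measurable borel" by measurable
    have m3: "(\<lambda>\<xi>. \<phi> \<xi> * ((m s \<xi> - m t \<xi>) / (s - t) - c \<xi> * m t \<xi>)) \<in> borel_measurable borel" by measurable
    note iw = integrable_weighted_inner and wb = weighted_inner_bound
    have iD: "integrable lborel (\<lambda>\<xi>. (\<phi> \<xi> * m t \<xi>) * (c \<xi> * (X t \<xi> \<bullet> Y t \<xi>) + X' \<xi> \<bullet> Y t \<xi> + X t \<xi> \<bullet> Y' \<xi>))"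
    proof -
      have "integrable lborel (\<lambda>\<xi>. \<phi> \<xi> * (c \<xi> * m t \<xi>) * (X t \<xi> \<bullet> Y t \<xi>) + \<phi> \<xi> * m t \<xi> * (X' \<xi> \<bullet> Y t \<xi>) + \<phi> \<xi> * m t \<xi> * (X t \<xi> \<bullet> Y' \<xi>))"
        by (intro Bochner_Integration.integrable_add iw[OF m1 b0[OF t]] iw[OF m2 bc] Xt Yt X' Y')
      then show ?thesis by (simp only: distrib_left mult_ac)
    qed
    have "(F s - F t) / (s - t) - D = (LINT \<xi>|lborel. ((\<phi> \<xi> * m s \<xi>) * (X s \<xi> \<bullet> Y s \<xi>) - (\<phi> \<xi> * m t \<xi>) * (X t \<xi> \<bullet> Y t \<xi>)) / (s - t)
        - (\<phi> \<xi> * m t \<xi>) * (c \<xi> * (X t \<xi> \<bullet> Y t \<xi>) + X' \<xi> \<bullet> Y t \<xi> + X t \<xi> \<bullet> Y' \<xi>))"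
    proof -
      note iA = iw[OF m1 b0[OF s(2)] Xs Ys] and iB = iw[OF m1 b0[OF t] Xt Yt]
      have "(F s - F t) / (s - t) = (LINT \<xi>|lborel. ((\<phi> \<xi> * m s \<xi>) * (X s \<xi> \<bullet> Y s \<xi>) - (\<phi> \<xi> * m t \<xi>) * (X t \<xi> \<bullet> Y t \<xi>)) / (s - t))"
        unfolding F_def Bochner_Integration.integral_diff[OF iA iB, symmetric] by (rule integral_divide_zero[symmetric])
      then show ?thesis unfolding D_def
        by (simp only: Bochner_Integration.integral_diff[OF integrable_divide[OF Bochner_Integration.integrable_diff[OF iA iB]] iD])
    qed
    also have "\<dots> = (LINT \<xi>|lborel.
        (\<phi> \<xi> * ((m s \<xi> - m t \<xi>) / (s - t) - c \<xi> * m t \<xi>)) * (X s \<xi> \<bullet> Y s \<xi>)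
        + (\<phi> \<xi> * (c \<xi> * m t \<xi>)) * (?dx s \<xi> \<bullet> Y s \<xi>) + (\<phi> \<xi> * (c \<xi> * m t \<xi>)) * (X t \<xi> \<bullet> ?dy s \<xi>)
        + (\<phi> \<xi> * m t \<xi>) * (?qx s \<xi> \<bullet> Y s \<xi>) + (\<phi> \<xi> * m t \<xi>) * (X' \<xi> \<bullet> ?dy s \<xi>) + (\<phi> \<xi> * m t \<xi>) * (X t \<xi> \<bullet> ?qy s \<xi>))"
    proof (rule Bochner_Integration.integral_cong[OF refl])
      fix \<xi>
      note id = weighted_quotient_identity[of "m s \<xi>" "X s \<xi>" "Y s \<xi>" "m t \<xi>" "X t \<xi>" "Y t \<xi>" "s - t" "c \<xi>" "X' \<xi>" "Y' \<xi>"]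
      have "((\<phi> \<xi> * m s \<xi>) * (X s \<xi> \<bullet> Y s \<xi>) - (\<phi> \<xi> * m t \<xi>) * (X t \<xi> \<bullet> Y t \<xi>)) / (s - t)
        - (\<phi> \<xi> * m t \<xi>) * (c \<xi> * (X t \<xi> \<bullet> Y t \<xi>) + X' \<xi> \<bullet> Y t \<xi> + X t \<xi> \<bullet> Y' \<xi>)
        = \<phi> \<xi> * ((m s \<xi> * (X s \<xi> \<bullet> Y s \<xi>) - m t \<xi> * (X t \<xi> \<bullet> Y t \<xi>)) / (s - t)
        - m t \<xi> * (c \<xi> * (X t \<xi> \<bullet> Y t \<xi>) + X' \<xi> \<bullet> Y t \<xi> + X t \<xi> \<bullet> Y' \<xi>))"
        by (simp only: right_diff_distrib mult.assoc times_divide_eq_right)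
      also note id
      finally show "((\<phi> \<xi> * m s \<xi>) * (X s \<xi> \<bullet> Y s \<xi>) - (\<phi> \<xi> * m t \<xi>) * (X t \<xi> \<bullet> Y t \<xi>)) / (s - t)
        - (\<phi> \<xi> * m t \<xi>) * (c \<xi> * (X t \<xi> \<bullet> Y t \<xi>) + X' \<xi> \<bullet> Y t \<xi> + X t \<xi> \<bullet> Y' \<xi>)
        = (\<phi> \<xi> * ((m s \<xi> - m t \<xi>) / (s - t) - c \<xi> * m t \<xi>)) * (X s \<xi> \<bullet> Y s \<xi>)
        + (\<phi> \<xi> * (c \<xi> * m t \<xi>)) * (?dx s \<xi> \<bullet> Y s \<xi>) + (\<phi> \<xi> * (c \<xi> * m t \<xi>)) * (X t \<xi> \<bullet> ?dy s \<xi>)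
        + (\<phi> \<xi> * m t \<xi>) * (?qx s \<xi> \<bullet> Y s \<xi>) + (\<phi> \<xi> * m t \<xi>) * (X' \<xi> \<bullet> ?dy s \<xi>) + (\<phi> \<xi> * m t \<xi>) * (X t \<xi> \<bullet> ?qy s \<xi>)"
        by (simp only: distrib_left mult.assoc)
    qed
    finally have eq: "(F s - F t) / (s - t) - D = \<dots>" .
      note I = conjI[OF iw wb]
      note I1 = I[OF m3 bq Xs Ys m3 bq Xs Ys] and I2 = I[OF m2 bc dx Ys m2 bc dx Ys] and I3 = I[OF m2 bc Xt dy m2 bc Xt dy]
        and I4 = I[OF m1 b0[OF t] qx Ys m1 b0[OF t] qx Ys] and I5 = I[OF m1 b0[OF t] X' dy m1 b0[OF t] X' dy]
        and I6 = I[OF m1 b0[OF t] Xt qy m1 b0[OF t] Xt qy]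
      show ?thesis unfolding eq
        by (rule abs_integral_add_le[OF abs_integral_add_le[OF abs_integral_add_le[OF abs_integral_add_le[OF abs_integral_add_le[OF I1 I2] I3] I4] I5] I6, THEN conjunct2])
  qed
  have lx: "((\<lambda>s. L2_norm (?dx s)) \<longlongrightarrow> 0) (at t within ?S)" and ly: "((\<lambda>s. L2_norm (?dy s)) \<longlongrightarrow> 0) (at t within ?S)"
    using L2_deriv_at_continuous[OF dX X t] L2_deriv_at_continuous[OF dY Y t] by auto
  note nx = L2_norm_tendsto_within[OF X t lx] and ny = L2_norm_tendsto_within[OF Y t ly]
  have lqx: "((\<lambda>s. L2_norm (?qx s)) \<longlongrightarrow> 0) (at t within ?S)" and lqy: "((\<lambda>s. L2_norm (?qy s)) \<longlongrightarrow> 0) (at t within ?S)"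
    using dX dY by (auto simp: L2_deriv_at_def)
  have lB: "(?B \<longlongrightarrow> (K * \<bar>t - t\<bar>) * L2_norm (X t) * L2_norm (Y t) + K * 0 * L2_norm (Y t) + K * L2_norm (X t) * 0
     + K * 0 * L2_norm (Y t) + K * L2_norm X' * 0 + K * L2_norm (X t) * 0) (at t within ?S)"
    by (intro tendsto_intros lx ly nx ny lqx lqy)
  have "((\<lambda>s. (F s - F t) / (s - t) - D) \<longlongrightarrow> 0) (at t within ?S)"
  proof (rule Lim_null_comparison)
    show "\<forall>\<^sub>F s in at t within ?S. norm ((F s - F t) / (s - t) - D) \<le> ?B s"
      unfolding eventually_at_filter real_norm_def by (intro always_eventually allI impI main)
    show "(?B \<longlongrightarrow> 0) (at t within ?S)" using lB by simp
  qed
  then have "((\<lambda>s. (F s - F t) / (s - t)) \<longlongrightarrow> D) (at t within ?S)" by (rule LIM_zero_cancel)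
  then have "(F has_real_derivative D) (at t within ?S)" by (simp add: has_field_derivative_iff)
  then show ?thesis unfolding F_def D_def m_def .
qed

section \<open>The energy estimate\<close>

definition symb :: "real^'n::finite \<Rightarrow> real" where
  "symb \<xi> = ln (1 + (norm \<xi>)\<^sup>2)"

lemma symb_nonneg [simp]: "0 \<le> symb \<xi>"
  by (simp add: symb_def)

lemma symb_measurable [measurable]: "symb \<in> borel_measurable borel"
  unfolding symb_def[abs_def] by measurable

definition damping :: "real \<Rightarrow> real" where
  "damping \<mu> = 1 / (1 + \<mu>)"

definition rate_denom :: "real \<Rightarrow> real" where
  "rate_denom \<mu> = \<mu> + (damping \<mu>)\<^sup>2"

text \<open>The denominator is the coefficient of |u|^2 in the quadratic upper bound of the energy.
  The factor \<open>2\<close> absorbs the \<open>2\<close> in front of |v|^2 there, as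
  \<open>decay_rate_le\<close> records.\<close>

definition decay_rate :: "real \<Rightarrow> real" where
  "decay_rate \<mu> = damping \<mu> * \<mu> / (2 * rate_denom \<mu>)"

text \<open>
  The constant \<open>6\<close> makes the energy dominate \<open>(norm u)\<^sup>2\<close>.  With this normalisation all three
  coefficients of the energy are bounded in \<open>\<mu>\<close>, so no cutoff at high frequencies is needed.
\<close>

definition energy_coeff :: "real \<Rightarrow> real" where
  "energy_coeff \<mu> = 6 / rate_denom \<mu>"

definition energy :: "real \<Rightarrow> complex \<Rightarrow> complex \<Rightarrow> real" where
  "energy \<mu> u v = energy_coeff \<mu> * (v \<bullet> v) + energy_coeff \<mu> * (\<mu> + (damping \<mu>)\<^sup>2 / 2) * (u \<bullet> u) + energy_coeff \<mu> * damping \<mu> * (v \<bullet> u)"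

context
  fixes \<mu> :: real
  assumes \<mu>: "0 \<le> \<mu>"
begin

lemma damping_bounds: "0 < damping \<mu>" "damping \<mu> \<le> 1" "(damping \<mu>)\<^sup>2 \<le> 1"
  using \<mu> by (auto simp: damping_def power_le_one)

text \<open>Below \<mu> = \<open>1\<close> the square of the damping is at least \<open>1/4\<close>,
  above it \<mu> alone suffices. Consequently \<open>energy_coeff\<close> is at most a multiple of
  \<open>damping\<close>, with constant \<open>6 * 4 = 24\<close>.\<close>

lemma rate_denom_bound: "1 + \<mu> \<le> 4 * rate_denom \<mu>"
proof (cases "\<mu> \<le> 1")
  case True
  then have "1 / 2 \<le> damping \<mu>" using \<mu> by (simp add: damping_def field_simps)
  then have "(1 / 2)\<^sup>2 \<le> (damping \<mu>)\<^sup>2" by (intro power_mono) auto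
  then have "1 \<le> 4 * (damping \<mu>)\<^sup>2" by (simp add: power2_eq_square)
  then show ?thesis using \<mu> by (simp add: rate_denom_def)
next
  case False
  then have "1 + \<mu> \<le> 4 * \<mu>" by simp
  also have "\<dots> \<le> 4 * rate_denom \<mu>" by (simp add: rate_denom_def)
  finally show ?thesis .
qed

lemma rate_denom_pos: "0 < rate_denom \<mu>"
  using rate_denom_bound \<mu> by linarith

lemma energy_coeff_pos: "0 < energy_coeff \<mu>"
  using rate_denom_pos by (simp add: energy_coeff_def)

lemma energy_coeff_le: "energy_coeff \<mu> \<le> 24 * damping \<mu>"
  using rate_denom_bound rate_denom_pos \<mu> by (simp add: energy_coeff_def damping_def field_simps)

lemma decay_rate_nonneg: "0 \<le> decay_rate \<mu>"
  using rate_denom_pos damping_bounds \<mu> by (simp add: decay_rate_def)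

lemma decay_rate_rate_denom: "2 * (decay_rate \<mu> * rate_denom \<mu>) = damping \<mu> * \<mu>"
  using rate_denom_pos by (simp add: decay_rate_def)

lemma decay_rate_le: "2 * decay_rate \<mu> \<le> damping \<mu>"
proof -
  have "\<mu> / rate_denom \<mu> \<le> 1"
    using rate_denom_pos zero_le_power2[of "damping \<mu>"] by (simp add: divide_le_eq rate_denom_def)
  then have "damping \<mu> * (\<mu> / rate_denom \<mu>) \<le> damping \<mu> * 1"
    using damping_bounds by (intro mult_left_mono) auto
  then show ?thesis by (simp add: decay_rate_def)
qed

lemma decay_rate_le_1: "decay_rate \<mu> \<le> 1"
  using decay_rate_le damping_bounds decay_rate_nonneg by linarith

lemma decay_rate_lower_small:
  assumes "\<mu> \<le> 1"
  shows "\<mu> / 8 \<le> decay_rate \<mu>"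
proof -
  have "1 / 2 \<le> damping \<mu>" using \<mu> assms by (simp add: damping_def field_simps)
  then have "1 / 2 * \<mu> \<le> damping \<mu> * \<mu>" by (intro mult_right_mono \<mu>)
  moreover have "2 * rate_denom \<mu> \<le> 4" using damping_bounds assms by (simp add: rate_denom_def)
  ultimately have "1 / 2 * \<mu> / 4 \<le> damping \<mu> * \<mu> / (2 * rate_denom \<mu>)"
    using rate_denom_pos \<mu> by (intro frac_le) auto
  then show ?thesis by (simp add: decay_rate_def)
qed

lemma decay_rate_lower_large:
  assumes "1 \<le> \<mu>"
  shows "damping \<mu> / 4 \<le> decay_rate \<mu>"
proof -
  have "2 * rate_denom \<mu> \<le> 4 * \<mu>" using damping_bounds assms by (simp add: rate_denom_def)
  then have "damping \<mu> * \<mu> / (4 * \<mu>) \<le> damping \<mu> * \<mu> / (2 * rate_denom \<mu>)"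
    using rate_denom_pos \<mu> damping_bounds by (intro frac_le) auto
  then show ?thesis using assms by (simp add: decay_rate_def)
qed

lemma energy_factor:
  "energy \<mu> u v = energy_coeff \<mu> * ((v \<bullet> v) + (\<mu> + (damping \<mu>)\<^sup>2 / 2) * (u \<bullet> u) + damping \<mu> * (v \<bullet> u))"
  by (simp add: energy_def algebra_simps)

lemma energy_coeff_rate_denom: "energy_coeff \<mu> * (\<mu> + (damping \<mu>)\<^sup>2) = 6"
  using rate_denom_pos unfolding rate_denom_def[symmetric] by (simp add: energy_coeff_def)

lemma energy_lower: "(norm u)\<^sup>2 \<le> energy \<mu> u v"
proof -
  define a where "a = damping \<mu>"
  \<comment> \<open>Three quarters of this square contain the cross term exactly and use up
    \<open>1/3\<close> of the available \<open>1/2\<close> in front of a^2 |u|^2. The remaining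
    \<open>1/6\<close> is the origin of the constant \<open>6\<close> in
    \<open>energy_coeff\<close>.\<close>
  have "0 \<le> (v + (2 * a / 3) *\<^sub>R u) \<bullet> (v + (2 * a / 3) *\<^sub>R u)" by (rule inner_ge_zero)
  also have "\<dots> = v \<bullet> v + 4 / 3 * (a * (v \<bullet> u)) + 4 / 9 * (a\<^sup>2 * (u \<bullet> u))"
    by (simp add: inner_add_left inner_add_right inner_commute power2_eq_square)
  finally have "1/6 * (\<mu> * (u \<bullet> u)) + 1/6 * (a\<^sup>2 * (u \<bullet> u)) \<le> v \<bullet> v + (\<mu> * (u \<bullet> u)) + 1/2 * (a\<^sup>2 * (u \<bullet> u)) + a * (v \<bullet> u)"
    using inner_ge_zero[of v] mult_nonneg_nonneg[OF \<mu> inner_ge_zero[of u]] by linarith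
  then have "1/6 * (\<mu> + a\<^sup>2) * (u \<bullet> u) \<le> v \<bullet> v + (\<mu> + a\<^sup>2 / 2) * (u \<bullet> u) + a * (v \<bullet> u)"
    by (simp add: algebra_simps)
  then have "energy_coeff \<mu> * (1/6 * (\<mu> + a\<^sup>2) * (u \<bullet> u)) \<le> energy \<mu> u v"
    unfolding energy_factor a_def using energy_coeff_pos by (intro mult_left_mono) auto
  also have "energy_coeff \<mu> * (1/6 * (\<mu> + a\<^sup>2) * (u \<bullet> u)) = (energy_coeff \<mu> * (\<mu> + a\<^sup>2)) / 6 * (u \<bullet> u)" by simp
  also have "\<dots> = (norm u)\<^sup>2" unfolding a_def energy_coeff_rate_denom by (simp add: power2_norm_eq_inner)
  finally show ?thesis .
qed

lemma energy_upper_quadratic: "energy \<mu> u v \<le> energy_coeff \<mu> * (2 * (v \<bullet> v) + (\<mu> + (damping \<mu>)\<^sup>2) * (u \<bullet> u))"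
proof -
  define a where "a = damping \<mu>"
  have "0 \<le> (v - (a / 2) *\<^sub>R u) \<bullet> (v - (a / 2) *\<^sub>R u)" by (rule inner_ge_zero)
  also have "\<dots> = v \<bullet> v - a * (v \<bullet> u) + 1 / 4 * (a\<^sup>2 * (u \<bullet> u))"
    by (simp add: inner_diff_left inner_diff_right inner_commute power2_eq_square)
  finally have "v \<bullet> v + \<mu> * (u \<bullet> u) + 1 / 2 * (a\<^sup>2 * (u \<bullet> u)) + a * (v \<bullet> u) \<le> 2 * (v \<bullet> v) + \<mu> * (u \<bullet> u) + a\<^sup>2 * (u \<bullet> u)"
    using mult_nonneg_nonneg[OF zero_le_power2[of a] inner_ge_zero[of u]] by linarith
  then have "v \<bullet> v + (\<mu> + a\<^sup>2 / 2) * (u \<bullet> u) + a * (v \<bullet> u) \<le> 2 * (v \<bullet> v) + (\<mu> + a\<^sup>2) * (u \<bullet> u)"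
    by (simp add: algebra_simps)
  then show ?thesis
    unfolding energy_factor a_def[symmetric] using energy_coeff_pos by (intro mult_left_mono) auto
qed

text \<open>The factor \<open>damping\<close> in front of the velocity is what the normalisation
  gains; it will pay for one power of \<open>1 + symb \<xi>\<close> in the norm of the initial
  velocity.\<close>

lemma energy_upper: "energy \<mu> u v \<le> 6 * (norm u)\<^sup>2 + 48 * damping \<mu> * (norm v)\<^sup>2"
proof -
  have "energy \<mu> u v \<le> energy_coeff \<mu> * (2 * (v \<bullet> v)) + (energy_coeff \<mu> * (\<mu> + (damping \<mu>)\<^sup>2)) * (u \<bullet> u)"
    using energy_upper_quadratic[of u v] by (simp add: algebra_simps)
  also have "\<dots> = energy_coeff \<mu> * (2 * (v \<bullet> v)) + 6 * (u \<bullet> u)" by (simp only: energy_coeff_rate_denom)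
  also have "\<dots> \<le> 24 * damping \<mu> * (2 * (v \<bullet> v)) + 6 * (u \<bullet> u)"
    by (intro add_right_mono mult_right_mono energy_coeff_le) simp
  finally show ?thesis by (simp add: power2_norm_eq_inner)
qed

text \<open>The left side is the time derivative of exp(c t) times the energy, divided by exp(c t),
  with \<open>v\<close> and \<open>w\<close> for the derivatives of \<open>u\<close> and
  \<open>v\<close>. Inserting the equation cancels the mixed terms and leaves c times the energy
  minus \<open>energy_coeff\<close> times a (|v|^2 + \<mu> |u|^2); the two inequalities that
  characterise c compare these.\<close>

lemma energy_dissipation:
  assumes w: "w = - complex_of_real \<mu> * u - complex_of_real (damping \<mu>) * v"
  shows "energy_coeff \<mu> * (decay_rate \<mu> * (v \<bullet> v) + w \<bullet> v + v \<bullet> w)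
    + energy_coeff \<mu> * (\<mu> + (damping \<mu>)\<^sup>2 / 2) * (decay_rate \<mu> * (u \<bullet> u) + v \<bullet> u + u \<bullet> v)
    + energy_coeff \<mu> * damping \<mu> * (decay_rate \<mu> * (v \<bullet> u) + w \<bullet> u + v \<bullet> v) \<le> 0"
    (is "?L \<le> 0")
proof -
  define a where "a = damping \<mu>"
  define c where "c = decay_rate \<mu>"
  define al where "al = energy_coeff \<mu>"
  have w': "w = - (\<mu> *\<^sub>R u) - a *\<^sub>R v" by (simp add: w a_def scaleR_conv_of_real)
  have eq: "?L = c * energy \<mu> u v - al * (a * (v \<bullet> v) + a * \<mu> * (u \<bullet> u))"
    unfolding energy_factor a_def[symmetric] c_def[symmetric] al_def[symmetric] w'
    by (simp add: inner_diff_left inner_diff_right inner_commute[of u v]) (simp add: power2_eq_square algebra_simps)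
  have "c * energy \<mu> u v \<le> c * (al * (2 * (v \<bullet> v) + (\<mu> + a\<^sup>2) * (u \<bullet> u)))"
    unfolding c_def al_def a_def by (intro mult_left_mono energy_upper_quadratic decay_rate_nonneg)
  also have "\<dots> = al * ((2 * c) * (v \<bullet> v) + (c * (\<mu> + a\<^sup>2)) * (u \<bullet> u))" by (simp add: algebra_simps)
  also have "\<dots> \<le> al * (a * (v \<bullet> v) + (a * \<mu>) * (u \<bullet> u))"
  proof (intro mult_left_mono add_mono mult_right_mono)
    show "2 * c \<le> a" unfolding c_def a_def by (rule decay_rate_le)
    have "2 * (c * (\<mu> + a\<^sup>2)) = a * \<mu>"
      using decay_rate_rate_denom by (simp only: c_def a_def rate_denom_def)
    moreover have "0 \<le> a * \<mu>" using \<mu> damping_bounds by (simp add: a_def)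
    ultimately show "c * (\<mu> + a\<^sup>2) \<le> a * \<mu>" by linarith
    show "0 \<le> al" using energy_coeff_pos by (simp add: al_def)
  qed auto
  finally show ?thesis unfolding eq by simp
qed

lemma energy_coeffs_bounded:
  "\<bar>energy_coeff \<mu>\<bar> \<le> 24" "\<bar>energy_coeff \<mu> * (\<mu> + (damping \<mu>)\<^sup>2 / 2)\<bar> \<le> 24" "\<bar>energy_coeff \<mu> * damping \<mu>\<bar> \<le> 24"
proof -
  have al: "energy_coeff \<mu> \<le> 24" using energy_coeff_le damping_bounds by linarith
  then show "\<bar>energy_coeff \<mu>\<bar> \<le> 24" using energy_coeff_pos by simp
  have "0 \<le> energy_coeff \<mu> * (\<mu> + (damping \<mu>)\<^sup>2 / 2)" using energy_coeff_pos \<mu> by simp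
  moreover have "energy_coeff \<mu> * (\<mu> + (damping \<mu>)\<^sup>2 / 2) \<le> energy_coeff \<mu> * (\<mu> + (damping \<mu>)\<^sup>2)"
    using energy_coeff_pos by (intro mult_left_mono) auto
  ultimately show "\<bar>energy_coeff \<mu> * (\<mu> + (damping \<mu>)\<^sup>2 / 2)\<bar> \<le> 24" using energy_coeff_rate_denom by linarith
  have "energy_coeff \<mu> * damping \<mu> \<le> 24 * 1"
    using al damping_bounds energy_coeff_pos by (intro mult_mono) auto
  moreover have "0 \<le> energy_coeff \<mu> * damping \<mu>"
    using damping_bounds energy_coeff_pos by (intro mult_nonneg_nonneg) auto
  ultimately show "\<bar>energy_coeff \<mu> * damping \<mu>\<bar> \<le> 24" by linarith
qed

end

section \<open>The energy integrated over all frequencies\<close>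

lemma damping_measurable [measurable]: "damping \<in> borel_measurable borel"
  unfolding damping_def[abs_def] by measurable

lemma rate_denom_measurable [measurable]: "rate_denom \<in> borel_measurable borel"
  unfolding rate_denom_def[abs_def] by measurable

lemma energy_coeff_measurable [measurable]: "energy_coeff \<in> borel_measurable borel"
  unfolding energy_coeff_def[abs_def] by measurable

lemma decay_rate_measurable [measurable]: "decay_rate \<in> borel_measurable borel"
  unfolding decay_rate_def[abs_def] by measurable

lemma integrable_weighted_initial:
  fixes u v :: "('n::finite) cfun"
  assumes u: "u \<in> L2" and v: "v \<in> L2" and T: "0 \<le> T"
  shows "integrable lborel (\<lambda>\<xi>. exp (- decay_rate (symb \<xi>) * T) * (6 * (norm (u \<xi>))\<^sup>2 + 48 * damping (symb \<xi>) * (norm (v \<xi>))\<^sup>2))"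
proof (rule Bochner_Integration.integrable_bound)
  show "integrable lborel (\<lambda>\<xi>. 6 * (norm (u \<xi>))\<^sup>2 + 48 * (norm (v \<xi>))\<^sup>2)"
    using L2_integrable[OF u] L2_integrable[OF v] by simp
  have [measurable]: "u \<in> borel_measurable borel" "v \<in> borel_measurable borel"
    using u v by (auto dest: L2_measurable)
  show "(\<lambda>\<xi>. exp (- decay_rate (symb \<xi>) * T) * (6 * (norm (u \<xi>))\<^sup>2 + 48 * damping (symb \<xi>) * (norm (v \<xi>))\<^sup>2)) \<in> borel_measurable lborel"
    by measurable
  have "exp (- decay_rate (symb \<xi>) * T) * (6 * (norm (u \<xi>))\<^sup>2 + 48 * damping (symb \<xi>) * (norm (v \<xi>))\<^sup>2) \<le> 1 * (6 * (norm (u \<xi>))\<^sup>2 + 48 * (norm (v \<xi>))\<^sup>2)" for \<xi>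
  proof (rule mult_mono)
    show "exp (- decay_rate (symb \<xi>) * T) \<le> 1" using T decay_rate_nonneg[of "symb \<xi>"] by (auto intro: mult_nonneg_nonneg)
    show "6 * (norm (u \<xi>))\<^sup>2 + 48 * damping (symb \<xi>) * (norm (v \<xi>))\<^sup>2 \<le> 6 * (norm (u \<xi>))\<^sup>2 + 48 * (norm (v \<xi>))\<^sup>2"
      using damping_bounds(2)[OF symb_nonneg, of \<xi>] mult_right_mono[of "damping (symb \<xi>)" 1 "(norm (v \<xi>))\<^sup>2"] by simp
  qed (auto intro!: mult_nonneg_nonneg add_nonneg_nonneg less_imp_le[OF damping_bounds(1)])
  moreover have "0 \<le> exp (- decay_rate (symb \<xi>) * T) * (6 * (norm (u \<xi>))\<^sup>2 + 48 * damping (symb \<xi>) * (norm (v \<xi>))\<^sup>2)" for \<xi>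
    by (auto intro!: mult_nonneg_nonneg add_nonneg_nonneg less_imp_le[OF damping_bounds(1)])
  ultimately show "AE \<xi> in lborel. norm (exp (- decay_rate (symb \<xi>) * T) * (6 * (norm (u \<xi>))\<^sup>2 + 48 * damping (symb \<xi>) * (norm (v \<xi>))\<^sup>2)) \<le> norm (6 * (norm (u \<xi>))\<^sup>2 + 48 * (norm (v \<xi>))\<^sup>2)"
    by (intro AE_I2) (simp add: abs_of_nonneg)
qed

text \<open>With the final time \<open>T\<close> fixed, the weight is \<open>1\<close> at time
  \<open>T\<close> and exp(-c T) at time \<open>0\<close>. Monotonicity of the weighted energy
  between these times thus gives the unweighted norm on the left and the decay factor on the
  right.\<close>

theorem energy_estimate:
  fixes U V W :: "real \<Rightarrow> ('n::finite) cfun"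
  assumes U: "\<And>t. 0 \<le> t \<Longrightarrow> U t \<in> L2" and V: "\<And>t. 0 \<le> t \<Longrightarrow> V t \<in> L2"
    and dU: "\<And>t. 0 \<le> t \<Longrightarrow> L2_deriv_at U (V t) t {0..}" and dV: "\<And>t. 0 \<le> t \<Longrightarrow> L2_deriv_at V (W t) t {0..}"
    and eq: "\<And>t. 0 < t \<Longrightarrow> AE \<xi> in lborel. W t \<xi> = - complex_of_real (symb \<xi>) * U t \<xi> - complex_of_real (damping (symb \<xi>)) * V t \<xi>"
    and T: "0 \<le> T"
  shows "(L2_norm (U T))\<^sup>2 \<le> (LINT \<xi>|lborel. exp (- decay_rate (symb \<xi>) * T) * (6 * (norm (U 0 \<xi>))\<^sup>2 + 48 * damping (symb \<xi>) * (norm (V 0 \<xi>))\<^sup>2))"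
proof -
  let ?S = "{0..T}"
  let ?c = "\<lambda>\<xi>::real^'n. decay_rate (symb \<xi>)"
  let ?a1 = "\<lambda>\<xi>::real^'n. energy_coeff (symb \<xi>)"
  let ?a2 = "\<lambda>\<xi>::real^'n. energy_coeff (symb \<xi>) * (symb \<xi> + (damping (symb \<xi>))\<^sup>2 / 2)"
  let ?a3 = "\<lambda>\<xi>::real^'n. energy_coeff (symb \<xi>) * damping (symb \<xi>)"
  let ?m = "\<lambda>s \<xi>::real^'n. exp (- ?c \<xi> * (T - s))"
  have W: "W t \<in> L2" if "0 \<le> t" for t using dV[OF that] by (simp add: L2_deriv_at_def)
  have a_meas: "?a1 \<in> borel_measurable borel" "?a2 \<in> borel_measurable borel" "?a3 \<in> borel_measurable borel" by measurable
  have c_meas: "?c \<in> borel_measurable borel" by measurable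
  have a_bd: "\<bar>?a1 \<xi>\<bar> \<le> 24" "\<bar>?a2 \<xi>\<bar> \<le> 24" "\<bar>?a3 \<xi>\<bar> \<le> 24" for \<xi>
    using energy_coeffs_bounded[of "symb \<xi>"] by auto
  have c01: "0 \<le> ?c \<xi>" "?c \<xi> \<le> 1" for \<xi> by (auto intro: decay_rate_nonneg decay_rate_le_1)
  have m01: "\<bar>?m s \<xi>\<bar> \<le> 1" if "s \<in> ?S" for s \<xi> using that c01[of \<xi>] by (auto intro: mult_nonneg_nonneg)
  have am_meas: "(\<lambda>\<xi>. ?a1 \<xi> * ?m s \<xi>) \<in> borel_measurable borel" "(\<lambda>\<xi>. ?a2 \<xi> * ?m s \<xi>) \<in> borel_measurable borel" "(\<lambda>\<xi>. ?a3 \<xi> * ?m s \<xi>) \<in> borel_measurable borel" for s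
    by measurable
  have am_bd: "\<bar>?a1 \<xi> * ?m s \<xi>\<bar> \<le> 24" "\<bar>?a2 \<xi> * ?m s \<xi>\<bar> \<le> 24" "\<bar>?a3 \<xi> * ?m s \<xi>\<bar> \<le> 24" if "s \<in> ?S" for s \<xi>
    using mult_mono[OF a_bd(1) m01[OF that], of \<xi> \<xi>] mult_mono[OF a_bd(2) m01[OF that], of \<xi> \<xi>] mult_mono[OF a_bd(3) m01[OF that], of \<xi> \<xi>]
    by (simp_all only: abs_mult abs_ge_zero) simp_all
  \<comment> \<open>Kept as three bilinear integrals, to each of which
    \<open>has_derivative_weighted_inner\<close> applies.\<close>
  define F where "F s = (LINT \<xi>|lborel. (?a1 \<xi> * ?m s \<xi>) * (V s \<xi> \<bullet> V s \<xi>)) + (LINT \<xi>|lborel. (?a2 \<xi> * ?m s \<xi>) * (U s \<xi> \<bullet> U s \<xi>))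
     + (LINT \<xi>|lborel. (?a3 \<xi> * ?m s \<xi>) * (V s \<xi> \<bullet> U s \<xi>))" for s
  let ?d1 = "\<lambda>t \<xi>. (?a1 \<xi> * ?m t \<xi>) * (?c \<xi> * (V t \<xi> \<bullet> V t \<xi>) + W t \<xi> \<bullet> V t \<xi> + V t \<xi> \<bullet> W t \<xi>)"
  let ?d2 = "\<lambda>t \<xi>. (?a2 \<xi> * ?m t \<xi>) * (?c \<xi> * (U t \<xi> \<bullet> U t \<xi>) + V t \<xi> \<bullet> U t \<xi> + U t \<xi> \<bullet> V t \<xi>)"
  let ?d3 = "\<lambda>t \<xi>. (?a3 \<xi> * ?m t \<xi>) * (?c \<xi> * (V t \<xi> \<bullet> U t \<xi>) + W t \<xi> \<bullet> U t \<xi> + V t \<xi> \<bullet> V t \<xi>)"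
  have der: "(F has_real_derivative ((LINT \<xi>|lborel. ?d1 t \<xi>) + (LINT \<xi>|lborel. ?d2 t \<xi>) + (LINT \<xi>|lborel. ?d3 t \<xi>))) (at t within ?S)" if t: "t \<in> ?S" for t
  proof -
    have sub: "?S \<subseteq> {0..}" by auto
    have t0: "0 \<le> t" using t by simp
    note dU' = L2_deriv_at_subset[OF dU[OF t0] sub] and dV' = L2_deriv_at_subset[OF dV[OF t0] sub]
    have U': "\<And>s. s \<in> ?S \<Longrightarrow> U s \<in> L2" and V': "\<And>s. s \<in> ?S \<Longrightarrow> V s \<in> L2" using U V by auto
    show ?thesis unfolding F_def
      by (intro DERIV_add has_derivative_weighted_inner[OF V' V' dV' dV' a_meas(1) a_bd(1) c_meas c01 t]
        has_derivative_weighted_inner[OF U' U' dU' dU' a_meas(2) a_bd(2) c_meas c01 t]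
        has_derivative_weighted_inner[OF V' U' dV' dU' a_meas(3) a_bd(3) c_meas c01 t])
  qed
  have nonpos: "(LINT \<xi>|lborel. ?d1 t \<xi>) + (LINT \<xi>|lborel. ?d2 t \<xi>) + (LINT \<xi>|lborel. ?d3 t \<xi>) \<le> 0" if t: "0 < t" "t \<le> T" for t
  proof -
    have tS: "t \<in> ?S" and t0: "0 \<le> t" using t by auto
    note Ut = U[OF t0] and Vt = V[OF t0] and Wt = W[OF t0]
    have i: "integrable lborel (\<lambda>\<xi>. (a \<xi> * ?m t \<xi>) * (?c \<xi> * (X \<xi> \<bullet> Y \<xi>) + X' \<xi> \<bullet> Y \<xi> + X \<xi> \<bullet> Y' \<xi>))"
      if L: "X \<in> L2" "Y \<in> L2" "X' \<in> L2" "Y' \<in> L2" and a: "a \<in> borel_measurable borel" "\<And>\<xi>. \<bar>a \<xi>\<bar> \<le> 24" for a X Y X' Y'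
    proof -
      have am: "(\<lambda>\<xi>. a \<xi> * ?m t \<xi>) \<in> borel_measurable borel" "(\<lambda>\<xi>. a \<xi> * ?m t \<xi> * ?c \<xi>) \<in> borel_measurable borel"
        using a(1) by measurable
      have b1: "\<bar>a \<xi> * ?m t \<xi>\<bar> \<le> 24" for \<xi>
        using mult_mono[OF a(2) m01[OF tS], of \<xi> \<xi>] by (simp only: abs_mult abs_ge_zero) simp
      have b2: "\<bar>a \<xi> * ?m t \<xi> * ?c \<xi>\<bar> \<le> 24" for \<xi>
        using mult_mono[OF b1[of \<xi>] c01(2)[of \<xi>]] c01(1)[of \<xi>] by (simp add: abs_mult)
      have "integrable lborel (\<lambda>\<xi>. (a \<xi> * ?m t \<xi> * ?c \<xi>) * (X \<xi> \<bullet> Y \<xi>) + (a \<xi> * ?m t \<xi>) * (X' \<xi> \<bullet> Y \<xi>) + (a \<xi> * ?m t \<xi>) * (X \<xi> \<bullet> Y' \<xi>))"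
        by (intro Bochner_Integration.integrable_add integrable_weighted_inner[OF am(1) b1] integrable_weighted_inner[OF am(2) b2] L)
      then show ?thesis by (simp only: distrib_left mult.assoc)
    qed
    note i1 = i[OF Vt Vt Wt Wt a_meas(1) a_bd(1)] and i2 = i[OF Ut Ut Vt Vt a_meas(2) a_bd(2)] and i3 = i[OF Vt Ut Wt Vt a_meas(3) a_bd(3)]
    have "(LINT \<xi>|lborel. ?d1 t \<xi>) + (LINT \<xi>|lborel. ?d2 t \<xi>) + (LINT \<xi>|lborel. ?d3 t \<xi>) = (LINT \<xi>|lborel. ?d1 t \<xi> + ?d2 t \<xi> + ?d3 t \<xi>)"
      by (simp only: Bochner_Integration.integral_add[OF Bochner_Integration.integrable_add[OF i1 i2] i3] Bochner_Integration.integral_add[OF i1 i2])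
    moreover have "0 \<le> - (LINT \<xi>|lborel. ?d1 t \<xi> + ?d2 t \<xi> + ?d3 t \<xi>)"
      unfolding Bochner_Integration.integral_minus[symmetric]
    proof (rule integral_nonneg_AE)
      show "AE \<xi> in lborel. 0 \<le> - (?d1 t \<xi> + ?d2 t \<xi> + ?d3 t \<xi>)"
        using eq[OF t(1)]
      proof eventually_elim
        case (elim \<xi>)
        let ?E = "energy_coeff (symb \<xi>) * (?c \<xi> * (V t \<xi> \<bullet> V t \<xi>) + W t \<xi> \<bullet> V t \<xi> + V t \<xi> \<bullet> W t \<xi>)
          + energy_coeff (symb \<xi>) * (symb \<xi> + (damping (symb \<xi>))\<^sup>2 / 2) * (?c \<xi> * (U t \<xi> \<bullet> U t \<xi>) + V t \<xi> \<bullet> U t \<xi> + U t \<xi> \<bullet> V t \<xi>)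
          + energy_coeff (symb \<xi>) * damping (symb \<xi>) * (?c \<xi> * (V t \<xi> \<bullet> U t \<xi>) + W t \<xi> \<bullet> U t \<xi> + V t \<xi> \<bullet> V t \<xi>)"
        have "?E \<le> 0" by (rule energy_dissipation[OF symb_nonneg elim])
        then have "?m t \<xi> * ?E \<le> 0" by (rule mult_nonneg_nonpos[rotated]) simp
        moreover have "?d1 t \<xi> + ?d2 t \<xi> + ?d3 t \<xi> = ?m t \<xi> * ?E" by (simp only: distrib_left mult_ac)
        ultimately show ?case by simp
      qed
    qed
    ultimately show ?thesis by linarith
  qed
  have "F 0 \<ge> F T"
  \<comment> \<open>The equation holds for positive times only, so the sign of the derivative is
    used inside the interval; the one-sided derivatives provide continuity up to the
    endpoints.\<close>
  proof (rule DERIV_nonpos_imp_decreasing_open[OF T])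
    show "continuous_on ?S F"
      by (rule DERIV_continuous_on) (rule der)
    fix t assume t: "0 < t" "t < T"
    then have "at t within ?S = at t" by (intro at_within_Icc_at) auto
    with der[of t] nonpos[of t] t show "\<exists>y. (F has_real_derivative y) (at t) \<and> y \<le> 0" by auto
  qed
  have F_eq: "F s = (LINT \<xi>|lborel. ?m s \<xi> * energy (symb \<xi>) (U s \<xi>) (V s \<xi>))"
    and F_int: "integrable lborel (\<lambda>\<xi>. ?m s \<xi> * energy (symb \<xi>) (U s \<xi>) (V s \<xi>))" if s: "s \<in> ?S" for s
  proof -
    have s0: "0 \<le> s" using s by simp
    note i1 = integrable_weighted_inner[OF am_meas(1) am_bd(1)[OF s] V[OF s0] V[OF s0]]
      and i2 = integrable_weighted_inner[OF am_meas(2) am_bd(2)[OF s] U[OF s0] U[OF s0]]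
      and i3 = integrable_weighted_inner[OF am_meas(3) am_bd(3)[OF s] V[OF s0] U[OF s0]]
    have eq: "?m s \<xi> * energy (symb \<xi>) (U s \<xi>) (V s \<xi>) = (?a1 \<xi> * ?m s \<xi>) * (V s \<xi> \<bullet> V s \<xi>) + (?a2 \<xi> * ?m s \<xi>) * (U s \<xi> \<bullet> U s \<xi>) + (?a3 \<xi> * ?m s \<xi>) * (V s \<xi> \<bullet> U s \<xi>)" for \<xi>
      by (simp only: energy_def distrib_left mult_ac)
    show "F s = (LINT \<xi>|lborel. ?m s \<xi> * energy (symb \<xi>) (U s \<xi>) (V s \<xi>))"
      unfolding F_def eq
      by (simp only: Bochner_Integration.integral_add[OF Bochner_Integration.integrable_add[OF i1 i2] i3] Bochner_Integration.integral_add[OF i1 i2])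
    show "integrable lborel (\<lambda>\<xi>. ?m s \<xi> * energy (symb \<xi>) (U s \<xi>) (V s \<xi>))"
      unfolding eq by (intro Bochner_Integration.integrable_add i1 i2 i3)
  qed
  have T_in: "T \<in> ?S" "0 \<in> ?S" using T by auto
  have "(L2_norm (U T))\<^sup>2 \<le> F T"
    unfolding F_eq[OF T_in(1)] L2_norm_power2
  proof (rule integral_mono[OF L2_integrable[OF U[OF T]] F_int[OF T_in(1)]])
    show "(norm (U T \<xi>))\<^sup>2 \<le> ?m T \<xi> * energy (symb \<xi>) (U T \<xi>) (V T \<xi>)" for \<xi>
      using energy_lower[OF symb_nonneg, of "U T \<xi>" \<xi> "V T \<xi>"] by simp
  qed
  also have "F T \<le> F 0" by fact
  also have "F 0 \<le> (LINT \<xi>|lborel. exp (- decay_rate (symb \<xi>) * T) * (6 * (norm (U 0 \<xi>))\<^sup>2 + 48 * damping (symb \<xi>) * (norm (V 0 \<xi>))\<^sup>2))"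
    unfolding F_eq[OF T_in(2)]
  proof (rule integral_mono[OF F_int[OF T_in(2)] integrable_weighted_initial[OF U V T]])
    show "?m 0 \<xi> * energy (symb \<xi>) (U 0 \<xi>) (V 0 \<xi>) \<le> exp (- decay_rate (symb \<xi>) * T) * (6 * (norm (U 0 \<xi>))\<^sup>2 + 48 * damping (symb \<xi>) * (norm (V 0 \<xi>))\<^sup>2)" for \<xi>
      unfolding diff_zero by (intro mult_left_mono energy_upper) auto
  qed simp_all
  finally show ?thesis .
qed

section \<open>Decay of solutions\<close>

lemma Y_L2: "f \<in> Y \<delta> \<Longrightarrow> f \<in> L2"
  by (simp add: Y_def)

lemma Y_integrable: "f \<in> Y \<delta> \<Longrightarrow> integrable lborel (\<lambda>\<xi>. (1 + symb \<xi>) powr \<delta> * (norm (fourier f \<xi>))\<^sup>2)"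
  by (simp add: Y_def symb_def)

lemma Y_norm_power2: "(Y_norm \<delta> f)\<^sup>2 = (LINT \<xi>|lborel. (1 + symb \<xi>) powr \<delta> * (norm (fourier f \<xi>))\<^sup>2)"
  by (simp add: Y_norm_def symb_def)

lemma fourier_measurable: "f \<in> L2 \<Longrightarrow> fourier f \<in> borel_measurable borel"
  by (intro L2_measurable fourier_L2)

lemma Y_lincomb:
  assumes f: "f \<in> Y \<delta>" and g: "g \<in> Y \<delta>"
  shows "(\<lambda>x. a * f x + b * g x) \<in> Y \<delta>"
proof -
  let ?w = "\<lambda>\<xi>. (1 + symb \<xi>) powr \<delta>"
  note L = Y_L2[OF f] Y_L2[OF g]
  have ab: "(\<lambda>x. a * f x + b * g x) \<in> L2" by (intro L2_add L2_cmult L)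
  have [measurable]: "fourier f \<in> borel_measurable borel" "fourier g \<in> borel_measurable borel"
      "fourier (\<lambda>x. a * f x + b * g x) \<in> borel_measurable borel"
    by (intro fourier_measurable L ab)+
  have "integrable lborel (\<lambda>\<xi>. 2 * (norm a)\<^sup>2 * (?w \<xi> * (norm (fourier f \<xi>))\<^sup>2) + 2 * (norm b)\<^sup>2 * (?w \<xi> * (norm (fourier g \<xi>))\<^sup>2))"
    by (intro Bochner_Integration.integrable_add integrable_mult_right Y_integrable f g)
  then have "integrable lborel (\<lambda>\<xi>. ?w \<xi> * (norm (fourier (\<lambda>x. a * f x + b * g x) \<xi>))\<^sup>2)"
  proof (rule Bochner_Integration.integrable_bound)
    show "(\<lambda>\<xi>. ?w \<xi> * (norm (fourier (\<lambda>x. a * f x + b * g x) \<xi>))\<^sup>2) \<in> borel_measurable lborel" by measurable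
    show "AE \<xi> in lborel. norm (?w \<xi> * (norm (fourier (\<lambda>x. a * f x + b * g x) \<xi>))\<^sup>2)
      \<le> norm (2 * (norm a)\<^sup>2 * (?w \<xi> * (norm (fourier f \<xi>))\<^sup>2) + 2 * (norm b)\<^sup>2 * (?w \<xi> * (norm (fourier g \<xi>))\<^sup>2))"
      using fourier_lincomb[OF L, of a b]
    proof eventually_elim
      case (elim \<xi>)
      have "?w \<xi> * (norm (a * fourier f \<xi> + b * fourier g \<xi>))\<^sup>2 \<le> ?w \<xi> * (2 * (norm (a * fourier f \<xi>))\<^sup>2 + 2 * (norm (b * fourier g \<xi>))\<^sup>2)"
        by (intro mult_left_mono norm_add_power2_le) auto
      also have "\<dots> = 2 * (norm a)\<^sup>2 * (?w \<xi> * (norm (fourier f \<xi>))\<^sup>2) + 2 * (norm b)\<^sup>2 * (?w \<xi> * (norm (fourier g \<xi>))\<^sup>2)"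
        by (simp add: norm_mult power_mult_distrib algebra_simps)
      finally show ?case unfolding elim by simp
    qed
  qed
  then show ?thesis using ab by (simp add: Y_def symb_def)
qed

lemma L2_norm_fourier_le_Y_norm:
  assumes f: "f \<in> Y \<delta>" and \<delta>: "0 \<le> \<delta>"
  shows "L2_norm (fourier f) \<le> Y_norm \<delta> f"
proof (rule power2_le_imp_le)
  show "(L2_norm (fourier f))\<^sup>2 \<le> (Y_norm \<delta> f)\<^sup>2"
    unfolding L2_norm_power2 Y_norm_power2
  proof (rule integral_mono[OF L2_integrable[OF fourier_L2[OF Y_L2[OF f]]] Y_integrable[OF f]])
    fix \<xi> :: "real^'a"
    have "1 * (norm (fourier f \<xi>))\<^sup>2 \<le> (1 + symb \<xi>) powr \<delta> * (norm (fourier f \<xi>))\<^sup>2"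
      by (intro mult_right_mono ge_one_powr_ge_zero \<delta>) auto
    then show "(norm (fourier f \<xi>))\<^sup>2 \<le> (1 + symb \<xi>) powr \<delta> * (norm (fourier f \<xi>))\<^sup>2" by simp
  qed
  show "0 \<le> Y_norm \<delta> f" by (simp add: Y_norm_def)
qed

text \<open>Rewrites the error of a difference quotient as nested combinations of two functions, the
  shape to which \<open>fourier_lincomb\<close> and \<open>Y_lincomb\<close> apply.\<close>

lemma quotient_lincomb:
  fixes f g h c :: complex
  shows "(f - g) / c - h = 1 * (inverse c * f + (- inverse c) * g) + (- 1) * h"
  by (simp add: divide_inverse algebra_simps)

lemma fourier_quotient:
  assumes "f \<in> L2" "g \<in> L2" "h \<in> L2"
  shows "AE \<xi> in lborel. fourier (\<lambda>x. (f x - g x) / c - h x) \<xi> = (fourier f \<xi> - fourier g \<xi>) / c - fourier h \<xi>"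
proof -
  have q: "(\<lambda>x. inverse c * f x + (- inverse c) * g x) \<in> L2" by (intro L2_add L2_cmult assms)
  show ?thesis
    unfolding quotient_lincomb
    using fourier_lincomb[OF q assms(3), of 1 "-1"] fourier_lincomb[OF assms(1,2), of "inverse c" "- inverse c"]
    by eventually_elim simp
qed

lemma L2_norm_fourier_quotient:
  assumes "f \<in> L2" "g \<in> L2" "h \<in> L2"
  shows "L2_norm (\<lambda>\<xi>. (fourier f \<xi> - fourier g \<xi>) / c - fourier h \<xi>) = L2_norm (fourier (\<lambda>x. (f x - g x) / c - h x))"
proof (rule L2_norm_cong_AE)
  show "(\<lambda>\<xi>. (fourier f \<xi> - fourier g \<xi>) / c - fourier h \<xi>) \<in> borel_measurable borel"
    by (intro L2_measurable L2_diff L2_divide fourier_L2 assms)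
  show "fourier (\<lambda>x. (f x - g x) / c - h x) \<in> borel_measurable borel"
    by (intro fourier_measurable L2_diff L2_divide assms)
  show "AE \<xi> in lborel. (fourier f \<xi> - fourier g \<xi>) / c - fourier h \<xi> = fourier (\<lambda>x. (f x - g x) / c - h x) \<xi>"
    using fourier_quotient[OF assms, of c] by eventually_elim simp
qed

lemma curve_derivative_fourier_L2:
  fixes u :: "real \<Rightarrow> ('n::finite) cfun"
  assumes d: "curve_derivative L2 L2_norm u u'" and t: "0 \<le> t"
  shows "L2_deriv_at (\<lambda>t. fourier (u t)) (fourier (u' t)) t {0..}"
proof -
  let ?c = "fourier_const TYPE('n)"
  have L: "\<And>t. 0 \<le> t \<Longrightarrow> u t \<in> L2" "\<And>t. 0 \<le> t \<Longrightarrow> u' t \<in> L2" using d by (auto simp: curve_derivative_def)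
  have lim: "((\<lambda>s. L2_norm (\<lambda>x. (u s x - u t x) / complex_of_real (s - t) - u' t x)) \<longlongrightarrow> 0) (at t within {0..})"
    using d t by (simp add: curve_derivative_def)
  have eq: "L2_norm (\<lambda>\<xi>. (fourier (u s) \<xi> - fourier (u t) \<xi>) / complex_of_real (s - t) - fourier (u' t) \<xi>)
     = ?c * L2_norm (\<lambda>x. (u s x - u t x) / complex_of_real (s - t) - u' t x)" if s: "0 \<le> s" for s
    unfolding L2_norm_fourier_quotient[OF L(1)[OF s] L(1)[OF t] L(2)[OF t]]
    by (intro Plancherel L2_diff L2_divide L s t)
  have "((\<lambda>s. L2_norm (\<lambda>\<xi>. (fourier (u s) \<xi> - fourier (u t) \<xi>) / complex_of_real (s - t) - fourier (u' t) \<xi>)) \<longlongrightarrow> 0) (at t within {0..})"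
  proof (rule Lim_null_comparison)
    show "\<forall>\<^sub>F s in at t within {0..}. norm (L2_norm (\<lambda>\<xi>. (fourier (u s) \<xi> - fourier (u t) \<xi>) / complex_of_real (s - t) - fourier (u' t) \<xi>))
      \<le> ?c * L2_norm (\<lambda>x. (u s x - u t x) / complex_of_real (s - t) - u' t x)"
      unfolding eventually_at_filter using eq by (intro always_eventually) simp
    show "((\<lambda>s. ?c * L2_norm (\<lambda>x. (u s x - u t x) / complex_of_real (s - t) - u' t x)) \<longlongrightarrow> 0) (at t within {0..})"
      by (rule tendsto_mult_right_zero[OF lim])
  qed
  then show ?thesis unfolding L2_deriv_at_def using fourier_L2[OF L(2)[OF t]] by blast
qed

text \<open>The norm of \<open>Y\<close> is defined on the frequency side with a weight that is at
  least \<open>1\<close>, so it dominates the L^2 norm of the transform directly, in place of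
  Plancherel's identity.\<close>

lemma curve_derivative_fourier_Y:
  fixes u :: "real \<Rightarrow> ('n::finite) cfun"
  assumes d: "curve_derivative (Y \<delta>) (Y_norm \<delta>) u u'" and t: "0 \<le> t" and \<delta>: "0 \<le> \<delta>"
  shows "L2_deriv_at (\<lambda>t. fourier (u t)) (fourier (u' t)) t {0..}"
proof -
  have Y: "\<And>t. 0 \<le> t \<Longrightarrow> u t \<in> Y \<delta>" "\<And>t. 0 \<le> t \<Longrightarrow> u' t \<in> Y \<delta>" using d by (auto simp: curve_derivative_def)
  note L = Y_L2[OF Y(1)] Y_L2[OF Y(2)]
  have lim: "((\<lambda>s. Y_norm \<delta> (\<lambda>x. (u s x - u t x) / complex_of_real (s - t) - u' t x)) \<longlongrightarrow> 0) (at t within {0..})"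
    using d t by (simp add: curve_derivative_def)
  have le: "L2_norm (\<lambda>\<xi>. (fourier (u s) \<xi> - fourier (u t) \<xi>) / complex_of_real (s - t) - fourier (u' t) \<xi>)
     \<le> Y_norm \<delta> (\<lambda>x. (u s x - u t x) / complex_of_real (s - t) - u' t x)" if s: "0 \<le> s" for s
    unfolding L2_norm_fourier_quotient[OF L(1)[OF s] L(1)[OF t] L(2)[OF t]]
  proof (rule L2_norm_fourier_le_Y_norm[OF _ \<delta>])
    show "(\<lambda>x. (u s x - u t x) / complex_of_real (s - t) - u' t x) \<in> Y \<delta>"
      unfolding quotient_lincomb by (intro Y_lincomb Y s t)
  qed
  have "((\<lambda>s. L2_norm (\<lambda>\<xi>. (fourier (u s) \<xi> - fourier (u t) \<xi>) / complex_of_real (s - t) - fourier (u' t) \<xi>)) \<longlongrightarrow> 0) (at t within {0..})"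
  proof (rule Lim_null_comparison[OF _ lim])
    show "\<forall>\<^sub>F s in at t within {0..}. norm (L2_norm (\<lambda>\<xi>. (fourier (u s) \<xi> - fourier (u t) \<xi>) / complex_of_real (s - t) - fourier (u' t) \<xi>))
      \<le> Y_norm \<delta> (\<lambda>x. (u s x - u t x) / complex_of_real (s - t) - u' t x)"
      unfolding eventually_at_filter using le by (intro always_eventually) simp
  qed
  then show ?thesis unfolding L2_deriv_at_def using fourier_L2[OF L(2)[OF t]] by blast
qed

text \<open>Transforming \<open>h + g = v\<close> with \<open>g = L h\<close> gives (1 + m) times
  the transform of \<open>h\<close>; dividing by 1 + m identifies the resolvent with multiplication
  by \<open>damping\<close>.\<close>

lemma fourier_equation:
  fixes u :: "('n::finite) cfun"
  assumes Lu: "L_graph u Lu" and h: "IL_inv_graph v h" and w: "w \<in> L2" and eq: "AE x in lborel. w x + Lu x + h x = 0"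
  shows "AE \<xi> in lborel. fourier w \<xi> = - complex_of_real (symb \<xi>) * fourier u \<xi> - complex_of_real (damping (symb \<xi>)) * fourier v \<xi>"
proof -
  have LuL: "Lu \<in> L2" and Lu_f: "AE \<xi> in lborel. fourier Lu \<xi> = complex_of_real (symb \<xi>) * fourier u \<xi>"
    using Lu by (auto simp: L_graph_def symb_def)
  obtain g where g: "L_graph h g" and v: "v \<in> L2" and hg: "AE x in lborel. h x + g x = v x"
    using h by (auto simp: IL_inv_graph_def)
  have hL: "h \<in> L2" and gL: "g \<in> L2" and g_f: "AE \<xi> in lborel. fourier g \<xi> = complex_of_real (symb \<xi>) * fourier h \<xi>"
    using g by (auto simp: L_graph_def symb_def)
  have "fourier (\<lambda>x. 1 * h x + 1 * g x) = fourier v"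
    by (rule fourier_cong_AE) (use hg in \<open>auto intro: L2_add hL gL v\<close>)
  moreover have "AE \<xi> in lborel. fourier (\<lambda>x. 1 * h x + 1 * g x) \<xi> = 1 * fourier h \<xi> + 1 * fourier g \<xi>"
    by (rule fourier_lincomb[OF hL gL])
  ultimately have v_f: "AE \<xi> in lborel. fourier v \<xi> = fourier h \<xi> + fourier g \<xi>" by simp
  have "AE x in lborel. w x = (- 1) * Lu x + (- 1) * h x"
    using eq
  proof eventually_elim
    case (elim x)
    have "w x = (w x + Lu x + h x) - Lu x - h x" by simp
    then have "w x = 0 - Lu x - h x" by (simp only: elim)
    then show ?case by simp
  qed
  then have "fourier w = fourier (\<lambda>x. (- 1) * Lu x + (- 1) * h x)"
    by (intro fourier_cong_AE w L2_add L2_cmult LuL hL)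
  moreover have "AE \<xi> in lborel. fourier (\<lambda>x. (- 1) * Lu x + (- 1) * h x) \<xi> = (- 1) * fourier Lu \<xi> + (- 1) * fourier h \<xi>"
    by (rule fourier_lincomb[OF LuL hL])
  ultimately have w_f: "AE \<xi> in lborel. fourier w \<xi> = - fourier Lu \<xi> - fourier h \<xi>" by simp
  show ?thesis using Lu_f g_f v_f w_f
  proof eventually_elim
    case (elim \<xi>)
    have "fourier v \<xi> = complex_of_real (1 + symb \<xi>) * fourier h \<xi>" using elim(2,3) by (simp add: distrib_right)
    moreover have "damping (symb \<xi>) * (1 + symb \<xi>) = 1" using symb_nonneg[of \<xi>] by (simp add: damping_def add_nonneg_eq_0_iff)
    ultimately have "complex_of_real (damping (symb \<xi>)) * fourier v \<xi> = fourier h \<xi>"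
      by (simp only: mult.assoc[symmetric] of_real_mult[symmetric]) simp
    then show ?case using elim(1,4) by simp
  qed
qed

text \<open>The derivative of \<open>u\<close> in \<open>Y 1\<close> and that of \<open>ut\<close>
  in \<open>L2\<close> both become L^2 derivatives of transforms, which together form the first
  order system of \<open>energy_estimate\<close>. The data are attained only almost everywhere, but
  by \<open>fourier_cong_AE\<close> their transforms agree everywhere.\<close>

lemma solution_energy_estimate:
  fixes u :: "real \<Rightarrow> ('n::finite) cfun"
  assumes sol: "is_solution u0 u1 u" and u0: "u0 \<in> L2" and u1: "u1 \<in> L2" and t: "0 \<le> t"
  shows "u t \<in> L2" "(L2_norm (fourier (u t)))\<^sup>2
    \<le> (LINT \<xi>|lborel. exp (- decay_rate (symb \<xi>) * t) * (6 * (norm (fourier u0 \<xi>))\<^sup>2 + 48 * damping (symb \<xi>) * (norm (fourier u1 \<xi>))\<^sup>2))"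
proof -
  obtain ut utt where
    d1: "curve_derivative (Y 1) (Y_norm 1) u ut" and d2: "curve_derivative L2 L2_norm ut utt"
    and eq: "\<And>t. 0 < t \<Longrightarrow> \<exists>Lu h. L_graph (u t) Lu \<and> IL_inv_graph (ut t) h \<and> (AE x in lborel. utt t x + Lu x + h x = 0)"
    and i0: "AE x in lborel. u 0 x = u0 x" and i1: "AE x in lborel. ut 0 x = u1 x"
    using sol unfolding is_solution_def by blast
  have uL: "u t \<in> L2" if "0 \<le> t" for t using d1 that by (auto simp: curve_derivative_def intro: Y_L2)
  have utL: "ut t \<in> L2" and uttL: "utt t \<in> L2" if "0 \<le> t" for t using d2 that by (auto simp: curve_derivative_def)
  show "u t \<in> L2" by (rule uL[OF t])
  have "(L2_norm (fourier (u t)))\<^sup>2 \<le> (LINT \<xi>|lborel. exp (- decay_rate (symb \<xi>) * t) * (6 * (norm (fourier (u 0) \<xi>))\<^sup>2 + 48 * damping (symb \<xi>) * (norm (fourier (ut 0) \<xi>))\<^sup>2))"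
  proof (rule energy_estimate[where V="\<lambda>t. fourier (ut t)" and W="\<lambda>t. fourier (utt t)"])
    show "AE \<xi> in lborel. fourier (utt t) \<xi> = - complex_of_real (symb \<xi>) * fourier (u t) \<xi> - complex_of_real (damping (symb \<xi>)) * fourier (ut t) \<xi>" if "0 < t" for t
    proof -
      obtain Lu h where "L_graph (u t) Lu" "IL_inv_graph (ut t) h" "AE x in lborel. utt t x + Lu x + h x = 0"
        using eq[OF \<open>0 < t\<close>] by blast
      then show ?thesis using uttL[of t] that by (intro fourier_equation) auto
    qed
    show "fourier (u t) \<in> L2" "fourier (ut t) \<in> L2" if "0 \<le> t" for t by (intro fourier_L2 uL utL that)+
    show "L2_deriv_at (\<lambda>t. fourier (u t)) (fourier (ut t)) t {0..}" if "0 \<le> t" for t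
      by (rule curve_derivative_fourier_Y[OF d1 that]) simp
    show "L2_deriv_at (\<lambda>t. fourier (ut t)) (fourier (utt t)) t {0..}" if "0 \<le> t" for t
      by (rule curve_derivative_fourier_L2[OF d2 that])
  qed (rule t)
  moreover have "fourier (u 0) = fourier u0" "fourier (ut 0) = fourier u1"
    by (intro fourier_cong_AE uL utL u0 u1 i0 i1; simp)+
  ultimately show "(L2_norm (fourier (u t)))\<^sup>2
    \<le> (LINT \<xi>|lborel. exp (- decay_rate (symb \<xi>) * t) * (6 * (norm (fourier u0 \<xi>))\<^sup>2 + 48 * damping (symb \<xi>) * (norm (fourier u1 \<xi>))\<^sup>2))"
    by simp
qed

section \<open>Low and high frequency bounds\<close>

lemma norm_fourier_le_L11_norm:
  fixes f :: "('n::finite) cfun"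
  assumes f: "f \<in> L11" "f \<in> L2"
  shows "AE \<xi> in lborel. norm (fourier f \<xi>) \<le> L11_norm f"
proof -
  have i: "integrable lborel f" and i1: "integrable lborel (\<lambda>x. (1 + norm x) * norm (f x))"
    using f(1) by (auto simp: L11_def)
  have "(LINT x|lborel. norm (f x)) \<le> L11_norm f"
    unfolding L11_norm_def
    by (rule integral_mono[OF integrable_norm[OF i] i1]) (simp add: distrib_right)
  then have "norm (fourier_L1 f \<xi>) \<le> L11_norm f" for \<xi>
    using norm_fourier_L1_le[of f \<xi>] by linarith
  with fourier_eq_fourier_L1[OF i f(2)] show ?thesis by (auto elim!: eventually_mono)
qed

lemma power_le_fact_exp:
  fixes x :: real
  assumes "0 \<le> x"
  shows "x ^ n \<le> fact n * exp x"
proof -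
  have "(\<Sum>k\<in>{n}. x ^ k /\<^sub>R fact k) \<le> (\<Sum>k. x ^ k /\<^sub>R fact k)"
    by (rule sum_le_suminf[OF summable_exp_generic]) (use assms in auto)
  then have "x ^ n / fact n \<le> exp x" by (simp add: exp_def divide_inverse mult.commute)
  then show ?thesis by (simp add: divide_le_eq mult.commute)
qed

text \<open>The exponent \<open>p\<close> will be \<open>l + 1\<close>. Comparing with the integer
  power \<open>n\<close> makes the constant independent of \<open>p\<close>, and this is how the
  final constant becomes independent of \<open>l\<close>.\<close>

lemma powr_exp_bound:
  fixes s p :: real
  assumes s: "0 < s" and p: "0 \<le> p" "p \<le> real n"
  shows "s powr p * exp (- s / 4) \<le> 1 + 4 ^ n * fact n"
proof -
  have "s powr p \<le> 1 + s ^ n"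
  proof (cases "s \<le> 1")
    case True
    then have "s powr p \<le> 1" using s p by (simp add: powr_le1)
    then show ?thesis using s by (simp add: add_increasing2)
  next
    case False
    then have "s powr p \<le> s powr real n" using p by (intro powr_mono) auto
    then show ?thesis using s by (simp add: powr_realpow)
  qed
  then have "s powr p * exp (- s / 4) \<le> (1 + s ^ n) * exp (- s / 4)" by (rule mult_right_mono) simp
  also have "\<dots> = exp (- s / 4) + 4 ^ n * ((s / 4) ^ n * exp (- s / 4))"
    by (simp add: distrib_right power_divide)
  also have "\<dots> \<le> 1 + 4 ^ n * fact n"
  proof (intro add_mono mult_left_mono)
    have "(s / 4) ^ n * exp (- s / 4) \<le> (fact n * exp (s / 4)) * exp (- s / 4)"
      by (intro mult_right_mono power_le_fact_exp) (use s in auto)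
    also have "\<dots> = fact n" by (simp add: exp_minus)
    finally show "(s / 4) ^ n * exp (- s / 4) \<le> fact n" .
  qed (use s in auto)
  finally show ?thesis .
qed

text \<open>If log(1 + r) <= 1 for r = |\<xi>|^2, then 1 + r <= e <= 3 and log(1 + r) >= r / (1 + r)
  >= r / 3. With the lower bound m / 8 for the rate the exponent is at most -t r / 24, the exponent
  of a Gaussian scaled by sqrt(t / 12).\<close>

lemma decay_factor_small:
  fixes \<xi> :: "real^'n::finite"
  assumes small: "symb \<xi> \<le> 1" and t: "0 \<le> t"
  shows "exp (- decay_rate (symb \<xi>) * t) \<le> gauss (sqrt (t / 12) *\<^sub>R \<xi>)"
proof -
  let ?r = "(norm \<xi>)\<^sup>2"
  have pos: "0 < 1 + ?r" by (simp add: add_pos_nonneg)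
  have "exp (symb \<xi>) \<le> exp 1" using small by simp
  then have r: "1 + ?r \<le> 3" using pos exp_le by (simp add: symb_def)
  have "ln (inverse (1 + ?r)) \<le> inverse (1 + ?r) - 1" using pos by (intro ln_le_minus_one) simp
  then have "1 - inverse (1 + ?r) \<le> symb \<xi>" using pos by (simp add: symb_def ln_inverse)
  moreover have "1 - inverse (1 + ?r) = ?r / (1 + ?r)" using pos by (simp add: field_simps)
  moreover have "?r / 3 \<le> ?r / (1 + ?r)" by (rule divide_left_mono[OF r]) (use pos in auto)
  ultimately have "?r / 3 \<le> symb \<xi>" by linarith
  moreover have "symb \<xi> / 8 \<le> decay_rate (symb \<xi>)" by (rule decay_rate_lower_small[OF symb_nonneg small])
  ultimately have "?r / 24 \<le> decay_rate (symb \<xi>)" by linarith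
  then have "?r / 24 * t \<le> decay_rate (symb \<xi>) * t" using t by (rule mult_right_mono)
  then show ?thesis using t by (simp add: gauss_def power_mult_distrib mult.commute)
qed

lemma decay_factor_large:
  fixes \<xi> :: "real^'n::finite"
  assumes large: "1 \<le> symb \<xi>" and t: "0 < t" and p: "0 \<le> p" "p \<le> real n"
  shows "exp (- decay_rate (symb \<xi>) * t) \<le> (1 + 4 ^ n * fact n) * t powr (- p) * (1 + symb \<xi>) powr p"
proof -
  let ?b = "1 + symb \<xi>"
  have b: "0 < ?b" using large by simp
  have "damping (symb \<xi>) / 4 * t \<le> decay_rate (symb \<xi>) * t"
    using decay_rate_lower_large[OF symb_nonneg large] t by (intro mult_right_mono) auto
  then have "exp (- decay_rate (symb \<xi>) * t) \<le> exp (- (t / ?b) / 4)"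
    by (simp add: damping_def)
  \<comment> \<open>Inserting the powers \<open>p\<close> and \<open>- p\<close> of
    \<open>t / ?b\<close> leaves one factor for \<open>powr_exp_bound\<close> and one that is
    exactly the claimed power.\<close>
  also have "\<dots> = ((t / ?b) powr p * exp (- (t / ?b) / 4)) * ((t / ?b) powr (- p))"
    using b t by (simp add: powr_minus field_simps)
  also have "\<dots> \<le> (1 + 4 ^ n * fact n) * ((t / ?b) powr (- p))"
    by (intro mult_right_mono powr_exp_bound p) (use b t in auto)
  also have "(t / ?b) powr (- p) = t powr (- p) * ?b powr p"
    using b t by (simp add: powr_divide powr_minus field_simps)
  finally show ?thesis by (simp add: mult.assoc)
qed

text \<open>Both majorants are nonnegative, so their sum bounds the integrand at every frequency and
  the integral need not be split at \<open>symb \<xi> = 1\<close>.\<close>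

lemma initial_integrand_bound:
  fixes \<xi> :: "real^'n::finite"
  assumes t: "0 < t" and l: "0 \<le> l" "l + 1 \<le> real CARD('n)"
    and A: "norm a \<le> A" and B: "norm b \<le> B"
  shows "exp (- decay_rate (symb \<xi>) * t) * (6 * (norm a)\<^sup>2 + 48 * damping (symb \<xi>) * (norm b)\<^sup>2)
    \<le> 48 * (A\<^sup>2 + B\<^sup>2) * gauss (sqrt (t / 12) *\<^sub>R \<xi>)
      + 48 * (1 + 4 ^ CARD('n) * fact CARD('n)) * t powr (- (l + 1)) * ((1 + symb \<xi>) powr (l + 1) * (norm a)\<^sup>2 + (1 + symb \<xi>) powr l * (norm b)\<^sup>2)"
    (is "?E * ?I \<le> ?G + ?H")
proof (cases "symb \<xi> \<le> 1")
  case True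
  have "damping (symb \<xi>) * (norm b)\<^sup>2 \<le> 1 * B\<^sup>2"
    by (intro mult_mono power_mono B damping_bounds symb_nonneg) auto
  moreover have "(norm a)\<^sup>2 \<le> A\<^sup>2" by (intro power_mono A) auto
  ultimately have I: "?I \<le> 48 * (A\<^sup>2 + B\<^sup>2)"
    using zero_le_power2[of A] by (simp only: mult.assoc distrib_left)
  have "?E * ?I \<le> gauss (sqrt (t / 12) *\<^sub>R \<xi>) * (48 * (A\<^sup>2 + B\<^sup>2))"
    by (rule mult_mono[OF decay_factor_small[OF True] I])
      (use t damping_bounds(1)[OF symb_nonneg, of \<xi>] in auto)
  also have "\<dots> = ?G" by (rule mult.commute)
  finally have "?E * ?I \<le> ?G" .
  moreover have "0 \<le> ?H" by (auto intro!: mult_nonneg_nonneg add_nonneg_nonneg)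
  ultimately show ?thesis by linarith
next
  case False
  let ?b = "1 + symb \<xi>"
  let ?K = "1 + 4 ^ CARD('n) * fact CARD('n) :: real"
  have b: "0 < ?b" using False by simp
  have "?E * ?I \<le> (?K * t powr (- (l + 1)) * ?b powr (l + 1)) * ?I"
    using decay_factor_large[of \<xi> t "l + 1" "CARD('n)"] False t l damping_bounds(1)[OF symb_nonneg, of \<xi>]
    by (intro mult_right_mono) auto
  also have "\<dots> = ?K * t powr (- (l + 1)) * (6 * (?b powr (l + 1) * (norm a)\<^sup>2) + 48 * ((?b powr (l + 1) * damping (symb \<xi>)) * (norm b)\<^sup>2))"
    by (simp only: distrib_left mult_ac)
  \<comment> \<open>The damping factor cancels one power of \<open>?b\<close>, so the initial
    velocity is needed in \<open>Y l\<close> only.\<close>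
  also have "?b powr (l + 1) * damping (symb \<xi>) = ?b powr l"
    using b by (simp add: powr_add damping_def)
  also have "?K * t powr (- (l + 1)) * (6 * (?b powr (l + 1) * (norm a)\<^sup>2) + 48 * (?b powr l * (norm b)\<^sup>2))
    \<le> ?K * t powr (- (l + 1)) * (48 * (?b powr (l + 1) * (norm a)\<^sup>2) + 48 * (?b powr l * (norm b)\<^sup>2))"
    by (intro mult_left_mono add_right_mono mult_right_mono) auto
  also have "\<dots> = ?H" by (simp only: distrib_left mult_ac)
  finally have "?E * ?I \<le> ?H" .
  moreover have "0 \<le> ?G" by (auto intro!: mult_nonneg_nonneg)
  ultimately show ?thesis by linarith
qed

lemma solution_decay:
  fixes u :: "real \<Rightarrow> ('n::finite) cfun"
  assumes sol: "is_solution u0 u1 u" and l: "0 \<le> l" "l \<le> real CARD('n) / 2 - 1"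
    and u0: "u0 \<in> L11" "u0 \<in> Y (l + 1)" and u1: "u1 \<in> L11" "u1 \<in> Y l" and t: "1 \<le> t"
  shows "(fourier_const TYPE('n) * L2_norm (u t))\<^sup>2
    \<le> 48 * (sqrt (24 * pi) ^ CARD('n) + (1 + 4 ^ CARD('n) * fact CARD('n))) * t powr (- (l + 1)) * (I0 l u0 u1)\<^sup>2"
proof -
  let ?K = "1 + 4 ^ CARD('n) * fact CARD('n) :: real"
  let ?A = "L11_norm u0" and ?B = "L11_norm u1"
  let ?P = "(Y_norm (l + 1) u0)\<^sup>2 + (Y_norm l u1)\<^sup>2"
  let ?g = "\<lambda>\<xi>::real^'n. gauss (sqrt (t / 12) *\<^sub>R \<xi>)"
  let ?h = "\<lambda>\<xi>. (1 + symb \<xi>) powr (l + 1) * (norm (fourier u0 \<xi>))\<^sup>2 + (1 + symb \<xi>) powr l * (norm (fourier u1 \<xi>))\<^sup>2"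
  have t0: "0 < t" "0 \<le> t" using t by auto
  note L = Y_L2[OF u0(2)] Y_L2[OF u1(2)]
  have gi: "integrable lborel ?g" by (rule integrable_gauss) (use t0 in simp)
  have hi: "integrable lborel ?h" by (intro Bochner_Integration.integrable_add Y_integrable u0 u1)
  have hI: "(LINT \<xi>|lborel. ?h \<xi>) = ?P"
    unfolding Y_norm_power2 by (intro Bochner_Integration.integral_add Y_integrable u0 u1)
  have "(LINT \<xi>|lborel. ?g \<xi>) = (sqrt (2 * pi) / sqrt (t / 12)) ^ CARD('n)"
    using integral_gauss[of "sqrt (t / 12)", where ?'a="real^'n"] t0 by simp
  also have "sqrt (2 * pi) / sqrt (t / 12) = sqrt (24 * pi) * t powr (- (1 / 2))"
    using t0 by (simp add: powr_minus powr_half_sqrt real_sqrt_divide[symmetric] real_sqrt_mult[symmetric] divide_inverse[symmetric])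
  also have "(sqrt (24 * pi) * t powr (- (1 / 2))) ^ CARD('n) = sqrt (24 * pi) ^ CARD('n) * t powr (- (real CARD('n) / 2))"
    using t0 by (simp add: power_mult_distrib powr_realpow[symmetric] powr_powr)
  \<comment> \<open>The upper bound on \<open>l\<close> and \<open>1 \<le> t\<close> are what allow
    passing from t^(-n/2) to the slower power.\<close>
  also have "\<dots> \<le> sqrt (24 * pi) ^ CARD('n) * t powr (- (l + 1))"
    using t l by (intro mult_left_mono powr_mono) auto
  finally have gI: "(LINT \<xi>|lborel. ?g \<xi>) \<le> sqrt (24 * pi) ^ CARD('n) * t powr (- (l + 1))" .
  have "(fourier_const TYPE('n) * L2_norm (u t))\<^sup>2 = (L2_norm (fourier (u t)))\<^sup>2"
    using Plancherel[OF solution_energy_estimate(1)[OF sol L t0(2)]] by simp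
  also have "\<dots> \<le> (LINT \<xi>|lborel. exp (- decay_rate (symb \<xi>) * t) * (6 * (norm (fourier u0 \<xi>))\<^sup>2 + 48 * damping (symb \<xi>) * (norm (fourier u1 \<xi>))\<^sup>2))"
    by (rule solution_energy_estimate(2)[OF sol L t0(2)])
  also have "\<dots> \<le> (LINT \<xi>|lborel. 48 * (?A\<^sup>2 + ?B\<^sup>2) * ?g \<xi> + 48 * ?K * t powr (- (l + 1)) * ?h \<xi>)"
  proof (rule integral_mono_AE)
    show "integrable lborel (\<lambda>\<xi>. exp (- decay_rate (symb \<xi>) * t) * (6 * (norm (fourier u0 \<xi>))\<^sup>2 + 48 * damping (symb \<xi>) * (norm (fourier u1 \<xi>))\<^sup>2))"
      by (intro integrable_weighted_initial fourier_L2 L t0)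
    show "integrable lborel (\<lambda>\<xi>. 48 * (?A\<^sup>2 + ?B\<^sup>2) * ?g \<xi> + 48 * ?K * t powr (- (l + 1)) * ?h \<xi>)"
      by (intro Bochner_Integration.integrable_add integrable_mult_right gi hi)
    show "AE \<xi> in lborel. exp (- decay_rate (symb \<xi>) * t) * (6 * (norm (fourier u0 \<xi>))\<^sup>2 + 48 * damping (symb \<xi>) * (norm (fourier u1 \<xi>))\<^sup>2)
      \<le> 48 * (?A\<^sup>2 + ?B\<^sup>2) * ?g \<xi> + 48 * ?K * t powr (- (l + 1)) * ?h \<xi>"
      using norm_fourier_le_L11_norm[OF u0(1) L(1)] norm_fourier_le_L11_norm[OF u1(1) L(2)]
      by eventually_elim (rule initial_integrand_bound; use t0 l in simp)
  qed
  also have "\<dots> = 48 * (?A\<^sup>2 + ?B\<^sup>2) * (LINT \<xi>|lborel. ?g \<xi>) + 48 * ?K * t powr (- (l + 1)) * ?P"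
    unfolding hI[symmetric]
    by (subst Bochner_Integration.integral_add[OF integrable_mult_right[OF gi] integrable_mult_right[OF hi]])
      (simp only: integral_mult_right_zero)
  also have "\<dots> \<le> 48 * (?A\<^sup>2 + ?B\<^sup>2) * (sqrt (24 * pi) ^ CARD('n) * t powr (- (l + 1))) + 48 * ?K * t powr (- (l + 1)) * ?P"
    by (intro add_right_mono mult_left_mono gI) simp
  also have "\<dots> = 48 * t powr (- (l + 1)) * (sqrt (24 * pi) ^ CARD('n) * (?A\<^sup>2 + ?B\<^sup>2) + ?K * ?P)"
    by (simp only: distrib_left mult_ac)
  \<comment> \<open>Both groups of data receive the sum of the two constants, so that their squares
    combine into that of \<open>I0\<close>.\<close>
  also have "\<dots> \<le> 48 * t powr (- (l + 1)) * ((sqrt (24 * pi) ^ CARD('n) + ?K) * (?A\<^sup>2 + ?B\<^sup>2) + (sqrt (24 * pi) ^ CARD('n) + ?K) * ?P)"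
    by (rule mult_left_mono[OF add_mono[OF mult_right_mono mult_right_mono]]) auto
  also have "\<dots> = 48 * (sqrt (24 * pi) ^ CARD('n) + ?K) * t powr (- (l + 1)) * (I0 l u0 u1)\<^sup>2"
  proof -
    have "(I0 l u0 u1)\<^sup>2 = (?A\<^sup>2 + ?B\<^sup>2) + ?P" by (simp add: I0_def)
    then show ?thesis by (simp only: distrib_left mult_ac)
  qed
  finally show ?thesis .
qed

theorem theorem1p4:
  assumes "CARD('n::finite) \<ge> 4"
  shows "\<exists>C>0. \<exists>T>0. \<forall>(l::real) (u0 :: 'n cfun) (u1 :: 'n cfun) (u :: real \<Rightarrow> 'n cfun).
     1 \<le> l \<longrightarrow> l \<le> real CARD('n) / 2 - 1 \<longrightarrow>
     u0 \<in> L11 \<inter> Y (l + 1) \<longrightarrow> u1 \<in> L11 \<inter> Y l \<longrightarrow> is_solution u0 u1 u \<longrightarrow>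
     (\<forall>t\<ge>T. L2_norm (u t) \<le> C * I0 l u0 u1 * t powr (- (l + 1) / 2))"
proof -
  \<comment> \<open>The constant of \<open>solution_decay\<close> for squared norms. It contains
    neither \<open>l\<close> nor the data, so \<open>C = sqrt D / ?c\<close> depends on the
    dimension alone; the time threshold is \<open>1\<close>.\<close>
  define D where "D = 48 * (sqrt (24 * pi) ^ CARD('n) + (1 + 4 ^ CARD('n) * fact CARD('n)))"
  have D: "D > 0" unfolding D_def by (intro mult_pos_pos add_pos_pos zero_less_power) auto
  let ?c = "fourier_const TYPE('n)"
  have "L2_norm (u t) \<le> sqrt D / ?c * I0 l u0 u1 * t powr (- (l + 1) / 2)"
    if "1 \<le> l" "l \<le> real CARD('n) / 2 - 1" "u0 \<in> L11 \<inter> Y (l + 1)" "u1 \<in> L11 \<inter> Y l" "is_solution u0 u1 u" "1 \<le> t"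
    for l and u0 u1 :: "'n cfun" and u :: "real \<Rightarrow> 'n cfun" and t
  proof -
    have "(?c * L2_norm (u t))\<^sup>2 \<le> D * t powr (- (l + 1)) * (I0 l u0 u1)\<^sup>2"
      unfolding D_def using that by (intro solution_decay) auto
    also have "t powr (- (l + 1)) = (t powr (- (l + 1) / 2))\<^sup>2"
      by (simp only: power2_eq_square powr_add[symmetric] field_sum_of_halves)
    also have "D * (t powr (- (l + 1) / 2))\<^sup>2 * (I0 l u0 u1)\<^sup>2 = (sqrt D * I0 l u0 u1 * t powr (- (l + 1) / 2))\<^sup>2"
      using D by (simp add: power_mult_distrib)
    finally have "?c * L2_norm (u t) \<le> sqrt D * I0 l u0 u1 * t powr (- (l + 1) / 2)"
      by (rule power2_le_imp_le) (use D in \<open>simp add: I0_def\<close>)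
    then show ?thesis by (simp add: field_simps)
  qed
  moreover have "sqrt D / ?c > 0" using D by simp
  ultimately show ?thesis
    by (intro exI[of _ "sqrt D / ?c"] exI[of _ "1::real"] conjI allI impI zero_less_one)
qed

end
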